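(* Let $J\neq F_n^\infty$ be a WOT-closed two-sided ideal of $F_n^\infty$ generated by a family of polynomials $\mathcal P_J$. Let $T:=[T_1,\ldots,T_n]$, $T_i\in B(\mathcal H)$, be a $J$-constrained row contraction. Then $$I_{\mathcal N_J\otimes\mathcal D_T}-\Theta_{J,T}\Theta_{J,T}^*=K_{J,T}K_{J,T}^*,$$ where $\Theta_{J,T}$ is the constrained characteristic function of $T$ and $K_{J,T}$ is the corresponding constrained Poisson kernel.
   Context: Let $n\in\{1,2,\dots\}$ and let $F^2(H_n)=\bigoplus_{k\ge 0}H_n^{\otimes k}$ be the full Fock space of an $n$-dimensional complex Hilbert space $H_n$ with orthonormal basis $e_1,\dots,e_n$ (with $H_n^{\otimes 0}=\mathbb C1$). Left and right creation operators: $S_i\varphi=e_i\otimes\varphi$, $R_i\varphi=\varphi\otimes e_i$. $F_n^\infty\subset B(F^2(H_n))$ is the WOT-closed algebra generated by $S_1,\dots,S_n$ and the identity. Polynomials in $F_n^\infty$ are operators $p(S_1,\dots,S_n)$, $p$ a noncommutative polynomial; "generated by $\mathcal P_J$" means $J$ is the smallest WOT-closed two-sided ideal containing $\mathcal P_J$. Put $\mathcal N_J=F^2(H_n)\ominus\overline{JF^2(H_n)}$, $B_i=P_{\mathcal N_J}S_i|_{\mathcal N_J}$, $W_i=P_{\mathcal N_J}R_i|_{\mathcal N_J}$. $\mathbb F_n^+$ is the unital free semigroup on $g_1,\dots,g_n$; $T_\alpha=T_{i_1}\cdots T_{i_k}$, $e_\alpha=e_{i_1}\otimes\cdots\otimes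 e_{i_k}$ for $\alpha=g_{i_1}\cdots g_{i_k}$, with $T_{g_0}=I$, $e_{g_0}=1$ for the neutral element. $T$ is a row contraction if $TT^*=\sum_iT_iT_i^*\le I$ ($T$ viewed as an operator $\mathcal H^{(n)}\to\mathcal H$); it is $J$-constrained if $p(T_1,\dots,T_n)=0$ for all $p\in\mathcal P_J$. Set $\Delta_T=(I-TT^* )^{1/2}$, $\Delta_{T^*}=(I-T^*T)^{1/2}\in B(\mathcal H^{(n)})$, $\mathcal D_T=\overline{\Delta_T\mathcal H}$, $\mathcal D_{T^*}=\overline{\Delta_{T^*}\mathcal H^{(n)}}$. The Poisson kernel is $K_T:\mathcal H\to F^2(H_n)\otimes\mathcal D_T$, $K_Th=\sum_{\alpha\in\mathbb F_n^+}e_\alpha\otimes\Delta_TT_\alpha^*h$, and the constrained Poisson kernel is $K_{J,T}=(P_{\mathcal N_J}\otimes I_{\mathcal D_T})K_T:\mathcal H\to\mathcal N_J\otimes\mathcal D_T$. The constrained characteristic function $\Theta_{J,T}:\mathcal N_J\otimes\mathcal D_{T^*}\to\mathcal N_J\otimes\mathcal D_T$ is the bounded operator with formal Fourier representation $$-I_{\mathcal N_J}\otimes T+(I_{\mathcal N_J}\otimes\Delta_T)\Big(I-\sum_{i=1}^nW_i\otimes T_i^*\Big)^{-1}[W_1\otimes I_{\mathcal H},\dots,W_n\otimes I_{\mathcal H}](I_{\mathcal N_J}\otimes\Delta_{T^*}),$$ understood as the SOT-limit as $r\to1$, $r<1$, of the expressions with each $W_i$ replaced by $rW_i$. Equivalently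 $\Theta_{J,T}=P_{\mathcal N_J\otimes\mathcal D_T}\Theta_T|_{\mathcal N_J\otimes\mathcal D_{T^*}}$, where $\Theta_T:F^2(H_n)\otimes\mathcal D_{T^*}\to F^2(H_n)\otimes\mathcal D_T$ is given by the same formula with $R_i$ in place of $W_i$ and $F^2(H_n)$ in place of $\mathcal N_J$. *)

theory Defs
  imports "HOL-Analysis.Analysis" "HOL-Library.Poly_Mapping"
begin

section \<open>Complex Hilbert spaces\<close>

text \<open>The inner product is linear in the first argument; its real part is the real inner
  product of the underlying real Hilbert space, so norm and topology are the usual ones.\<close>

class chilbert_space = real_inner + complete_space +
  fixes scaleC :: "complex \<Rightarrow> 'a \<Rightarrow> 'a" (infixr "*\<^sub>C" 75)
    and cinner :: "'a \<Rightarrow> 'a \<Rightarrow> complex"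
  assumes scaleC_add_right: "c *\<^sub>C (x + y) = c *\<^sub>C x + c *\<^sub>C y"
    and scaleC_add_left: "(c + d) *\<^sub>C x = c *\<^sub>C x + d *\<^sub>C x"
    and scaleC_scaleC: "c *\<^sub>C d *\<^sub>C x = (c * d) *\<^sub>C x"
    and scaleC_of_real: "complex_of_real r *\<^sub>C x = r *\<^sub>R x"
    and cinner_commute: "cinner x y = cnj (cinner y x)"
    and cinner_add_left: "cinner (x + y) z = cinner x z + cinner y z"
    and cinner_scaleC_left: "cinner (c *\<^sub>C x) y = c * cinner x y"
    and Re_cinner: "Re (cinner x y) = inner x y"

lemma cinner_self: "cinner x x = complex_of_real ((norm x)\<^sup>2)"
  for x :: "'a::chilbert_space"
proof (rule complex_eqI)
  show "Re (cinner x x) = Re (complex_of_real ((norm x)\<^sup>2))"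
    by (simp add: Re_cinner power2_norm_eq_inner)
  have "Im (cinner x x) = - Im (cinner x x)"
    by (metis cinner_commute cnj.simps(2))
  then show "Im (cinner x x) = Im (complex_of_real ((norm x)\<^sup>2))"
    by simp
qed

lemma norm_scaleC: "norm (c *\<^sub>C x) = cmod c * norm x"
  for x :: "'a::chilbert_space"
proof -
  have "complex_of_real ((norm (c *\<^sub>C x))\<^sup>2) = c * cnj (c * cinner x x)"
    by (metis cinner_self cinner_scaleC_left cinner_commute)
  also have "\<dots> = (c * cnj c) * complex_of_real ((norm x)\<^sup>2)"
    by (simp add: cinner_self)
  also have "\<dots> = complex_of_real ((cmod c * norm x)\<^sup>2)"
    by (simp add: complex_norm_square[symmetric] power_mult_distrib)
  finally have "(norm (c *\<^sub>C x))\<^sup>2 = (cmod c * norm x)\<^sup>2"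
    using of_real_eq_iff by blast
  then show ?thesis by (simp add: power2_eq_iff_nonneg)
qed

lemma norm_cinner_le: "cmod (cinner x y) \<le> norm x * norm y"
  for x y :: "'a::chilbert_space"
proof (cases "cinner x y = 0")
  case False
  define c where "c = cnj (sgn (cinner x y))"
  have c1: "cmod c = 1" using False by (simp add: c_def norm_sgn)
  have "c * cinner x y = complex_of_real (cmod (cinner x y))"
    using False unfolding c_def sgn_div_norm
    by (simp add: scaleR_conv_of_real field_simps)
      (simp add: complex_norm_square[symmetric] flip: of_real_mult power2_eq_square)
  then have "cmod (cinner x y) = Re (cinner (c *\<^sub>C x) y)"
    by (simp add: cinner_scaleC_left)
  also have "\<dots> = inner (c *\<^sub>C x) y" by (rule Re_cinner)
  also have "\<dots> \<le> norm (c *\<^sub>C x) * norm y" by (rule norm_cauchy_schwarz)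
  finally show ?thesis by (simp add: norm_scaleC c1)
qed simp

lemma scaleC_zero_right: "c *\<^sub>C 0 = (0 :: 'a::chilbert_space)"
  using norm_scaleC[of c "0::'a"] by simp

instantiation complex :: chilbert_space
begin

definition "scaleC_complex c (x::complex) = c * x"
definition "cinner_complex (x::complex) y = x * cnj y"

instance
  by standard (auto simp: scaleC_complex_def cinner_complex_def algebra_simps inner_complex_def
      scaleR_conv_of_real)

end

text \<open>The direct sum \<open>H\<^sup>(\<^sup>n\<^sup>)\<close> of \<open>n\<close> copies of \<open>H\<close> is the library type \<open>'h ^ 'n\<close>.\<close>

instantiation vec :: (chilbert_space, finite) chilbert_space
begin

definition "scaleC_vec c (x :: 'a ^ 'b) = (\<chi> i. c *\<^sub>C (x $ i))"
definition "cinner_vec (x :: 'a ^ 'b) y = (\<Sum>i\<in>UNIV. cinner (x $ i) (y $ i))"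

instance
proof
  fix x y z :: "'a ^ 'b" and c d :: complex and r :: real
  show "cinner x y = cnj (cinner y x)"
    unfolding cinner_vec_def cnj_sum by (intro sum.cong refl cinner_commute)
qed (auto simp: scaleC_vec_def cinner_vec_def vec_eq_iff scaleC_add_right scaleC_add_left
    scaleC_scaleC scaleC_of_real cinner_add_left cinner_scaleC_left sum.distrib
    sum_distrib_left inner_vec_def Re_cinner)

end


section \<open>Square-summable families\<close>

definition square_summable :: "('i \<Rightarrow> 'a::real_normed_vector) \<Rightarrow> bool" where
  "square_summable f \<longleftrightarrow> (\<lambda>i. (norm (f i))\<^sup>2) summable_on UNIV"

lemma square_summable_add:
  assumes "square_summable f" "square_summable g"
  shows "square_summable (\<lambda>i. f i + g i)"
  unfolding square_summable_def
proof (rule summable_on_comparison_test)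
  show "(\<lambda>i. 2 * (norm (f i))\<^sup>2 + 2 * (norm (g i))\<^sup>2) summable_on UNIV"
    using assms unfolding square_summable_def
    by (intro summable_on_add summable_on_cmult_right) auto
  fix i
  have "(norm (f i + g i))\<^sup>2 \<le> (norm (f i) + norm (g i))\<^sup>2"
    by (intro power_mono norm_triangle_ineq norm_ge_zero)
  also have "\<dots> \<le> 2 * (norm (f i))\<^sup>2 + 2 * (norm (g i))\<^sup>2"
    using sum_squares_bound[of "norm (f i)" "norm (g i)"]
    by (simp add: power2_eq_square algebra_simps)
  finally show "(norm (f i + g i))\<^sup>2 \<le> 2 * (norm (f i))\<^sup>2 + 2 * (norm (g i))\<^sup>2" .
qed simp

lemma square_summable_scale:
  assumes "square_summable f" "\<And>i. norm (g i) = k * norm (f i)"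
  shows "square_summable g"
  using assms unfolding square_summable_def
  by (simp add: power_mult_distrib summable_on_cmult_right)

lemma square_summable_dominated:
  assumes "square_summable f" "square_summable g"
    "\<And>i. norm (h i) \<le> norm (f i) * norm (g i)"
  shows "(\<lambda>i. h i :: 'b::banach) summable_on UNIV"
proof (rule abs_summable_summable, rule summable_on_comparison_test)
  show "(\<lambda>i. (norm (f i))\<^sup>2 + (norm (g i))\<^sup>2) summable_on UNIV"
    using assms(1,2) unfolding square_summable_def by (intro summable_on_add) auto
  fix i
  have "norm (f i) * norm (g i) \<le> (norm (f i))\<^sup>2 + (norm (g i))\<^sup>2"
    using sum_squares_bound[of "norm (f i)" "norm (g i)"]
      zero_le_power2[of "norm (f i)"] zero_le_power2[of "norm (g i)"]
      mult_nonneg_nonneg[OF norm_ge_zero norm_ge_zero, of "f i" "g i"]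
    by linarith
  then show "norm (h i) \<le> (norm (f i))\<^sup>2 + (norm (g i))\<^sup>2"
    using assms(3)[of i] by linarith
qed simp

lemma square_summable_reindex:
  assumes "square_summable f" "inj_on h A" "\<And>x. x \<in> A \<Longrightarrow> g x = f (h x)"
    "\<And>x. x \<notin> A \<Longrightarrow> g x = 0"
  shows "square_summable g"
proof -
  have "(\<lambda>i. (norm (f i))\<^sup>2) summable_on (h ` A)"
    using assms(1) unfolding square_summable_def
    by (rule summable_on_subset_banach) simp
  then have "((\<lambda>i. (norm (f i))\<^sup>2) \<circ> h) summable_on A"
    by (simp add: summable_on_reindex[OF assms(2)])
  then have "(\<lambda>i. (norm (g i))\<^sup>2) summable_on A"
    by (rule summable_on_cong[THEN iffD1, rotated]) (simp add: assms(3))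
  then show ?thesis
    unfolding square_summable_def
    by (rule summable_on_cong_neutral[THEN iffD1, rotated -1]) (auto simp: assms(4))
qed

typedef (overloaded) ('i, 'a) ell2 = "{f :: 'i \<Rightarrow> 'a::chilbert_space. square_summable f}"
  morphisms coeff Abs_ell2
  by (rule exI[of _ "\<lambda>_. 0"]) (simp add: square_summable_def)

setup_lifting type_definition_ell2

lemma coeff_square_summable: "square_summable (coeff x)"
  using coeff[of x] by simp

lemma ell2_inner_summable: "(\<lambda>i. inner (coeff x i) (coeff y i)) summable_on UNIV"
  by (rule square_summable_dominated[OF coeff_square_summable[of x] coeff_square_summable[of y]])
    (simp add: Cauchy_Schwarz_ineq2)

lemma ell2_cinner_summable: "(\<lambda>i. cinner (coeff x i) (coeff y i)) summable_on UNIV"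
  by (rule square_summable_dominated[OF coeff_square_summable[of x] coeff_square_summable[of y]])
    (simp add: norm_cinner_le)

instantiation ell2 :: (type, chilbert_space) real_inner
begin

lift_definition zero_ell2 :: "('a, 'b) ell2" is "\<lambda>_. 0"
  by (simp add: square_summable_def)
lift_definition plus_ell2 :: "('a, 'b) ell2 \<Rightarrow> ('a, 'b) ell2 \<Rightarrow> ('a, 'b) ell2"
  is "\<lambda>f g i. f i + g i"
  by (rule square_summable_add)
lift_definition uminus_ell2 :: "('a, 'b) ell2 \<Rightarrow> ('a, 'b) ell2" is "\<lambda>f i. - f i"
  by (simp add: square_summable_def)
lift_definition minus_ell2 :: "('a, 'b) ell2 \<Rightarrow> ('a, 'b) ell2 \<Rightarrow> ('a, 'b) ell2"
  is "\<lambda>f g i. f i - g i"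
  subgoal for f g
    using square_summable_add[of f "\<lambda>i. - g i"] by (simp add: square_summable_def)
  done
lift_definition scaleR_ell2 :: "real \<Rightarrow> ('a, 'b) ell2 \<Rightarrow> ('a, 'b) ell2"
  is "\<lambda>r f i. r *\<^sub>R f i"
  by (erule square_summable_scale) (rule norm_scaleR)

definition inner_ell2 :: "('a, 'b) ell2 \<Rightarrow> ('a, 'b) ell2 \<Rightarrow> real" where
  "inner_ell2 x y = (\<Sum>\<^sub>\<infinity>i. inner (coeff x i) (coeff y i))"
definition norm_ell2 :: "('a, 'b) ell2 \<Rightarrow> real" where
  "norm_ell2 x = sqrt (inner x x)"
definition sgn_ell2 :: "('a, 'b) ell2 \<Rightarrow> ('a, 'b) ell2" where
  "sgn_ell2 x = inverse (norm x) *\<^sub>R x"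
definition dist_ell2 :: "('a, 'b) ell2 \<Rightarrow> ('a, 'b) ell2 \<Rightarrow> real" where
  "dist_ell2 x y = norm (x - y)"
definition uniformity_ell2 :: "(('a, 'b) ell2 \<times> ('a, 'b) ell2) filter" where
  "uniformity_ell2 = (INF e\<in>{0<..}. principal {(x, y). dist x y < e})"
definition open_ell2 :: "('a, 'b) ell2 set \<Rightarrow> bool" where
  "open_ell2 U \<longleftrightarrow> (\<forall>x\<in>U. eventually (\<lambda>(x', y). x' = x \<longrightarrow> y \<in> U) uniformity)"

instance
proof
  fix x y z :: "('a, 'b) ell2" and r s :: real and U :: "('a, 'b) ell2 set"
  show "x + y + z = x + (y + z)" by transfer (simp add: algebra_simps)
  show "x + y = y + x" by transfer (simp add: algebra_simps)
  show "0 + x = x" by transfer simp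
  show "- x + x = 0" by transfer simp
  show "x - y = x + - y" by transfer simp
  show "r *\<^sub>R (x + y) = r *\<^sub>R x + r *\<^sub>R y" by transfer (simp add: algebra_simps)
  show "(r + s) *\<^sub>R x = r *\<^sub>R x + s *\<^sub>R x" by transfer (simp add: algebra_simps)
  show "r *\<^sub>R s *\<^sub>R x = (r * s) *\<^sub>R x" by transfer simp
  show "1 *\<^sub>R x = x" by transfer simp
  show "sgn x = inverse (norm x) *\<^sub>R x" by (rule sgn_ell2_def)
  show "dist x y = norm (x - y)" by (rule dist_ell2_def)
  show "uniformity = (INF e\<in>{0<..}. principal {(x, y :: ('a, 'b) ell2). dist x y < e})"
    by (rule uniformity_ell2_def)
  show "open U \<longleftrightarrow> (\<forall>x\<in>U. eventually (\<lambda>(x', y). x' = x \<longrightarrow> y \<in> U) uniformity)"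
    by (rule open_ell2_def)
  show "inner x y = inner y x" by (simp add: inner_ell2_def inner_commute)
  show "inner (x + y) z = inner x z + inner y z"
    unfolding inner_ell2_def plus_ell2.rep_eq inner_add_left
    by (intro infsum_add ell2_inner_summable)
  show "inner (r *\<^sub>R x) y = r * inner x y"
    unfolding inner_ell2_def scaleR_ell2.rep_eq inner_scaleR_left
    by (rule infsum_cmult_right')
  show "0 \<le> inner x x" unfolding inner_ell2_def by (intro infsum_nonneg) simp
  show "inner x x = 0 \<longleftrightarrow> x = 0"
  proof
    assume 0: "inner x x = 0"
    have "inner (coeff x i) (coeff x i) = 0" for i
    proof (rule nonneg_infsum_le_0D[where A = UNIV and f = "\<lambda>i. inner (coeff x i) (coeff x i)"])
      show "(\<Sum>\<^sub>\<infinity>i. inner (coeff x i) (coeff x i)) \<le> 0" using 0 by (simp add: inner_ell2_def)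
    qed (auto intro: ell2_inner_summable)
    then show "x = 0"
      by (simp add: coeff_inject[symmetric] zero_ell2.rep_eq fun_eq_iff)
  qed (simp add: inner_ell2_def zero_ell2.rep_eq)
  show "norm x = sqrt (inner x x)" by (rule norm_ell2_def)
qed

end

lemma norm_ell2_sq: "(norm x)\<^sup>2 = (\<Sum>\<^sub>\<infinity>i. (norm (coeff x i))\<^sup>2)"
  by (simp add: power2_norm_eq_inner inner_ell2_def)

lemma sum_le_norm_ell2_sq: "finite F \<Longrightarrow> (\<Sum>i\<in>F. (norm (coeff x i))\<^sup>2) \<le> (norm x)\<^sup>2"
  unfolding norm_ell2_sq
  by (rule finite_sum_le_infsum) (use coeff_square_summable[of x] in \<open>auto simp: square_summable_def\<close>)

lemma norm_coeff_le: "norm (coeff x i) \<le> norm x"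
  using sum_le_norm_ell2_sq[of "{i}" x] by (simp add: power2_le_iff_abs_le)

instance ell2 :: (type, chilbert_space) complete_space
proof
  fix X :: "nat \<Rightarrow> ('a, 'b) ell2"
  assume X: "Cauchy X"
  have "Cauchy (\<lambda>m. coeff (X m) i)" for i
  proof (rule metric_CauchyI)
    fix e :: real assume "e > 0"
    then obtain M where M: "\<forall>m\<ge>M. \<forall>n\<ge>M. dist (X m) (X n) < e"
      using X unfolding Cauchy_def by blast
    have "dist (coeff (X m) i) (coeff (X n) i) \<le> dist (X m) (X n)" for m n
      using norm_coeff_le[of "X m - X n" i] by (simp add: dist_norm minus_ell2.rep_eq)
    then show "\<exists>M. \<forall>m\<ge>M. \<forall>n\<ge>M. dist (coeff (X m) i) (coeff (X n) i) < e"
      using M by (meson le_less_trans)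
  qed
  then have "\<forall>i. \<exists>l. (\<lambda>m. coeff (X m) i) \<longlonglongrightarrow> l"
    by (simp add: Cauchy_convergent_iff convergent_def)
  then obtain f where f: "\<And>i. (\<lambda>m. coeff (X m) i) \<longlonglongrightarrow> f i" by metis
  have key: "\<exists>M. \<forall>m\<ge>M. \<forall>F. finite F \<longrightarrow> (\<Sum>i\<in>F. (norm (coeff (X m) i - f i))\<^sup>2) \<le> e\<^sup>2"
    if "e > 0" for e :: real
  proof -
    obtain M where M: "\<forall>m\<ge>M. \<forall>n\<ge>M. dist (X m) (X n) < e"
      using X \<open>e > 0\<close> unfolding Cauchy_def by blast
    have "(\<Sum>i\<in>F. (norm (coeff (X m) i - f i))\<^sup>2) \<le> e\<^sup>2" if "m \<ge> M" "finite F" for m F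
    proof (rule LIMSEQ_le_const2)
      show "(\<lambda>n. \<Sum>i\<in>F. (norm (coeff (X m) i - coeff (X n) i))\<^sup>2)
          \<longlonglongrightarrow> (\<Sum>i\<in>F. (norm (coeff (X m) i - f i))\<^sup>2)"
        by (intro tendsto_intros f)
      have "(\<Sum>i\<in>F. (norm (coeff (X m) i - coeff (X n) i))\<^sup>2) \<le> e\<^sup>2" if "n \<ge> M" for n
      proof -
        have "(\<Sum>i\<in>F. (norm (coeff (X m) i - coeff (X n) i))\<^sup>2) \<le> (norm (X m - X n))\<^sup>2"
          using sum_le_norm_ell2_sq[OF \<open>finite F\<close>, of "X m - X n"]
          by (simp add: minus_ell2.rep_eq)
        also have "\<dots> \<le> e\<^sup>2"
          using M \<open>m \<ge> M\<close> that by (intro power_mono) (auto simp: dist_norm less_imp_le)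
        finally show ?thesis .
      qed
      then show "\<exists>N. \<forall>n\<ge>N. (\<Sum>i\<in>F. (norm (coeff (X m) i - coeff (X n) i))\<^sup>2) \<le> e\<^sup>2"
        by blast
    qed
    then show ?thesis by blast
  qed
  have diff: "square_summable (\<lambda>i. g i - f i)"
    if "\<forall>F. finite F \<longrightarrow> (\<Sum>i\<in>F. (norm (g i - f i))\<^sup>2) \<le> e\<^sup>2" for g e
    unfolding square_summable_def
    by (rule nonneg_bdd_above_summable_on) (use that in \<open>auto intro!: bdd_aboveI2[where M = "e\<^sup>2"]\<close>)
  obtain M where "\<forall>F. finite F \<longrightarrow> (\<Sum>i\<in>F. (norm (coeff (X M) i - f i))\<^sup>2) \<le> 1\<^sup>2"
    using key[of 1] by fastforce
  then have "square_summable (\<lambda>i. coeff (X M) i - f i)" by (rule diff)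
  then have "square_summable (\<lambda>i. - (coeff (X M) i - f i))" by (simp add: square_summable_def norm_minus_commute)
  from square_summable_add[OF coeff_square_summable[of "X M"] this]
  have sf: "square_summable f" by simp
  define L where "L = Abs_ell2 f"
  have L: "coeff L = f" unfolding L_def using sf by (simp add: Abs_ell2_inverse)
  have "X \<longlonglongrightarrow> L"
  proof (rule metric_LIMSEQ_I)
    fix e :: real assume "e > 0"
    then obtain M where M: "\<forall>m\<ge>M. \<forall>F. finite F \<longrightarrow>
        (\<Sum>i\<in>F. (norm (coeff (X m) i - f i))\<^sup>2) \<le> (e / 2)\<^sup>2"
      using key[of "e / 2"] by auto
    have "dist (X m) L < e" if "m \<ge> M" for m
    proof -
      have "(norm (X m - L))\<^sup>2 \<le> (e / 2)\<^sup>2"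
        unfolding norm_ell2_sq
      proof (rule infsum_le_finite_sums)
        show "(\<lambda>i. (norm (coeff (X m - L) i))\<^sup>2) summable_on UNIV"
          using coeff_square_summable by (simp add: square_summable_def)
      qed (use M that in \<open>simp add: minus_ell2.rep_eq L\<close>)
      then have "norm (X m - L) \<le> e / 2"
        using \<open>e > 0\<close> by (simp add: power2_le_iff_abs_le)
      then show ?thesis using \<open>e > 0\<close> by (simp add: dist_norm)
    qed
    then show "\<exists>no. \<forall>n\<ge>no. dist (X n) L < e" by blast
  qed
  then show "convergent X" by (rule convergentI)
qed

instantiation ell2 :: (type, chilbert_space) chilbert_space
begin

lift_definition scaleC_ell2 :: "complex \<Rightarrow> ('a, 'b) ell2 \<Rightarrow> ('a, 'b) ell2"
  is "\<lambda>c f i. c *\<^sub>C f i"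
  by (erule square_summable_scale) (rule norm_scaleC)

definition cinner_ell2 :: "('a, 'b) ell2 \<Rightarrow> ('a, 'b) ell2 \<Rightarrow> complex" where
  "cinner_ell2 x y = (\<Sum>\<^sub>\<infinity>i. cinner (coeff x i) (coeff y i))"

instance
proof
  fix x y z :: "('a, 'b) ell2" and c d :: complex and r :: real
  show "c *\<^sub>C (x + y) = c *\<^sub>C x + c *\<^sub>C y" by transfer (simp add: scaleC_add_right)
  show "(c + d) *\<^sub>C x = c *\<^sub>C x + d *\<^sub>C x" by transfer (simp add: scaleC_add_left)
  show "c *\<^sub>C d *\<^sub>C x = (c * d) *\<^sub>C x" by transfer (simp add: scaleC_scaleC)
  show "complex_of_real r *\<^sub>C x = r *\<^sub>R x" by transfer (simp add: scaleC_of_real)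
  show "cinner x y = cnj (cinner y x)"
    unfolding cinner_ell2_def infsum_cnj[symmetric] by (intro infsum_cong cinner_commute)
  show "cinner (x + y) z = cinner x z + cinner y z"
    unfolding cinner_ell2_def plus_ell2.rep_eq cinner_add_left
    by (intro infsum_add ell2_cinner_summable)
  show "cinner (c *\<^sub>C x) y = c * cinner x y"
    unfolding cinner_ell2_def scaleC_ell2.rep_eq cinner_scaleC_left
    by (rule infsum_cmult_right')
  show "Re (cinner x y) = inner x y"
    unfolding cinner_ell2_def inner_ell2_def
    by (simp add: infsum_Re[OF ell2_cinner_summable, symmetric] Re_cinner)
qed

end


section \<open>Operators\<close>

text \<open>Operators are functions on the ambient type; a bounded operator between the subspaces \<open>M\<close>
  and \<open>N\<close> is only looked at on \<open>M\<close>, its values elsewhere being irrelevant.\<close>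

definition bop :: "'a::chilbert_space set \<Rightarrow> 'b::chilbert_space set \<Rightarrow> ('a \<Rightarrow> 'b) set" where
  "bop M N = {f. (\<forall>x\<in>M. f x \<in> N) \<and> (\<forall>x\<in>M. \<forall>y\<in>M. f (x + y) = f x + f y) \<and>
     (\<forall>c. \<forall>x\<in>M. f (c *\<^sub>C x) = c *\<^sub>C f x) \<and> (\<exists>b. \<forall>x\<in>M. norm (f x) \<le> b * norm x)}"

text \<open>For \<open>f \<in> bop M N\<close> with \<open>M\<close> closed, the restriction of \<open>adj_on M f\<close> to \<open>N\<close> is the adjoint
  \<open>N \<rightarrow> M\<close> of \<open>f\<close>.\<close>

definition adj_on :: "'a::chilbert_space set \<Rightarrow> ('a \<Rightarrow> 'b::chilbert_space) \<Rightarrow> 'b \<Rightarrow> 'a" where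
  "adj_on M f y = (THE z. z \<in> M \<and> (\<forall>x\<in>M. cinner (f x) y = cinner x z))"

abbreviation adj :: "('a::chilbert_space \<Rightarrow> 'b::chilbert_space) \<Rightarrow> 'b \<Rightarrow> 'a" where
  "adj \<equiv> adj_on UNIV"

definition positive_op :: "('a::chilbert_space \<Rightarrow> 'a) \<Rightarrow> bool" where
  "positive_op A \<longleftrightarrow> A \<in> bop UNIV UNIV \<and> (\<forall>x. cinner (A x) x \<in> \<real>\<^sub>\<ge>\<^sub>0)"

definition sqrt_op :: "('a::chilbert_space \<Rightarrow> 'a) \<Rightarrow> 'a \<Rightarrow> 'a" where
  "sqrt_op A = (THE B. positive_op B \<and> B \<circ> B = A)"

definition csubspace :: "'a::chilbert_space set \<Rightarrow> bool" where
  "csubspace M \<longleftrightarrow> 0 \<in> M \<and> (\<forall>x\<in>M. \<forall>y\<in>M. x + y \<in> M) \<and> (\<forall>c. \<forall>x\<in>M. c *\<^sub>C x \<in> M)"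

definition closed_cspan :: "'a::chilbert_space set \<Rightarrow> 'a set" where
  "closed_cspan X = closure (csubspace hull X)"

definition orth_compl :: "'a::chilbert_space set \<Rightarrow> 'a set" where
  "orth_compl M = {y. \<forall>x\<in>M. cinner y x = 0}"

text \<open>\<open>proj M\<close> is the orthogonal projection onto a closed subspace \<open>M\<close>.\<close>

definition proj :: "'a::chilbert_space set \<Rightarrow> 'a \<Rightarrow> 'a" where
  "proj M x = (THE y. y \<in> M \<and> x - y \<in> orth_compl M)"

text \<open>The weak operator topology on the bounded operators: the coarsest topology for which all
  maps \<open>A \<mapsto> \<langle>A x, y\<rangle>\<close> are continuous.\<close>

definition wot :: "('a::chilbert_space \<Rightarrow> 'a) topology" where
  "wot = pullback_topology (bop UNIV UNIV) (\<lambda>A (x, y). cinner (A x) y)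
     (product_topology (\<lambda>_. euclidean) UNIV)"


section \<open>Tensor products\<close>

text \<open>The Hilbert space tensor product of \<open>\<ell>\<^sup>2(I)\<close> with \<open>K\<close> is realised as \<open>\<ell>\<^sup>2(I; K)\<close>. For subspaces
  \<open>M\<close> and \<open>L\<close>, \<open>tensor_space M L\<close> is the closed span of the elementary tensors, and for bounded
  \<open>A\<close> on \<open>M\<close> and \<open>B\<close> on \<open>L\<close>, the operator \<open>A \<otimes> B\<close> is uniquely determined on \<open>tensor_space M L\<close>.\<close>

lift_definition tensor ::
  "('i, complex) ell2 \<Rightarrow> 'h::chilbert_space \<Rightarrow> ('i, 'h) ell2" (infixr "\<otimes>\<^sub>v" 70)
  is "\<lambda>f k i. f i *\<^sub>C k"
  subgoal for f k
    by (erule square_summable_scale[where k = "norm k"]) (simp add: norm_scaleC mult.commute)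
  done

definition tensor_space ::
  "('i, complex) ell2 set \<Rightarrow> 'h::chilbert_space set \<Rightarrow> ('i, 'h) ell2 set" (infixr "\<otimes>\<^sub>s" 70) where
  "M \<otimes>\<^sub>s L = closed_cspan {f \<otimes>\<^sub>v k |f k. f \<in> M \<and> k \<in> L}"

definition tensor_op ::
  "('i, complex) ell2 set \<Rightarrow> 'h::chilbert_space set \<Rightarrow> (('i, complex) ell2 \<Rightarrow> ('j, complex) ell2) \<Rightarrow>
   ('h \<Rightarrow> 'k::chilbert_space) \<Rightarrow> ('i, 'h) ell2 \<Rightarrow> ('j, 'k) ell2" where
  "tensor_op M L A B = (SOME C. C \<in> bop (M \<otimes>\<^sub>s L) UNIV \<and>
     (\<forall>f\<in>M. \<forall>k\<in>L. C (f \<otimes>\<^sub>v k) = A f \<otimes>\<^sub>v B k))"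


section \<open>The full Fock space and the noncommutative analytic Toeplitz algebra\<close>

text \<open>The generators are indexed by a finite type \<open>'n\<close>, so \<open>n = CARD('n) \<ge> 1\<close>. Words in the free
  semigroup are lists, and \<open>F\<^sup>2(H\<^sub>n)\<close> is realised through its orthonormal basis \<open>e\<^sub>\<alpha>\<close> as the
  square-summable families indexed by words.\<close>

type_synonym 'n fock = "('n list, complex) ell2"

lift_definition basis_vec :: "'n list \<Rightarrow> 'n fock" is "\<lambda>\<alpha> \<beta>. if \<beta> = \<alpha> then 1 else 0"
  unfolding square_summable_def
  by (rule summable_on_cong_neutral[THEN iffD1, OF _ _ _ summable_on_finite[of "{_}"]]) auto

lift_definition left_creation :: "'n \<Rightarrow> 'n fock \<Rightarrow> 'n fock"
  is "\<lambda>i f \<alpha>. if \<alpha> \<noteq> [] \<and> hd \<alpha> = i then f (tl \<alpha>) else 0"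
  subgoal for i f
    by (rule square_summable_reindex[of f tl "{\<alpha>. \<alpha> \<noteq> [] \<and> hd \<alpha> = i}"])
      (auto simp: inj_on_def list.expand)
  done

lift_definition right_creation :: "'n \<Rightarrow> 'n fock \<Rightarrow> 'n fock"
  is "\<lambda>i f \<alpha>. if \<alpha> \<noteq> [] \<and> last \<alpha> = i then f (butlast \<alpha>) else 0"
proof -
  fix i :: 'a and f :: "'a list \<Rightarrow> complex"
  assume f: "square_summable f"
  have "inj_on butlast {\<alpha>. \<alpha> \<noteq> [] \<and> last \<alpha> = i}"
    by (rule inj_on_inverseI[where g = "\<lambda>\<beta>. \<beta> @ [i]"]) auto
  then show "square_summable (\<lambda>\<alpha>. if \<alpha> \<noteq> [] \<and> last \<alpha> = i then f (butlast \<alpha>) else 0)"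
    by (rule square_summable_reindex[OF f]) auto
qed

lemma left_creation_basis_vec: "left_creation i (basis_vec \<alpha>) = basis_vec (i # \<alpha>)"
  by transfer (auto simp: fun_eq_iff neq_Nil_conv)

lemma right_creation_basis_vec: "right_creation i (basis_vec \<alpha>) = basis_vec (\<alpha> @ [i])"
  by transfer (auto simp: fun_eq_iff)

definition word_op :: "('n \<Rightarrow> 'a \<Rightarrow> 'a) \<Rightarrow> 'n list \<Rightarrow> 'a \<Rightarrow> 'a" where
  "word_op T \<alpha> = foldr (\<lambda>i A. T i \<circ> A) \<alpha> id"

text \<open>A noncommutative polynomial is a finitely supported family of coefficients on words.\<close>

definition poly_op ::
  "('n \<Rightarrow> 'a \<Rightarrow> 'a::chilbert_space) \<Rightarrow> ('n list \<Rightarrow>\<^sub>0 complex) \<Rightarrow> 'a \<Rightarrow> 'a" where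
  "poly_op T p x = (\<Sum>\<alpha>\<in>Poly_Mapping.keys p. Poly_Mapping.lookup p \<alpha> *\<^sub>C word_op T \<alpha> x)"

definition wot_closed_algebra :: "('a::chilbert_space \<Rightarrow> 'a) set \<Rightarrow> bool" where
  "wot_closed_algebra \<A> \<longleftrightarrow> closedin wot \<A> \<and>
     (\<forall>A\<in>\<A>. \<forall>B\<in>\<A>. (\<lambda>x. A x + B x) \<in> \<A> \<and> A \<circ> B \<in> \<A>) \<and>
     (\<forall>c. \<forall>A\<in>\<A>. (\<lambda>x. c *\<^sub>C A x) \<in> \<A>)"

definition Finf :: "('n fock \<Rightarrow> 'n fock) set" where
  "Finf = wot_closed_algebra hull (insert id (range left_creation))"

definition wot_closed_ideal :: "('n fock \<Rightarrow> 'n fock) set \<Rightarrow> bool" where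
  "wot_closed_ideal J \<longleftrightarrow> closedin wot J \<and> J \<subseteq> Finf \<and> (\<lambda>_. 0) \<in> J \<and>
     (\<forall>A\<in>J. \<forall>B\<in>J. (\<lambda>x. A x + B x) \<in> J) \<and>
     (\<forall>c. \<forall>A\<in>J. (\<lambda>x. c *\<^sub>C A x) \<in> J) \<and>
     (\<forall>A\<in>J. \<forall>B\<in>Finf. A \<circ> B \<in> J \<and> B \<circ> A \<in> J)"

definition N_space :: "('n fock \<Rightarrow> 'n fock) set \<Rightarrow> 'n fock set" where
  "N_space J = orth_compl (closed_cspan {A f |A f. A \<in> J})"

definition W_op :: "('n fock \<Rightarrow> 'n fock) set \<Rightarrow> 'n \<Rightarrow> 'n fock \<Rightarrow> 'n fock" where
  "W_op J i f = proj (N_space J) (right_creation i f)"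


section \<open>Row contractions, Poisson kernels and characteristic functions\<close>

definition row_op :: "('n::finite \<Rightarrow> 'h \<Rightarrow> 'h::chilbert_space) \<Rightarrow> 'h ^ 'n \<Rightarrow> 'h" where
  "row_op T v = (\<Sum>i\<in>UNIV. T i (v $ i))"

definition row_contraction :: "('n::finite \<Rightarrow> 'h \<Rightarrow> 'h::chilbert_space) \<Rightarrow> bool" where
  "row_contraction T \<longleftrightarrow> (\<forall>i. T i \<in> bop UNIV UNIV) \<and>
     positive_op (\<lambda>x. x - row_op T (adj (row_op T) x))"

definition defect :: "('n::finite \<Rightarrow> 'h \<Rightarrow> 'h::chilbert_space) \<Rightarrow> 'h \<Rightarrow> 'h" where
  "defect T = sqrt_op (\<lambda>x. x - row_op T (adj (row_op T) x))"

definition defect_star ::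
  "('n::finite \<Rightarrow> 'h \<Rightarrow> 'h::chilbert_space) \<Rightarrow> 'h ^ 'n \<Rightarrow> 'h ^ 'n" where
  "defect_star T = sqrt_op (\<lambda>v. v - adj (row_op T) (row_op T v))"

definition defect_space :: "('n::finite \<Rightarrow> 'h \<Rightarrow> 'h::chilbert_space) \<Rightarrow> 'h set" where
  "defect_space T = closure (range (defect T))"

definition defect_star_space ::
  "('n::finite \<Rightarrow> 'h \<Rightarrow> 'h::chilbert_space) \<Rightarrow> ('h ^ 'n) set" where
  "defect_star_space T = closure (range (defect_star T))"

definition poisson_kernel ::
  "('n::finite \<Rightarrow> 'h \<Rightarrow> 'h::chilbert_space) \<Rightarrow> 'h \<Rightarrow> ('n list, 'h) ell2" where
  "poisson_kernel T h = (\<Sum>\<^sub>\<infinity>\<alpha>. basis_vec \<alpha> \<otimes>\<^sub>v defect T (adj (word_op T \<alpha>) h))"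

definition constrained_poisson_kernel ::
  "('n::finite fock \<Rightarrow> 'n fock) set \<Rightarrow> ('n \<Rightarrow> 'h \<Rightarrow> 'h::chilbert_space) \<Rightarrow>
   'h \<Rightarrow> ('n list, 'h) ell2" where
  "constrained_poisson_kernel J T h =
     tensor_op UNIV (defect_space T) (proj (N_space J)) id (poisson_kernel T h)"

text \<open>The formal Fourier representation, as an expression in operators \<open>V\<^sub>1, \<dots>, V\<^sub>n\<close> on a subspace
  \<open>N\<close> of the Fock space. The row operator \<open>[V\<^sub>1 \<otimes> I, \<dots>, V\<^sub>n \<otimes> I]\<close> acts on \<open>(N \<otimes> H)\<^sup>(\<^sup>n\<^sup>)\<close>, which is
  identified with \<open>N \<otimes> H\<^sup>(\<^sup>n\<^sup>)\<close>; the component \<open>i\<close> of \<open>Y\<close> is its image under \<open>I \<otimes> (v \<mapsto> v\<^sub>i)\<close>.\<close>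

definition fourier_expr ::
  "'n::finite fock set \<Rightarrow> ('n \<Rightarrow> 'n fock \<Rightarrow> 'n fock) \<Rightarrow> ('n \<Rightarrow> 'h \<Rightarrow> 'h::chilbert_space) \<Rightarrow>
   ('n list, 'h ^ 'n) ell2 \<Rightarrow> ('n list, 'h) ell2" where
  "fourier_expr N V T X =
     - tensor_op N (defect_star_space T) id (row_op T) X
     + tensor_op N UNIV id (defect T)
         (inv_into (N \<otimes>\<^sub>s UNIV) (\<lambda>Z. Z - (\<Sum>i\<in>UNIV. tensor_op N UNIV (V i) (adj (T i)) Z))
           (\<Sum>i\<in>UNIV. tensor_op N UNIV (V i) id
              (tensor_op N UNIV id (\<lambda>v :: 'h ^ 'n. v $ i)
                (tensor_op N (defect_star_space T) id (defect_star T) X))))"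

text \<open>The limit is taken pointwise, i.e. in the strong operator topology.\<close>

definition constrained_char_fun ::
  "('n::finite fock \<Rightarrow> 'n fock) set \<Rightarrow> ('n \<Rightarrow> 'h \<Rightarrow> 'h::chilbert_space) \<Rightarrow>
   ('n list, 'h ^ 'n) ell2 \<Rightarrow> ('n list, 'h) ell2" where
  "constrained_char_fun J T X =
     Lim (at_left (1::real)) (\<lambda>r. fourier_expr (N_space J) (\<lambda>i f. r *\<^sub>R W_op J i f) T X)"

end

theory Submission
  imports Defs
begin

text \<open>The characteristic function is the transfer function of a unitary system. With the defect
  operators \<open>D = \<Delta>\<^sub>T\<close>, \<open>E = \<Delta>\<^bsub>T\<^sup>*\<^esub>\<close>, the Julia operator \<open>(z, x) \<mapsto> (T\<^sup>* z + E x, D z - T x)\<close> is unitary,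
  and \<open>\<Theta>\<^sub>T X\<close> is the output of the system that runs along the words \<open>\<delta>\<close>: the states obey
  \<open>(Z\<^bsub>\<delta>i\<^esub>)\<^sub>i = T\<^sup>* Z\<^sub>\<delta> + E X\<^sub>\<delta>\<close> with \<open>Z\<close> vanishing on the empty word, and \<open>(\<Theta>\<^sub>T X)\<^sub>\<delta> = D Z\<^sub>\<delta> - T X\<^sub>\<delta>\<close>.
  Running the adjoint system backwards on \<open>Y\<close> gives the output \<open>\<Theta>\<^sub>T\<^sup>* Y\<close>, and its state at the empty
  word is \<open>K\<^sub>T\<^sup>* Y\<close>. Summing the energy balance over all words of length less than \<open>m\<close> and letting
  \<open>m \<rightarrow> \<infinity>\<close> gives \<open>I - \<Theta>\<^sub>T \<Theta>\<^sub>T\<^sup>* = K\<^sub>T K\<^sub>T\<^sup>*\<close>. Since the elements of \<open>J\<close> commute with right creation, the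
  orthogonal complement of \<open>N\<^sub>J \<otimes> H\<close> is invariant under the system; hence \<open>\<Theta>\<^bsub>J,T\<^esub>\<close> is the compression of
  \<open>\<Theta>\<^sub>T\<close>, \<open>\<Theta>\<^sub>T\<^sup>*\<close> maps \<open>N\<^sub>J \<otimes> \<D>\<^sub>T\<close> into \<open>N\<^sub>J \<otimes> \<D>\<^bsub>T\<^sup>*\<^esub>\<close>, and compressing the identity proves the theorem.
  The SOT-limit exists because the radial approximants \<open>\<Theta>\<^sub>r\<close> are contractions that satisfy
  \<open>\<Theta>\<^sub>r \<gamma>\<^sub>r = \<gamma>\<^sub>r \<Theta>\<^sub>T\<close> for the dilations \<open>(\<gamma>\<^sub>r x)\<^sub>\<alpha> = r\<^bsup>|\<alpha>|\<^esup> x\<^sub>\<alpha>\<close>, which tend strongly to \<open>I\<close>.\<close>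


section \<open>Hilbert space preliminaries\<close>

instance chilbert_space \<subseteq> banach
  by standard

lemma cinner_add_right: "cinner x (y + z) = cinner x y + cinner x z"
  by (metis cinner_add_left cinner_commute complex_cnj_add)

lemma cinner_scaleC_right: "cinner x (c *\<^sub>C y) = cnj c * cinner x y"
  by (metis cinner_scaleC_left cinner_commute complex_cnj_mult)

lemma scaleR_scaleC: "r *\<^sub>R x = complex_of_real r *\<^sub>C x"
  by (simp add: scaleC_of_real)

lemma minus_scaleC: "- x = (-1) *\<^sub>C x"
  using scaleC_of_real[of "-1" x] by simp

lemma cinner_zero_left [simp]: "cinner 0 y = 0"
  using cinner_add_left[of 0 0 y] by simp

lemma cinner_zero_right [simp]: "cinner x 0 = 0"
  using cinner_add_right[of x 0 0] by simp

lemma cinner_minus_left: "cinner (- x) y = - cinner x y"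
  using cinner_add_left[of x "-x" y] by (simp add: eq_neg_iff_add_eq_0 add.commute)

lemma cinner_minus_right: "cinner x (- y) = - cinner x y"
  using cinner_add_right[of x y "-y"] by (simp add: eq_neg_iff_add_eq_0 add.commute)

lemma cinner_diff_left: "cinner (x - y) z = cinner x z - cinner y z"
  using cinner_add_left[of x "-y" z] by (simp add: cinner_minus_left)

lemma cinner_diff_right: "cinner x (y - z) = cinner x y - cinner x z"
  using cinner_add_right[of x y "-z"] by (simp add: cinner_minus_right)

lemma cinner_scaleR_left: "cinner (r *\<^sub>R x) y = complex_of_real r * cinner x y"
  by (simp add: scaleR_scaleC cinner_scaleC_left)

lemma cinner_scaleR_right: "cinner x (r *\<^sub>R y) = complex_of_real r * cinner x y"
  by (simp add: scaleR_scaleC cinner_scaleC_right)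

lemma cinner_sum_left: "cinner (\<Sum>i\<in>A. f i) y = (\<Sum>i\<in>A. cinner (f i) y)"
  by (induction A rule: infinite_finite_induct) (auto simp: cinner_add_left)

lemmas cinner_algebra = cinner_add_left cinner_add_right cinner_diff_left cinner_diff_right
  cinner_minus_left cinner_minus_right

lemma cinner_self_eq_0 [simp]: "cinner x x = 0 \<longleftrightarrow> x = 0"
  by (simp add: cinner_self)

lemma cinner_eq_0_commute: "cinner x y = 0 \<longleftrightarrow> cinner y x = 0"
  by (metis cinner_commute complex_cnj_zero_iff)

lemma cinner_ext: "(\<And>z. cinner z x = cinner z y) \<Longrightarrow> x = y"
  by (metis cinner_diff_right cinner_self_eq_0 eq_iff_diff_eq_0)

lemma bounded_linear_cinner_left: "bounded_linear (\<lambda>x. cinner x y)"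
  by (rule bounded_linear_intro[where K = "norm y"])
    (auto simp: cinner_add_left cinner_scaleR_left scaleR_conv_of_real norm_cinner_le)

lemma scaleC_diff_right: "c *\<^sub>C (x - y) = c *\<^sub>C x - c *\<^sub>C (y :: 'a::chilbert_space)"
  using scaleC_add_right[of c "x - y" y] by (simp add: algebra_simps)

lemma bounded_linear_scaleC: "bounded_linear (\<lambda>x :: 'a::chilbert_space. c *\<^sub>C x)"
  by (rule bounded_linear_intro[where K = "cmod c"])
    (auto simp: scaleC_add_right scaleR_scaleC scaleC_scaleC mult.commute norm_scaleC)

section \<open>Complex subspaces, closed spans, orthogonal complements and projections\<close>

lemma
  assumes "csubspace M"
  shows csubspace_0: "0 \<in> M"
    and csubspace_add: "x \<in> M \<Longrightarrow> y \<in> M \<Longrightarrow> x + y \<in> M"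
    and csubspace_scaleC: "x \<in> M \<Longrightarrow> c *\<^sub>C x \<in> M"
    and csubspace_scaleR: "x \<in> M \<Longrightarrow> r *\<^sub>R x \<in> M"
    and csubspace_minus: "x \<in> M \<Longrightarrow> - x \<in> M"
    and csubspace_diff: "x \<in> M \<Longrightarrow> y \<in> M \<Longrightarrow> x - y \<in> M"
proof -
  show "0 \<in> M" and a: "x \<in> M \<Longrightarrow> y \<in> M \<Longrightarrow> x + y \<in> M"
    and s: "x \<in> M \<Longrightarrow> c *\<^sub>C x \<in> M" for x y c
    using assms by (auto simp: csubspace_def)
  show "x \<in> M \<Longrightarrow> r *\<^sub>R x \<in> M" by (simp add: scaleR_scaleC s)
  show m: "x \<in> M \<Longrightarrow> - x \<in> M" for x by (subst minus_scaleC) (rule s)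
  show "x \<in> M \<Longrightarrow> y \<in> M \<Longrightarrow> x - y \<in> M" using a[OF _ m, of x y] by simp
qed

lemma csubspace_sum:
  assumes "csubspace M" "\<And>i. i \<in> I \<Longrightarrow> f i \<in> M"
  shows "(\<Sum>i\<in>I. f i) \<in> M"
  using assms(2)
  by (induction I rule: infinite_finite_induct)
    (auto intro: csubspace_add[OF assms(1)] simp: csubspace_0[OF assms(1)])

lemma csubspace_UNIV [simp]: "csubspace UNIV"
  by (simp add: csubspace_def)

lemma csubspace_closure:
  assumes M: "csubspace M"
  shows "csubspace (closure M)"
  unfolding csubspace_def
proof (intro conjI ballI allI)
  show "0 \<in> closure M" using csubspace_0[OF M] closure_subset by blast
  show "x + y \<in> closure M" if "x \<in> closure M" "y \<in> closure M" for x y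
  proof -
    obtain f g where "\<And>n. f n \<in> M" "f \<longlonglongrightarrow> x" "\<And>n. g n \<in> M" "g \<longlonglongrightarrow> y"
      using \<open>x \<in> closure M\<close> \<open>y \<in> closure M\<close> unfolding closure_sequential by blast
    then show ?thesis
      unfolding closure_sequential
      by (intro exI[of _ "\<lambda>n. f n + g n"]) (auto intro: tendsto_add csubspace_add[OF M])
  qed
  show "c *\<^sub>C x \<in> closure M" if "x \<in> closure M" for c x
  proof -
    obtain f where "\<And>n. f n \<in> M" "f \<longlonglongrightarrow> x"
      using \<open>x \<in> closure M\<close> unfolding closure_sequential by blast
    then show ?thesis
      unfolding closure_sequential
      by (intro exI[of _ "\<lambda>n. c *\<^sub>C f n"])
        (auto intro: bounded_linear.tendsto[OF bounded_linear_scaleC] csubspace_scaleC[OF M])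
  qed
qed

lemma csubspace_hull: "csubspace (csubspace hull X)"
  by (rule hull_in) (auto simp: csubspace_def)

lemma csubspace_closed_cspan: "csubspace (closed_cspan X)"
  unfolding closed_cspan_def by (intro csubspace_closure csubspace_hull)

lemma closed_closed_cspan: "closed (closed_cspan X)"
  by (simp add: closed_cspan_def)

lemma closed_cspan_superset: "X \<subseteq> closed_cspan X"
  unfolding closed_cspan_def by (meson closure_subset hull_subset order_trans)

lemma closed_cspan_minimal: "X \<subseteq> M \<Longrightarrow> csubspace M \<Longrightarrow> closed M \<Longrightarrow> closed_cspan X \<subseteq> M"
  unfolding closed_cspan_def by (intro closure_minimal hull_minimal)

lemma csubspace_orth_compl: "csubspace (orth_compl M)"
  by (simp add: csubspace_def orth_compl_def cinner_add_left cinner_scaleC_left)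

lemma closed_orth_compl: "closed (orth_compl M)"
proof -
  have "orth_compl M = (\<Inter>x\<in>M. (\<lambda>y. cinner y x) -` {0})"
    by (auto simp: orth_compl_def)
  moreover have "closed ((\<lambda>y. cinner y x) -` {0})" for x :: 'a
    by (rule closed_vimage) (auto intro: linear_continuous_on bounded_linear_cinner_left)
  ultimately show ?thesis by (metis (mono_tags, lifting) closed_INT)
qed

text \<open>The double complement of \<open>X\<close> is a closed subspace containing
  \<open>X\<close>, so it contains the closed span; passing to that span adds no orthogonality
  condition.\<close>

lemma orth_compl_closed_cspan: "orth_compl (closed_cspan X) = orth_compl X"
proof
  show "orth_compl (closed_cspan X) \<subseteq> orth_compl X"
    using closed_cspan_superset[of X] by (auto simp: orth_compl_def)
  have "closed_cspan X \<subseteq> orth_compl (orth_compl X)"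
    by (intro closed_cspan_minimal csubspace_orth_compl closed_orth_compl)
      (auto simp: orth_compl_def cinner_eq_0_commute)
  then show "orth_compl X \<subseteq> orth_compl (closed_cspan X)"
    unfolding orth_compl_def using cinner_eq_0_commute by blast
qed

text \<open>Nearest-point argument: the limit \<open>y\<close> of a minimising sequence attains the
  distance from \<open>x\<close> to \<open>M\<close>, and comparing \<open>y\<close> with its
  perturbations inside \<open>M\<close> forces orthogonality.\<close>

lemma proj_exists:
  fixes x :: "'a::chilbert_space"
  assumes M: "csubspace M" "closed M"
  shows "\<exists>y\<in>M. x - y \<in> orth_compl M"
proof -
  define d where "d = Inf ((\<lambda>y. (norm (x - y))\<^sup>2) ` M)"
  have bdd: "bdd_below ((\<lambda>y. (norm (x - y))\<^sup>2) ` M)"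
    by (rule bdd_belowI2[where m = 0]) simp
  have ne: "(\<lambda>y. (norm (x - y))\<^sup>2) ` M \<noteq> {}"
    using csubspace_0[OF M(1)] by blast
  have d_le: "d \<le> (norm (x - y))\<^sup>2" if "y \<in> M" for y
    unfolding d_def using that by (intro cInf_lower bdd imageI)
  have "\<exists>y\<in>M. (norm (x - y))\<^sup>2 < d + inverse (real (Suc n))" for n
    using cInf_lessD[OF ne, of "d + inverse (real (Suc n))"] unfolding d_def by auto
  then obtain f where fM: "\<And>n. f n \<in> M"
    and f: "\<And>n. (norm (x - f n))\<^sup>2 < d + inverse (real (Suc n))" by metis
  \<comment> \<open>The parallelogram law makes a minimising sequence Cauchy.\<close>
  have par: "(norm (f m - f n))\<^sup>2 \<le> 2 * inverse (real (Suc m)) + 2 * inverse (real (Suc n))" for m n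
  proof -
    have "(1/2) *\<^sub>R (f m + f n) \<in> M" by (intro csubspace_scaleR csubspace_add M fM)
    from d_le[OF this] have "4 * d \<le> 4 * (norm (x - (1/2) *\<^sub>R (f m + f n)))\<^sup>2" by simp
    also have "\<dots> = (norm (2 *\<^sub>R (x - (1/2) *\<^sub>R (f m + f n))))\<^sup>2"
      by (simp add: power_mult_distrib)
    also have "2 *\<^sub>R (x - (1/2) *\<^sub>R (f m + f n)) = (x - f m) + (x - f n)"
      by (simp add: algebra_simps scaleR_2)
    finally have "4 * d \<le> (norm ((x - f m) + (x - f n)))\<^sup>2" .
    moreover have "(norm ((x - f m) + (x - f n)))\<^sup>2 + (norm ((x - f n) - (x - f m)))\<^sup>2
        = 2 * (norm (x - f m))\<^sup>2 + 2 * (norm (x - f n))\<^sup>2"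
      unfolding power2_norm_eq_inner
      by (simp add: inner_add_left inner_add_right inner_diff_left inner_diff_right inner_commute algebra_simps)
    ultimately show ?thesis using f[of m] f[of n] by simp
  qed
  have "Cauchy f"
  proof (rule metric_CauchyI)
    fix e :: real assume "e > 0"
    then obtain N where N: "inverse (real (Suc N)) < e\<^sup>2 / 4"
      using reals_Archimedean[of "e\<^sup>2 / 4"] by auto
    have "dist (f m) (f n) < e" if "m \<ge> N" "n \<ge> N" for m n
    proof -
      have "inverse (real (Suc m)) \<le> inverse (real (Suc N))"
        "inverse (real (Suc n)) \<le> inverse (real (Suc N))" using that by auto
      then have "(norm (f m - f n))\<^sup>2 < e\<^sup>2" using par[of m n] N by linarith
      then show ?thesis using \<open>e > 0\<close> by (simp add: dist_norm power2_less_imp_less)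
    qed
    then show "\<exists>N. \<forall>m\<ge>N. \<forall>n\<ge>N. dist (f m) (f n) < e" by blast
  qed
  then obtain y where y: "f \<longlonglongrightarrow> y" using Cauchy_convergent convergent_def by blast
  have yM: "y \<in> M" using closed_sequentially[OF M(2)] fM y by blast
  have "(norm (x - y))\<^sup>2 \<le> d"
  proof (rule LIMSEQ_le)
    show "(\<lambda>n. (norm (x - f n))\<^sup>2) \<longlonglongrightarrow> (norm (x - y))\<^sup>2" by (intro tendsto_intros y)
    show "(\<lambda>n. d + inverse (real (Suc n))) \<longlonglongrightarrow> d"
      using LIMSEQ_inverse_real_of_nat_add by blast
    show "\<exists>N. \<forall>n\<ge>N. (norm (x - f n))\<^sup>2 \<le> d + inverse (real (Suc n))"
      using f less_imp_le by blast
  qed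
  then have min: "(norm (x - y))\<^sup>2 \<le> (norm (x - z))\<^sup>2" if "z \<in> M" for z
    using d_le[OF that] by linarith
  have re: "inner (x - y) z = 0" if "z \<in> M" for z
  proof (cases "z = 0")
    case False
    \<comment> \<open>This \<open>t\<close> minimises the quadratic
      \<open>(norm ((x - y) - t *\<^sub>R z))\<^sup>2\<close>, so a nonzero inner product would
      contradict the minimality of \<open>y\<close>.\<close>
    define t where "t = inner (x - y) z / (norm z)\<^sup>2"
    have "(norm (x - y))\<^sup>2 \<le> (norm (x - (y + t *\<^sub>R z)))\<^sup>2"
      by (intro min csubspace_add csubspace_scaleR M yM that)
    also have "x - (y + t *\<^sub>R z) = (x - y) - t *\<^sub>R z" by simp
    also have "(norm ((x - y) - t *\<^sub>R z))\<^sup>2 = (norm (x - y))\<^sup>2 - 2 * t * inner (x - y) z + t\<^sup>2 * (norm z)\<^sup>2"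
      unfolding power2_norm_eq_inner
      by (simp add: inner_diff inner_commute algebra_simps power2_eq_square)
    also have "\<dots> = (norm (x - y))\<^sup>2 - (inner (x - y) z)\<^sup>2 / (norm z)\<^sup>2"
      using False by (simp add: t_def power2_eq_square field_simps)
    finally have "(inner (x - y) z)\<^sup>2 / (norm z)\<^sup>2 \<le> 0" by simp
    then show ?thesis using False by (simp add: divide_le_0_iff)
  qed simp
  have "cinner (x - y) z = 0" if "z \<in> M" for z
  proof (rule complex_eqI)
    show "Re (cinner (x - y) z) = Re 0" using re[OF that] by (simp add: Re_cinner)
    \<comment> \<open>Testing with \<open>\<i> *\<^sub>C z\<close>, again in \<open>M\<close>, turns
      the imaginary part into a real one.\<close>
    have "Re (cinner (x - y) (\<i> *\<^sub>C z)) = 0"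
      using re[OF csubspace_scaleC[OF M(1) that]] by (simp add: Re_cinner)
    then show "Im (cinner (x - y) z) = Im 0" by (simp add: cinner_scaleC_right)
  qed
  then show ?thesis using yM by (auto simp: orth_compl_def)
qed

lemma orth_compl_self_0: "x \<in> M \<Longrightarrow> x \<in> orth_compl M \<Longrightarrow> x = 0"
  using cinner_self_eq_0 by (auto simp: orth_compl_def)

lemma proj_eqI:
  assumes "csubspace M" "y \<in> M" "x - y \<in> orth_compl M"
  shows "proj M x = y"
  unfolding proj_def
proof (rule the_equality)
  fix z assume z: "z \<in> M \<and> x - z \<in> orth_compl M"
  have "(x - z) - (x - y) \<in> orth_compl M"
    using z assms(3) csubspace_diff[OF csubspace_orth_compl] by blast
  then have "y - z \<in> orth_compl M" by simp
  moreover have "y - z \<in> M" using assms z csubspace_diff by blast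
  ultimately show "z = y" using orth_compl_self_0 by fastforce
qed (use assms in auto)

lemma
  assumes "csubspace M" "closed M"
  shows proj_mem: "proj M x \<in> M" and proj_orth: "x - proj M x \<in> orth_compl M"
proof -
  obtain y where "y \<in> M" "x - y \<in> orth_compl M" using proj_exists[OF assms] by blast
  then show "proj M x \<in> M" "x - proj M x \<in> orth_compl M" using proj_eqI[OF assms(1)] by auto
qed

lemma proj_ident: "csubspace M \<Longrightarrow> x \<in> M \<Longrightarrow> proj M x = x"
  by (intro proj_eqI) (auto simp: csubspace_0[OF csubspace_orth_compl])

lemma proj_add:
  assumes "csubspace M" "closed M"
  shows "proj M (x + y) = proj M x + proj M y"
  by (intro proj_eqI assms csubspace_add proj_mem)
    (use csubspace_add[OF csubspace_orth_compl proj_orth[OF assms, of x] proj_orth[OF assms, of y]]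
      in \<open>simp add: algebra_simps\<close>)

lemma proj_scaleC:
  assumes "csubspace M" "closed M"
  shows "proj M (c *\<^sub>C x) = c *\<^sub>C proj M x"
  by (intro proj_eqI assms csubspace_scaleC proj_mem)
    (use csubspace_scaleC[OF csubspace_orth_compl proj_orth[OF assms, of x]]
      in \<open>simp add: scaleC_diff_right\<close>)

lemma cinner_proj:
  assumes "csubspace M" "closed M" "y \<in> M"
  shows "cinner (proj M x) y = cinner x y"
  using proj_orth[OF assms(1,2), of x] assms(3) by (auto simp: orth_compl_def cinner_diff_left)

lemma norm_proj_le:
  assumes "csubspace M" "closed M"
  shows "norm (proj M x) \<le> norm x"
proof -
  have "(norm (proj M x))\<^sup>2 = Re (cinner x (proj M x))"
    using cinner_proj[OF assms proj_mem[OF assms], of x x]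
    by (metis Re_complex_of_real cinner_self)
  also have "\<dots> \<le> norm x * norm (proj M x)"
    using complex_Re_le_cmod norm_cinner_le order_trans by blast
  finally show ?thesis
    by (cases "proj M x = 0") (auto simp: power2_eq_square)
qed

lemma bop_proj: "csubspace M \<Longrightarrow> closed M \<Longrightarrow> proj M \<in> bop UNIV UNIV"
  unfolding bop_def using norm_proj_le[of M]
  by (auto simp: proj_add proj_scaleC intro!: exI[of _ 1])

text \<open>A vector of the double complement differs from its projection by a vector that lies both
  in \<open>orth_compl M\<close> and in the double complement, hence by 0.\<close>

lemma orth_compl_orth_compl:
  assumes "csubspace M" "closed M"
  shows "orth_compl (orth_compl M) = M"
proof
  show "M \<subseteq> orth_compl (orth_compl M)" by (auto simp: orth_compl_def cinner_eq_0_commute)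
  show "orth_compl (orth_compl M) \<subseteq> M"
  proof
    fix x assume x: "x \<in> orth_compl (orth_compl M)"
    have "proj M x \<in> orth_compl (orth_compl M)"
      using proj_mem[OF assms, of x] by (auto simp: orth_compl_def cinner_eq_0_commute)
    then have "x - proj M x \<in> orth_compl (orth_compl M)"
      by (intro csubspace_diff[OF csubspace_orth_compl x])
    then have "x - proj M x = 0" using orth_compl_self_0[OF proj_orth[OF assms, of x]] by blast
    then show "x \<in> M" using proj_mem[OF assms, of x] by simp
  qed
qed


subsection \<open>Bounded operators and adjoints\<close>

lemma bopI:
  assumes "\<And>x y. f (x + y) = f x + f y" "\<And>c x. f (c *\<^sub>C x) = c *\<^sub>C f x"
    "\<And>x. norm (f x) \<le> b * norm x"
  shows "f \<in> bop UNIV UNIV"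
  using assms unfolding bop_def by auto

lemma bop_bounded_linear: "f \<in> bop UNIV UNIV \<Longrightarrow> bounded_linear f"
  unfolding bop_def
  by (auto simp: scaleR_scaleC mult.commute[of "norm _"] intro!: bounded_linear_intro)

lemma bop_scaleC: "f \<in> bop UNIV UNIV \<Longrightarrow> f (c *\<^sub>C x) = c *\<^sub>C f x"
  by (simp add: bop_def)

lemma bounded_linear_bop:
  assumes "bounded_linear f" "\<And>c x. f (c *\<^sub>C x) = c *\<^sub>C f x"
  shows "f \<in> bop UNIV UNIV"
proof -
  obtain K where "\<And>x. norm (f x) \<le> K * norm x"
    using bounded_linear.bounded[OF assms(1)] by (auto simp: mult.commute)
  moreover have "f (x + y) = f x + f y" for x y
    by (rule linear_add[OF bounded_linear.linear[OF assms(1)]])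
  ultimately show ?thesis using assms(2) by (rule bopI[rotated 2])
qed

lemma
  assumes "f \<in> bop UNIV UNIV"
  shows bop_add: "f (x + y) = f x + f y" and bop_diff: "f (x - y) = f x - f y"
    and bop_zero: "f 0 = 0"
    and bop_scaleR: "f (r *\<^sub>R x) = r *\<^sub>R f x"
  using bounded_linear.linear[OF bop_bounded_linear[OF assms]]
  by (auto simp: linear_add linear_diff linear_0 linear_scale)

lemma bop_subset: "f \<in> bop UNIV UNIV \<Longrightarrow> f \<in> bop M UNIV"
  unfolding bop_def by auto

lemma bop_id [simp]: "id \<in> bop UNIV UNIV"
  by (rule bopI[where b = 1]) auto

lemma bop_comp: "f \<in> bop UNIV UNIV \<Longrightarrow> g \<in> bop UNIV UNIV \<Longrightarrow> f \<circ> g \<in> bop UNIV UNIV"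
  by (rule bounded_linear_bop)
    (auto simp: comp_def bop_scaleC intro: bounded_linear_compose bop_bounded_linear)

lemma bop_diff_fun:
  "f \<in> bop UNIV UNIV \<Longrightarrow> g \<in> bop UNIV UNIV \<Longrightarrow> (\<lambda>x. f x - g x) \<in> bop UNIV UNIV"
  by (rule bounded_linear_bop)
    (auto simp: bop_scaleC scaleC_diff_right intro: bounded_linear_sub bop_bounded_linear)

lemma bop_closed_vimage: "f \<in> bop UNIV UNIV \<Longrightarrow> closed M \<Longrightarrow> closed (f -` M)"
  by (rule closed_vimage) (auto intro: linear_continuous_on bop_bounded_linear)

lemma bop_csubspace_vimage: "f \<in> bop UNIV UNIV \<Longrightarrow> csubspace M \<Longrightarrow> csubspace (f -` M)"
  by (auto simp: csubspace_def bop_add bop_scaleC bop_zero)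

text \<open>The kernel of a nonzero functional is a closed subspace of codimension one; a vector
  \<open>w\<close> orthogonal to it, suitably scaled, represents the functional.\<close>

lemma riesz_representation:
  fixes \<phi> :: "'a::chilbert_space \<Rightarrow> complex"
  assumes "\<phi> \<in> bop UNIV UNIV"
  shows "\<exists>z. \<forall>x. \<phi> x = cinner x z"
proof (cases "\<forall>x. \<phi> x = 0")
  case False
  then obtain u where u: "\<phi> u \<noteq> 0" by blast
  let ?M = "\<phi> -` {0}"
  have M: "csubspace ?M" "closed ?M"
    using assms by (auto intro!: bop_csubspace_vimage bop_closed_vimage)
      (simp add: csubspace_def scaleC_complex_def)
  define w where "w = u - proj ?M u"
  have "\<phi> (proj ?M u) = 0" using proj_mem[OF M, of u] by simp
  then have phw: "\<phi> w = \<phi> u" using assms by (simp add: w_def bop_diff)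
  have w0: "w \<noteq> 0" using phw u bop_zero[OF assms] by auto
  \<comment> \<open>The conjugate compensates for the antilinearity of \<open>cinner\<close> in its
    second argument.\<close>
  define z where "z = (cnj (\<phi> w) / cinner w w) *\<^sub>C w"
  have "\<phi> x = cinner x z" for x
  proof -
    have "x - (\<phi> x / \<phi> w) *\<^sub>C w \<in> ?M"
      using u phw assms by (simp add: bop_diff bop_scaleC scaleC_complex_def)
    moreover have "w \<in> orth_compl ?M" unfolding w_def by (rule proj_orth[OF M])
    ultimately have "cinner (x - (\<phi> x / \<phi> w) *\<^sub>C w) w = 0"
      by (auto simp: orth_compl_def cinner_eq_0_commute)
    then have e: "cinner x w = \<phi> x / \<phi> w * cinner w w"
      by (simp add: cinner_diff_left cinner_scaleC_left)
    have "cnj (cinner w w) = cinner w w" by (metis cinner_commute)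
    then show ?thesis using w0 u phw by (simp add: z_def cinner_scaleC_right e)
  qed
  then show ?thesis by blast
qed (auto intro: exI[of _ 0])

lemma adj_on_eqI:
  assumes "csubspace M" "z \<in> M" "\<And>x. x \<in> M \<Longrightarrow> cinner (f x) y = cinner x z"
  shows "adj_on M f y = z"
  unfolding adj_on_def
proof (rule the_equality)
  fix z' assume z': "z' \<in> M \<and> (\<forall>x\<in>M. cinner (f x) y = cinner x z')"
  have "z' - z \<in> M" using z' assms csubspace_diff by blast
  then have "cinner (z' - z) (z' - z) = 0" using z' assms by (simp add: cinner_diff_right)
  then show "z' = z" by simp
qed (use assms in auto)

lemma adj_eqI: "(\<And>x. cinner (f x) y = cinner x z) \<Longrightarrow> adj f y = z"
  by (rule adj_on_eqI) auto

text \<open>Riesz representation of \<open>\<lambda>x. cinner (f x) y\<close> supplies the vector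
  that the definite description in \<open>adj_on\<close> asks for.\<close>

lemma cinner_adj:
  assumes "f \<in> bop UNIV UNIV"
  shows "cinner (f x) y = cinner x (adj f y)"
proof -
  obtain b where b: "\<And>x. norm (f x) \<le> b * norm x" using assms by (auto simp: bop_def)
  have "(\<lambda>x. cinner (f x) y) \<in> bop UNIV UNIV"
  proof (rule bopI)
    fix x
    have "norm (cinner (f x) y) \<le> norm (f x) * norm y" by (rule norm_cinner_le)
    also have "\<dots> \<le> (b * norm x) * norm y" by (rule mult_right_mono[OF b]) simp
    finally show "norm (cinner (f x) y) \<le> (b * norm y) * norm x" by (simp add: ac_simps)
  qed (use assms in \<open>auto simp: bop_add bop_scaleC cinner_add_left cinner_scaleC_left scaleC_complex_def\<close>)
  from riesz_representation[OF this] obtain z where z: "\<And>x. cinner (f x) y = cinner x z" by blast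
  have "adj f y = z" by (rule adj_eqI) (rule z)
  then show ?thesis using z by simp
qed

lemma cinner_adj': "f \<in> bop UNIV UNIV \<Longrightarrow> cinner (adj f y) x = cinner y (f x)"
  by (metis cinner_adj cinner_commute)

lemma norm_adj_le:
  assumes "f \<in> bop UNIV UNIV" "\<And>x. norm (f x) \<le> b * norm x" "b \<ge> 0"
  shows "norm (adj f y) \<le> b * norm y"
proof (cases "adj f y = 0")
  case False
  have "(norm (adj f y))\<^sup>2 = Re (cinner (f (adj f y)) y)"
    by (simp add: cinner_adj[OF assms(1)] cinner_self)
  also have "\<dots> \<le> norm (f (adj f y)) * norm y"
    using complex_Re_le_cmod norm_cinner_le order_trans by blast
  also have "\<dots> \<le> (b * norm (adj f y)) * norm y" by (intro mult_right_mono assms) simp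
  finally show ?thesis using False by (simp add: power2_eq_square algebra_simps)
qed (use assms(3) in simp)

lemma adj_bop:
  assumes "f \<in> bop UNIV UNIV"
  shows "adj f \<in> bop UNIV UNIV"
proof -
  obtain b where b: "\<And>x. norm (f x) \<le> b * norm x" using assms by (auto simp: bop_def)
  have b': "norm (f x) \<le> \<bar>b\<bar> * norm x" for x
    by (rule order_trans[OF b mult_right_mono]) auto
  show ?thesis
  proof (rule bopI)
    show "norm (adj f x) \<le> \<bar>b\<bar> * norm x" for x by (intro norm_adj_le assms b') simp
  qed (auto intro!: adj_eqI simp: cinner_add_right cinner_scaleC_right cinner_adj[OF assms])
qed

lemma adj_comp:
  "f \<in> bop UNIV UNIV \<Longrightarrow> g \<in> bop UNIV UNIV \<Longrightarrow> adj (f \<circ> g) = adj g \<circ> adj f"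
  by (rule ext, rule adj_eqI) (simp add: cinner_adj)


section \<open>Positive square roots and defect operators\<close>

lemma positive_op_bop: "positive_op A \<Longrightarrow> A \<in> bop UNIV UNIV"
  by (simp add: positive_op_def)

text \<open>Polarisation: the quadratic form is real at \<open>x + y\<close> and at
  \<open>x + \<i> *\<^sub>C y\<close>, which fixes the imaginary and the real part
  respectively.\<close>

lemma positive_op_selfadjoint:
  assumes "positive_op A"
  shows "cinner (A x) y = cinner x (A y)"
proof -
  note A = positive_op_bop[OF assms]
  have im: "Im (cinner (A z) z) = 0" for z
    using assms by (auto simp: positive_op_def complex_nonneg_Reals_iff)
  have "Im (cinner (A x) y) + Im (cinner (A y) x) = 0"
    using im[of "x + y"] im[of x] im[of y] by (simp add: bop_add[OF A] cinner_algebra)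
  moreover have "Re (cinner (A y) x) = Re (cinner (A x) y)"
    using im[of "x + \<i> *\<^sub>C y"] im[of x] im[of y]
    by (simp add: bop_add[OF A] bop_scaleC[OF A] cinner_algebra cinner_scaleC_left cinner_scaleC_right)
  ultimately have "cinner (A x) y = cnj (cinner (A y) x)"
    by (simp add: complex_eq_iff)
  then show ?thesis by (simp add: cinner_commute[of x])
qed

text \<open>With \<open>z = A y\<close>, the form at \<open>y + t *\<^sub>R z\<close> has no
  constant term and linear coefficient \<open>2 * (norm z)\<^sup>2\<close>; for a small negative
  \<open>t\<close> it would be negative unless \<open>z = 0\<close>.\<close>

lemma positive_op_null:
  assumes "positive_op A" "cinner (A y) y = 0"
  shows "A y = 0"
proof (rule ccontr)
  note A = positive_op_bop[OF assms(1)]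
  assume "A y \<noteq> 0"
  define z where "z = A y"
  define n where "n = (norm z)\<^sup>2"
  define c where "c = Re (cinner (A z) z)"
  have n: "n > 0" using \<open>A y \<noteq> 0\<close> by (simp add: n_def z_def)
  have c: "c \<ge> 0" using assms(1) by (auto simp: positive_op_def complex_nonneg_Reals_iff c_def)
  have pos: "0 \<le> Re (cinner (A (y + t *\<^sub>R z)) (y + t *\<^sub>R z))" for t
    using assms(1) by (auto simp: positive_op_def complex_nonneg_Reals_iff)
  have "Re (cinner (A (y + t *\<^sub>R z)) (y + t *\<^sub>R z)) = 2 * t * n + t\<^sup>2 * c" for t
  proof -
    have "cinner (A z) y = cinner z z" by (simp add: positive_op_selfadjoint[OF assms(1)] z_def)
    moreover have "cinner (A y) z = cinner z z" by (simp add: z_def)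
    ultimately show ?thesis
      using assms(2)
      by (simp add: bop_add[OF A] bop_scaleR[OF A] cinner_algebra cinner_scaleR_left
          cinner_scaleR_right c_def n_def cinner_self power2_eq_square algebra_simps)
  qed
  then have q: "0 \<le> 2 * t * n + t\<^sup>2 * c" for t using pos[of t] by simp
  \<comment> \<open>Dividing by \<open>c + 1\<close> also covers \<open>c = 0\<close>, and at
    \<open>t = - u\<close> the quadratic becomes the negative number
    \<open>u\<^sup>2 * (- c - 2)\<close>.\<close>
  define u where "u = n / (c + 1)"
  have u: "u > 0" "n = u * (c + 1)" using c n by (auto simp: u_def)
  have "2 * (- u) * n + (- u)\<^sup>2 * c = u\<^sup>2 * (- c - 2)"
    by (simp add: u(2) power2_eq_square algebra_simps)
  also have "\<dots> < 0" using c u by (intro mult_pos_neg) auto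
  finally show False using q[of "- u"] by simp
qed

text \<open>Commuting roots satisfy (B + S)(B - S) = 0. At \<open>y = B x - S x\<close> the two
  nonnegative forms thus sum to 0, so \<open>B y = S y = 0\<close>, and then \<open>y\<close> is
  orthogonal to itself.\<close>

lemma positive_sqrt_unique:
  assumes "positive_op S" "positive_op B" "\<And>x. S (S x) = B (B x)" "\<And>x. S (B x) = B (S x)"
  shows "S = B"
proof
  fix x
  note SB = positive_op_bop[OF assms(1)] positive_op_bop[OF assms(2)]
  define y where "y = B x - S x"
  have "cinner (B y) y + cinner (S y) y = cinner (B y + S y) y" by (simp add: cinner_add_left)
  also have "B y + S y = 0" by (simp add: y_def bop_diff SB assms(3,4))
  finally have sum0: "cinner (B y) y + cinner (S y) y = 0" by simp
  have "cinner (B y) y \<in> \<real>\<^sub>\<ge>\<^sub>0" "cinner (S y) y \<in> \<real>\<^sub>\<ge>\<^sub>0"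
    using assms(1,2) by (auto simp: positive_op_def)
  then have "cinner (B y) y = 0" "cinner (S y) y = 0"
    using sum0 by (auto simp: complex_nonneg_Reals_iff complex_eq_iff)
  then have "B y = 0" "S y = 0" using assms positive_op_null by blast+
  moreover have "cinner y y = cinner x (B y - S y)"
    by (simp add: y_def[symmetric] cinner_diff_right positive_op_selfadjoint[OF assms(1), symmetric]
        positive_op_selfadjoint[OF assms(2), symmetric])
      (simp add: y_def cinner_diff_left)
  ultimately have "y = 0" by simp
  then show "S x = B x" by (simp add: y_def)
qed

text \<open>The Taylor coefficients of \<open>1 - sqrt (1 - t)\<close>; the recursion comes from
  \<open>b(t) = (t + b(t)\<^sup>2) / 2\<close>.\<close>

function sqrt_coeff :: "nat \<Rightarrow> real" where
  "sqrt_coeff n = (1/2) * ((if n = 1 then 1 else 0)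
     + (\<Sum>j\<in>{0<..<n}. sqrt_coeff j * sqrt_coeff (n - j)))"
  by auto
termination by (relation less_than) auto

declare sqrt_coeff.simps [simp del]

lemma sqrt_coeff_0: "sqrt_coeff 0 = 0"
  by (subst sqrt_coeff.simps) simp

lemma sqrt_coeff_nonneg: "sqrt_coeff n \<ge> 0"
proof (induction n rule: less_induct)
  case (less n)
  have "0 \<le> (\<Sum>j\<in>{0<..<n}. sqrt_coeff j * sqrt_coeff (n - j))"
    by (intro sum_nonneg mult_nonneg_nonneg less) auto
  then show ?case by (subst sqrt_coeff.simps) simp
qed

text \<open>The recursion in Cauchy product form; the end terms \<open>j = 0\<close> and
  \<open>j = n\<close> vanish because \<open>sqrt_coeff 0 = 0\<close>.\<close>

lemma sqrt_coeff_conv: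
  "(\<Sum>j\<le>n. sqrt_coeff j * sqrt_coeff (n - j)) = 2 * sqrt_coeff n - (if n = 1 then 1 else 0)"
proof -
  have "(\<Sum>j\<le>n. sqrt_coeff j * sqrt_coeff (n - j))
      = (\<Sum>j\<in>{0<..<n}. sqrt_coeff j * sqrt_coeff (n - j))"
    by (rule sum.mono_neutral_right) (auto simp: sqrt_coeff_0 not_less)
  then show ?thesis using sqrt_coeff.simps[of n] by simp
qed

text \<open>The recursion bounds twice the next partial sum by 1 plus the square of the present one,
  so the bound 1 propagates.\<close>

lemma sum_sqrt_coeff_le: "(\<Sum>k\<le>n. sqrt_coeff k) \<le> 1"
proof (induction n)
  case (Suc n)
  let ?c = sqrt_coeff and ?I = "SIGMA k:{..Suc n}. {0<..<k}"
  have "2 * (\<Sum>k\<le>Suc n. ?c k)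
      = (\<Sum>k\<le>Suc n. (if k = 1 then 1 else 0) + (\<Sum>j\<in>{0<..<k}. ?c j * ?c (k - j)))"
    unfolding sum_distrib_left by (intro sum.cong refl, subst sqrt_coeff.simps) simp
  also have "\<dots> = 1 + (\<Sum>k\<le>Suc n. \<Sum>j\<in>{0<..<k}. ?c j * ?c (k - j))"
    by (simp add: sum.distrib)
  also have "(\<Sum>k\<le>Suc n. \<Sum>j\<in>{0<..<k}. ?c j * ?c (k - j))
      = (\<Sum>(k, j)\<in>?I. ?c j * ?c (k - j))"
    by (rule sum.Sigma) auto
  \<comment> \<open>Both entries of the new pair are at least 1 and add up to at most
    \<open>Suc n\<close>, so the pair lies in the square
    \<open>{..n} \<times> {..n}\<close>.\<close>
  also have "\<dots> = (\<Sum>(j, i)\<in>(\<lambda>(k, j). (j, k - j)) ` ?I. ?c j * ?c i)"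
    by (subst sum.reindex) (auto simp: inj_on_def case_prod_beta)
  also have "\<dots> \<le> (\<Sum>(j, i)\<in>{..n} \<times> {..n}. ?c j * ?c i)"
    by (rule sum_mono2) (auto simp: sqrt_coeff_nonneg)
  also have "\<dots> = (\<Sum>k\<le>n. ?c k) * (\<Sum>k\<le>n. ?c k)"
    by (simp add: sum_product sum.cartesian_product)
  also have "\<dots> \<le> 1 * 1"
    by (intro mult_mono Suc.IH sum_nonneg sqrt_coeff_nonneg) simp
  finally show ?case by simp
qed (simp add: sqrt_coeff_0)

lemma sqrt_coeff_summable: "sqrt_coeff summable_on UNIV"
  and infsum_sqrt_coeff_le: "(\<Sum>\<^sub>\<infinity>k. sqrt_coeff k) \<le> 1"
proof -
  have le: "sum sqrt_coeff F \<le> 1" if "finite F" for F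
  proof -
    have "sum sqrt_coeff F \<le> sum sqrt_coeff {..Max (insert 0 F)}"
      by (rule sum_mono2) (use that in \<open>auto simp: sqrt_coeff_nonneg\<close>)
    then show ?thesis using sum_sqrt_coeff_le order_trans by blast
  qed
  show s: "sqrt_coeff summable_on UNIV"
    by (rule nonneg_bdd_above_summable_on)
      (auto simp: sqrt_coeff_nonneg le intro!: bdd_aboveI2[where M = 1])
  show "(\<Sum>\<^sub>\<infinity>k. sqrt_coeff k) \<le> 1"
    by (rule infsum_le_finite_sums[OF s]) (use le in auto)
qed

section \<open>The positive square root of I - C as a power series in a self-adjoint contraction
  C\<close>

definition sqrt_series :: "('a::chilbert_space \<Rightarrow> 'a) \<Rightarrow> 'a \<Rightarrow> 'a" where
  "sqrt_series C x = (\<Sum>\<^sub>\<infinity>k. sqrt_coeff k *\<^sub>R (C ^^ k) x)"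

text \<open>Used twice: with \<open>C' = C\<close>, to show that every positive root commutes with
  the series, and with the two products of \<open>A\<close> and its adjoint, to intertwine the
  defect operators.\<close>

lemma sqrt_series_intertwine:
  assumes X: "X \<in> bop UNIV UNIV" and XC: "\<And>x. X (C x) = C' (X x)"
    and s: "(\<lambda>k. sqrt_coeff k *\<^sub>R (C ^^ k) x) summable_on UNIV"
  shows "X (sqrt_series C x) = sqrt_series C' (X x)"
proof -
  have "X ((C ^^ k) x) = (C' ^^ k) (X x)" for k
    by (induction k) (auto simp: XC)
  then have "((\<lambda>k. sqrt_coeff k *\<^sub>R (C' ^^ k) (X x)) has_sum X (sqrt_series C x)) UNIV"
    using has_sum_bounded_linear[OF bop_bounded_linear[OF X] has_sum_infsum[OF s]]
    by (simp add: bop_scaleR[OF X] sqrt_series_def)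
  then show ?thesis unfolding sqrt_series_def by (simp add: infsumI)
qed

locale contraction =
  fixes C :: "'a::chilbert_space \<Rightarrow> 'a"
  assumes C: "C \<in> bop UNIV UNIV" and C_le: "\<And>x. norm (C x) \<le> norm x"
begin

lemma funpow_bop: "C ^^ k \<in> bop UNIV UNIV"
proof (induction k)
  case 0
  show ?case using bop_id by (simp add: id_def)
next
  case (Suc k)
  show ?case using bop_comp[OF C Suc] by (simp add: comp_def)
qed

lemma funpow_le: "norm ((C ^^ k) x) \<le> norm x"
  by (induction k) (auto intro: order_trans C_le)

lemma term_le: "norm (sqrt_coeff k *\<^sub>R (C ^^ k) x) \<le> sqrt_coeff k * norm x"
  by (simp add: sqrt_coeff_nonneg mult_left_mono funpow_le)

lemma series_abs_summable: "(\<lambda>k. norm (sqrt_coeff k *\<^sub>R (C ^^ k) x)) summable_on UNIV"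
  by (rule summable_on_comparison_test[OF summable_on_cmult_left[OF sqrt_coeff_summable]])
    (use term_le in auto)

lemma series_summable: "(\<lambda>k. sqrt_coeff k *\<^sub>R (C ^^ k) x) summable_on UNIV"
  by (rule abs_summable_summable[OF series_abs_summable])

lemma series_has_sum: "((\<lambda>k. sqrt_coeff k *\<^sub>R (C ^^ k) x) has_sum sqrt_series C x) UNIV"
  unfolding sqrt_series_def by (rule has_sum_infsum[OF series_summable])

lemma series_le: "norm (sqrt_series C x) \<le> norm x"
proof -
  have "norm (sqrt_series C x) \<le> (\<Sum>\<^sub>\<infinity>k. sqrt_coeff k * norm x)"
    by (rule norm_infsum_le[OF series_has_sum has_sum_infsum[OF summable_on_cmult_left[OF sqrt_coeff_summable]]])
      (use term_le in auto)
  also have "\<dots> = (\<Sum>\<^sub>\<infinity>k. sqrt_coeff k) * norm x" by (rule infsum_cmult_left')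
  also have "\<dots> \<le> 1 * norm x" by (intro mult_right_mono infsum_sqrt_coeff_le) simp
  finally show ?thesis by simp
qed

lemma series_bop: "sqrt_series C \<in> bop UNIV UNIV"
proof (rule bopI)
  show "sqrt_series C (x + y) = sqrt_series C x + sqrt_series C y" for x y
    using has_sum_add[OF series_has_sum[of x] series_has_sum[of y]]
    by (simp add: sqrt_series_def infsumI bop_add[OF funpow_bop] scaleR_add_right)
  show "sqrt_series C (c *\<^sub>C x) = c *\<^sub>C sqrt_series C x" for c x
    using has_sum_bounded_linear[OF bounded_linear_scaleC[of c] series_has_sum[of x]]
    by (simp add: sqrt_series_def infsumI bop_scaleC[OF funpow_bop] scaleR_scaleC scaleC_scaleC
        mult.commute)
  show "norm (sqrt_series C x) \<le> 1 * norm x" for x using series_le by simp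
qed

lemma series_selfadjoint:
  assumes "\<And>x y. cinner (C x) y = cinner x (C y)"
  shows "cinner (sqrt_series C x) y = cinner x (sqrt_series C y)"
proof -
  have "cinner ((C ^^ k) x) y = cinner x ((C ^^ k) y)" for k x y
    by (induction k arbitrary: x y) (auto simp: assms funpow_swap1)
  then have eq: "cinner (sqrt_coeff k *\<^sub>R (C ^^ k) x) y = cnj (cinner (sqrt_coeff k *\<^sub>R (C ^^ k) y) x)" for k
    by (simp add: cinner_scaleR_left cinner_commute[of x])
  have "((\<lambda>k. cinner (sqrt_coeff k *\<^sub>R (C ^^ k) x) y) has_sum cinner (sqrt_series C x) y) UNIV"
    by (rule has_sum_bounded_linear[OF bounded_linear_cinner_left series_has_sum])
  moreover have "((\<lambda>k. cnj (cinner (sqrt_coeff k *\<^sub>R (C ^^ k) y) x)) has_sum cnj (cinner (sqrt_series C y) x)) UNIV"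
    by (rule has_sum_bounded_linear[OF bounded_linear_cnj
          has_sum_bounded_linear[OF bounded_linear_cinner_left series_has_sum]])
  ultimately have "cinner (sqrt_series C x) y = cnj (cinner (sqrt_series C y) x)"
    unfolding eq using has_sum_unique by blast
  then show ?thesis by (simp add: cinner_commute[of x])
qed

text \<open>The double series converges absolutely and may be regrouped by total degree
  \<open>n = j + k\<close>; its inner sums are the coefficients of b(t)^2 = 2 b(t) - t.\<close>

lemma series_series: "sqrt_series C (sqrt_series C x) = 2 *\<^sub>R sqrt_series C x - C x"
proof -
  let ?c = sqrt_coeff
  define f where "f = (\<lambda>(j, k). (?c j * ?c k) *\<^sub>R (C ^^ (j + k)) x)"
  have cc: "(\<lambda>(j, k). ?c j * ?c k) summable_on UNIV \<times> UNIV"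
    by (rule summable_on_SigmaI[where g = "\<lambda>j. ?c j * infsum ?c UNIV"])
      (auto intro!: has_sum_cmult_right summable_on_cmult_left mult_nonneg_nonneg
        simp: sqrt_coeff_summable sqrt_coeff_nonneg)
  have f: "f summable_on UNIV \<times> UNIV"
  proof (rule abs_summable_summable, rule summable_on_comparison_test[OF summable_on_cmult_left[OF cc]])
    show "norm (f p) \<le> (case p of (j, k) \<Rightarrow> ?c j * ?c k) * norm x" for p
      by (cases p) (simp add: f_def sqrt_coeff_nonneg mult_left_mono funpow_le)
  qed auto
  have "sqrt_series C (sqrt_series C x) = (\<Sum>\<^sub>\<infinity>j. \<Sum>\<^sub>\<infinity>k. f (j, k))"
  proof -
    have "?c j *\<^sub>R (C ^^ j) (sqrt_series C x) = (\<Sum>\<^sub>\<infinity>k. f (j, k))" for j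
    proof -
      have "((\<lambda>k. ?c j *\<^sub>R (C ^^ j) (?c k *\<^sub>R (C ^^ k) x)) has_sum
          ?c j *\<^sub>R (C ^^ j) (sqrt_series C x)) UNIV"
        by (rule has_sum_bounded_linear[OF _ series_has_sum])
          (intro bounded_linear_const_scaleR bop_bounded_linear funpow_bop)
      moreover have "?c j *\<^sub>R (C ^^ j) (?c k *\<^sub>R (C ^^ k) x) = f (j, k)" for k
        by (simp add: f_def bop_scaleR[OF funpow_bop] funpow_add)
      ultimately show ?thesis by (simp add: infsumI)
    qed
    then show ?thesis by (subst sqrt_series_def) simp
  qed
  also have "\<dots> = infsum f (UNIV \<times> UNIV)" by (rule infsum_Sigma_banach[OF f])
  also have "\<dots> = (\<Sum>\<^sub>\<infinity>(n, j)\<in>Sigma UNIV (\<lambda>n. {..n}). f (j, n - j))"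
    by (rule infsum_reindex_bij_witness[of _ "\<lambda>(n, j). (j, n - j)" "\<lambda>(j, k). (j + k, j)"]) auto
  also have "\<dots> = (\<Sum>\<^sub>\<infinity>n. \<Sum>\<^sub>\<infinity>j\<in>{..n}. f (j, n - j))"
  proof (subst infsum_Sigma_banach[symmetric])
    have "(\<lambda>(n, j). f (j, n - j)) summable_on Sigma UNIV (\<lambda>n. {..n}) \<longleftrightarrow> f summable_on UNIV \<times> UNIV"
      by (rule summable_on_reindex_bij_witness[of _ "\<lambda>(j, k). (j + k, j)" "\<lambda>(n, j). (j, n - j)"]) auto
    then show "(\<lambda>(n, j). f (j, n - j)) summable_on Sigma UNIV (\<lambda>n. {..n})" using f by simp
  qed simp
  also have "(\<lambda>n. \<Sum>\<^sub>\<infinity>j\<in>{..n}. f (j, n - j))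
      = (\<lambda>n. 2 *\<^sub>R (?c n *\<^sub>R (C ^^ n) x) - (if n = 1 then C x else 0))"
  proof
    fix n
    have "(\<Sum>\<^sub>\<infinity>j\<in>{..n}. f (j, n - j)) = (\<Sum>j\<le>n. ?c j * ?c (n - j)) *\<^sub>R (C ^^ n) x"
      by (simp add: f_def scaleR_sum_left)
    then show "(\<Sum>\<^sub>\<infinity>j\<in>{..n}. f (j, n - j)) = 2 *\<^sub>R (?c n *\<^sub>R (C ^^ n) x) - (if n = 1 then C x else 0)"
      by (simp add: sqrt_coeff_conv scaleR_diff_left)
  qed
  also have "infsum \<dots> UNIV = 2 *\<^sub>R sqrt_series C x - C x"
  proof -
    have 1: "((\<lambda>n. 2 *\<^sub>R (?c n *\<^sub>R (C ^^ n) x)) has_sum 2 *\<^sub>R sqrt_series C x) UNIV"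
      by (rule has_sum_bounded_linear[OF bounded_linear_scaleR_right series_has_sum])
    have "((\<lambda>n. if n = 1 then C x else 0) has_sum C x) {1::nat}"
      by (rule has_sum_finiteI) auto
    then have "((\<lambda>n. if n = 1 then C x else 0) has_sum C x) (UNIV :: nat set)"
      by (rule has_sum_cong_neutral[THEN iffD1, rotated -1]) auto
    with 1 show ?thesis
      using has_sum_add[OF 1 has_sum_bounded_linear[OF bounded_linear_minus[OF bounded_linear_ident]]]
      by (intro infsumI) fastforce
  qed
  finally show ?thesis .
qed

lemma positive_root:
  assumes sa: "\<And>x y. cinner (C x) y = cinner x (C y)"
  shows "positive_op (\<lambda>x. x - sqrt_series C x)"
  unfolding positive_op_def
proof (intro conjI allI)
  show "(\<lambda>x. x - sqrt_series C x) \<in> bop UNIV UNIV"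
    using bop_diff_fun[OF bop_id series_bop] by simp
  fix x
  have "cinner (sqrt_series C x) x = cnj (cinner (sqrt_series C x) x)"
    by (subst series_selfadjoint[OF sa]) (rule cinner_commute)
  then have "Im (cinner (sqrt_series C x) x) = 0" by (simp add: complex_eq_iff)
  moreover have "Re (cinner (sqrt_series C x) x) \<le> (norm x)\<^sup>2"
  proof -
    have "Re (cinner (sqrt_series C x) x) \<le> norm (sqrt_series C x) * norm x"
      using complex_Re_le_cmod norm_cinner_le order_trans by blast
    also have "\<dots> \<le> norm x * norm x" by (intro mult_right_mono series_le) simp
    finally show ?thesis by (simp add: power2_eq_square)
  qed
  ultimately show "cinner (x - sqrt_series C x) x \<in> \<real>\<^sub>\<ge>\<^sub>0"
    by (auto simp: complex_nonneg_Reals_iff cinner_diff_left cinner_self)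
qed

text \<open>A positive root \<open>B\<close> commutes with its own square, hence with
  \<open>C\<close> and with the series, so uniqueness among commuting roots is enough.\<close>

lemma sqrt_op_eq:
  assumes sa: "\<And>x y. cinner (C x) y = cinner x (C y)"
  shows "sqrt_op (\<lambda>x. x - C x) = (\<lambda>x. x - sqrt_series C x)"
  unfolding sqrt_op_def
proof (rule the_equality)
  let ?S = "\<lambda>x. x - sqrt_series C x"
  have SS: "?S (?S x) = x - C x" for x
    by (simp add: bop_diff[OF series_bop] series_series scaleR_2)
  show "positive_op ?S \<and> ?S \<circ> ?S = (\<lambda>x. x - C x)"
    using positive_root[OF sa] SS by auto
  fix B assume B: "positive_op B \<and> B \<circ> B = (\<lambda>x. x - C x)"
  then have BB: "B (B x) = x - C x" for x by (metis comp_apply)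
  have Bb: "B \<in> bop UNIV UNIV" using B positive_op_bop by blast
  have "B (C x) = C (B x)" for x
    using BB[of "B x"] arg_cong[OF BB[of x], of B] by (simp add: bop_diff[OF Bb])
  then have "B (sqrt_series C x) = sqrt_series C (B x)" for x
    by (rule sqrt_series_intertwine[OF Bb _ series_summable])
  then show "B = ?S"
    using B BB SS positive_root[OF sa]
    by (intro positive_sqrt_unique) (auto simp: bop_diff[OF Bb])
qed

end

section \<open>Defect operators and the Julia operator of a contraction\<close>

locale row_operator =
  fixes A :: "'b::chilbert_space \<Rightarrow> 'a::chilbert_space"
  assumes A: "A \<in> bop UNIV UNIV" and A_le: "\<And>v. norm (A v) \<le> norm v"
begin

definition "D = sqrt_op (\<lambda>x. x - A (adj A x))"
definition "E = sqrt_op (\<lambda>v. v - adj A (A v))"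

lemma adj_A: "adj A \<in> bop UNIV UNIV"
  by (rule adj_bop[OF A])

lemma adj_A_le: "norm (adj A x) \<le> norm x"
  using norm_adj_le[OF A, of 1 x] A_le by simp

sublocale AA: contraction "A \<circ> adj A"
  by standard (auto intro: bop_comp A adj_A order_trans[OF A_le adj_A_le])

sublocale A'A: contraction "adj A \<circ> A"
  by standard (auto intro: bop_comp A adj_A order_trans[OF adj_A_le A_le])

lemma selfadjoint_AA: "cinner ((A \<circ> adj A) x) y = cinner x ((A \<circ> adj A) y)"
  by (simp add: cinner_adj[OF A] cinner_adj'[OF A])

lemma selfadjoint_A'A: "cinner ((adj A \<circ> A) x) y = cinner x ((adj A \<circ> A) y)"
  by (simp add: cinner_adj[OF A] cinner_adj'[OF A])

lemma D_eq: "D = (\<lambda>x. x - sqrt_series (A \<circ> adj A) x)"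
  using AA.sqrt_op_eq[OF selfadjoint_AA] by (simp add: D_def)

lemma E_eq: "E = (\<lambda>x. x - sqrt_series (adj A \<circ> A) x)"
  using A'A.sqrt_op_eq[OF selfadjoint_A'A] by (simp add: E_def)

lemma D: "D \<in> bop UNIV UNIV"
  using bop_diff_fun[OF bop_id AA.series_bop] by (simp add: D_eq)

lemma E: "E \<in> bop UNIV UNIV"
  using bop_diff_fun[OF bop_id A'A.series_bop] by (simp add: E_eq)

lemma D_selfadjoint: "cinner (D x) y = cinner x (D y)"
  using positive_op_selfadjoint[OF AA.positive_root[OF selfadjoint_AA]] by (simp add: D_eq)

lemma E_selfadjoint: "cinner (E x) y = cinner x (E y)"
  using positive_op_selfadjoint[OF A'A.positive_root[OF selfadjoint_A'A]] by (simp add: E_eq)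

lemma D_D: "D (D x) = x - A (adj A x)"
  by (simp add: D_eq bop_diff[OF AA.series_bop] AA.series_series scaleR_2)

lemma E_E: "E (E v) = v - adj A (A v)"
  by (simp add: E_eq bop_diff[OF A'A.series_bop] A'A.series_series scaleR_2)

text \<open>\<open>A\<close> intertwines \<open>adj A \<circ> A\<close> with
  \<open>A \<circ> adj A\<close>, and therefore the square root series of both.\<close>

lemma A_E: "A (E v) = D (A v)"
  using sqrt_series_intertwine[OF A _ A'A.series_summable, of "A \<circ> adj A" v]
  by (simp add: D_eq E_eq bop_diff[OF A])

lemma adj_A_D: "adj A (D x) = E (adj A x)"
  using sqrt_series_intertwine[OF adj_A _ AA.series_summable, of "adj A \<circ> A" x]
  by (simp add: D_eq E_eq bop_diff[OF adj_A])

text \<open>The squares of \<open>D\<close> and \<open>E\<close> restore what \<open>adj A\<close>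
  and \<open>A\<close> lose, and the mixed terms cancel by \<open>A_E\<close>. This is the energy
  law of one forward step.\<close>

lemma julia_isometry:
  "cinner (adj A x + E v) (adj A y + E w) + cinner (D x - A v) (D y - A w) = cinner x y + cinner v w"
proof -
  have "cinner (E v) (E w) = cinner v w - cinner (A v) (A w)"
    by (simp add: E_selfadjoint E_E cinner_diff_right cinner_adj[OF A])
  moreover have "cinner (D x) (D y) = cinner x y - cinner (adj A x) (adj A y)"
    by (simp add: D_selfadjoint D_D cinner_diff_right cinner_adj'[OF A])
  moreover have "cinner (adj A x) (E w) = cinner (D x) (A w)"
    by (simp add: cinner_adj'[OF A] D_selfadjoint A_E)
  moreover have "cinner (E v) (adj A y) = cinner (A v) (D y)"
    by (simp add: cinner_adj[OF A, symmetric] D_selfadjoint[symmetric] A_E)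
  ultimately show ?thesis by (simp add: cinner_algebra)
qed

text \<open>The energy law of one backward step, which is the adjoint of the Julia operator.\<close>

lemma julia_coisometry:
  "cinner (A v + D x) (A w + D y) + cinner (E v - adj A x) (E w - adj A y) = cinner v w + cinner x y"
proof -
  have "cinner (E v) (E w) = cinner v w - cinner (A v) (A w)"
    by (simp add: E_selfadjoint E_E cinner_diff_right cinner_adj[OF A])
  moreover have "cinner (D x) (D y) = cinner x y - cinner (adj A x) (adj A y)"
    by (simp add: D_selfadjoint D_D cinner_diff_right cinner_adj'[OF A])
  moreover have "cinner (adj A x) (E w) = cinner (D x) (A w)"
    by (simp add: cinner_adj'[OF A] D_selfadjoint A_E)
  moreover have "cinner (E v) (adj A y) = cinner (A v) (D y)"
    by (simp add: cinner_adj[OF A, symmetric] D_selfadjoint[symmetric] A_E)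
  ultimately show ?thesis by (simp add: cinner_algebra)
qed

text \<open>Pairs a forward step with a backward step; summed over words it yields the adjointness
  of the two systems.\<close>

lemma julia_adjoint:
  "cinner (adj A z + E v) p + cinner (D z - A v) y = cinner z (A p + D y) + cinner v (E p - adj A y)"
  by (simp add: cinner_algebra cinner_adj[OF A] cinner_adj'[OF A] D_selfadjoint E_selfadjoint)

end


section \<open>Operators on vector-valued \<open>\<ell>\<^sup>2\<close> spaces\<close>

lemma ell2_eqI: "(\<And>i. coeff x i = coeff y i) \<Longrightarrow> x = y"
  by (simp add: coeff_inject[symmetric] fun_eq_iff)

lemmas coeff_simps = zero_ell2.rep_eq plus_ell2.rep_eq minus_ell2.rep_eq uminus_ell2.rep_eq
  scaleR_ell2.rep_eq scaleC_ell2.rep_eq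

lemma coeff_sum: "coeff (\<Sum>i\<in>I. f i) j = (\<Sum>i\<in>I. coeff (f i) j)"
  by (induction I rule: infinite_finite_induct) (auto simp: coeff_simps)

lemma coeff_bop: "(\<lambda>x. coeff x i) \<in> bop UNIV UNIV"
  by (rule bopI[where b = 1]) (auto simp: coeff_simps norm_coeff_le)

lemma cinner_ell2_has_sum: "((\<lambda>i. cinner (coeff x i) (coeff y i)) has_sum cinner x y) UNIV"
  unfolding cinner_ell2_def by (rule has_sum_infsum[OF ell2_cinner_summable])

lemma norm_ell2_has_sum: "((\<lambda>i. (norm (coeff x i))\<^sup>2) has_sum (norm x)\<^sup>2) UNIV"
  unfolding norm_ell2_sq
  by (rule has_sum_infsum) (use coeff_square_summable[of x] in \<open>simp add: square_summable_def\<close>)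

lemma norm_ell2_leI:
  assumes "\<And>i. norm (coeff x i) \<le> b * norm (coeff y i)" "b \<ge> 0"
  shows "norm x \<le> b * norm y"
proof (rule power2_le_imp_le)
  have "(norm x)\<^sup>2 \<le> b\<^sup>2 * (norm y)\<^sup>2"
  proof (rule has_sum_mono[OF norm_ell2_has_sum has_sum_cmult_right[OF norm_ell2_has_sum]])
    show "(norm (coeff x i))\<^sup>2 \<le> b\<^sup>2 * (norm (coeff y i))\<^sup>2" for i
      using power_mono[OF assms(1) norm_ge_zero, of i 2] by (simp add: power_mult_distrib)
  qed
  then show "(norm x)\<^sup>2 \<le> (b * norm y)\<^sup>2" by (simp add: power_mult_distrib)
qed (use assms(2) in simp)

lemma square_summable_le:
  assumes "square_summable f" "\<And>i. norm (g i) \<le> b * norm (f i)"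
  shows "square_summable g"
  unfolding square_summable_def
proof (rule summable_on_comparison_test)
  show "(\<lambda>i. b\<^sup>2 * (norm (f i))\<^sup>2) summable_on UNIV"
    using assms(1) unfolding square_summable_def by (intro summable_on_cmult_right)
  show "(norm (g i))\<^sup>2 \<le> b\<^sup>2 * (norm (f i))\<^sup>2" for i
    using power_mono[OF assms(2) norm_ge_zero, of i 2] by (simp add: power_mult_distrib)
qed simp

text \<open>\<open>coeffwise B\<close> is \<open>I \<otimes> B\<close>.\<close>

definition coeffwise :: "('h \<Rightarrow> 'k) \<Rightarrow> ('i, 'h::chilbert_space) ell2 \<Rightarrow> ('i, 'k::chilbert_space) ell2" where
  "coeffwise B x = Abs_ell2 (\<lambda>i. B (coeff x i))"

lemma coeff_coeffwise: "B \<in> bop UNIV UNIV \<Longrightarrow> coeff (coeffwise B x) i = B (coeff x i)"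
proof -
  assume "B \<in> bop UNIV UNIV"
  then obtain b where "\<And>v. norm (B v) \<le> b * norm v" by (auto simp: bop_def)
  then have "square_summable (\<lambda>i. B (coeff x i))"
    by (intro square_summable_le[OF coeff_square_summable[of x], of _ b])
  then show ?thesis by (simp add: coeffwise_def Abs_ell2_inverse)
qed

lemma norm_coeffwise_le:
  assumes "B \<in> bop UNIV UNIV" "\<And>v. norm (B v) \<le> b * norm v" "b \<ge> 0"
  shows "norm (coeffwise B x) \<le> b * norm x"
  by (rule norm_ell2_leI) (use assms in \<open>auto simp: coeff_coeffwise\<close>)

lemma coeffwise_bop:
  assumes "B \<in> bop UNIV UNIV"
  shows "coeffwise B \<in> bop UNIV UNIV"
proof -
  obtain b where b: "\<And>v. norm (B v) \<le> b * norm v" using assms by (auto simp: bop_def)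
  have b': "norm (B v) \<le> \<bar>b\<bar> * norm v" for v
    by (rule order_trans[OF b mult_right_mono]) auto
  show ?thesis
  proof (rule bopI)
    show "norm (coeffwise B x) \<le> \<bar>b\<bar> * norm x" for x :: "('i, 'a) ell2"
      by (intro norm_coeffwise_le assms b') simp
  qed (auto intro!: ell2_eqI simp: coeff_coeffwise assms coeff_simps bop_add bop_scaleC)
qed

text \<open>The adjoint of \<open>\<lambda>f. f \<otimes>\<^sub>v k\<close>. Slices reduce
  statements about subspaces of the tensor product to the scalar Fock space.\<close>

lift_definition slice :: "'h::chilbert_space \<Rightarrow> ('i, 'h) ell2 \<Rightarrow> ('i, complex) ell2"
  is "\<lambda>k f i. cinner (f i) k"
  subgoal for k f
    by (rule square_summable_le[of f _ "norm k"])
      (auto intro: order_trans[OF norm_cinner_le] simp: mult.commute)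
  done

lemma slice_bop: "slice k \<in> bop UNIV UNIV"
proof (rule bopI)
  show "norm (slice k x) \<le> norm k * norm x" for x
    by (rule norm_ell2_leI) (simp_all add: slice.rep_eq mult.commute[of "norm k"] norm_cinner_le)
qed (auto intro!: ell2_eqI simp: slice.rep_eq coeff_simps cinner_add_left
    cinner_scaleC_left scaleC_complex_def)

lemma slice_tensor: "slice k (f \<otimes>\<^sub>v l) = cinner l k *\<^sub>C f"
  by (rule ell2_eqI)
    (simp add: slice.rep_eq tensor.rep_eq coeff_simps cinner_scaleC_left scaleC_complex_def)

lemma cinner_tensor: "cinner x (f \<otimes>\<^sub>v k) = cinner (slice k x) f"
  unfolding cinner_ell2_def
  by (simp add: slice.rep_eq tensor.rep_eq cinner_scaleC_right cinner_complex_def mult.commute)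

lemma slice_coeffwise: "B \<in> bop UNIV UNIV \<Longrightarrow> slice k (coeffwise B x) = slice (adj B k) x"
  by (rule ell2_eqI) (simp add: slice.rep_eq coeff_coeffwise cinner_adj)

lemma coeffwise_tensor: "B \<in> bop UNIV UNIV \<Longrightarrow> coeffwise B (f \<otimes>\<^sub>v k) = f \<otimes>\<^sub>v B k"
  by (rule ell2_eqI) (simp add: coeff_coeffwise tensor.rep_eq bop_scaleC)

lemma tensor_diff_left: "(f - g) \<otimes>\<^sub>v k = f \<otimes>\<^sub>v k - g \<otimes>\<^sub>v k"
  by (rule ell2_eqI) (metis (no_types, lifting) add_diff_cancel_right' coeff_simps(2,3)
      diff_add_cancel scaleC_add_left tensor.rep_eq)

text \<open>For \<open>h = (@) \<delta>\<close> this is the adjoint of left creation along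
  \<open>\<delta>\<close>, tensored with the identity.\<close>

definition pull :: "('j \<Rightarrow> 'i) \<Rightarrow> ('i, 'h::chilbert_space) ell2 \<Rightarrow> ('j, 'h) ell2" where
  "pull h x = Abs_ell2 (\<lambda>i. coeff x (h i))"

lemma coeff_pull: "inj h \<Longrightarrow> coeff (pull h x) i = coeff x (h i)"
proof -
  assume "inj h"
  then have "square_summable (\<lambda>i. coeff x (h i))"
    by (intro square_summable_reindex[OF coeff_square_summable[of x], of h UNIV]) auto
  then show ?thesis by (simp add: pull_def Abs_ell2_inverse)
qed

lemma norm_ell2_diff_finite:
  assumes "finite F" "\<And>i. i \<in> F \<Longrightarrow> coeff y i = coeff x i" "\<And>i. i \<notin> F \<Longrightarrow> coeff y i = 0"
  shows "(norm (x - y))\<^sup>2 = (norm x)\<^sup>2 - (\<Sum>i\<in>F. (norm (coeff x i))\<^sup>2)"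
proof -
  have F: "((\<lambda>i. if i \<in> F then (norm (coeff x i))\<^sup>2 else 0) has_sum (\<Sum>i\<in>F. (norm (coeff x i))\<^sup>2)) UNIV"
    by (rule has_sum_cong_neutral[THEN iffD1, OF _ _ _ has_sum_finite[OF assms(1)]]) auto
  have "((\<lambda>i. (norm (coeff x i))\<^sup>2 + - (if i \<in> F then (norm (coeff x i))\<^sup>2 else 0)) has_sum
      (norm x)\<^sup>2 + - (\<Sum>i\<in>F. (norm (coeff x i))\<^sup>2)) UNIV"
    by (intro has_sum_add norm_ell2_has_sum has_sum_uminusI F)
  moreover have "(norm (coeff x i))\<^sup>2 + - (if i \<in> F then (norm (coeff x i))\<^sup>2 else 0)
      = (norm (coeff (x - y) i))\<^sup>2" for i
    by (simp add: coeff_simps assms)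
  ultimately have "((\<lambda>i. (norm (coeff (x - y) i))\<^sup>2) has_sum
      (norm x)\<^sup>2 + - (\<Sum>i\<in>F. (norm (coeff x i))\<^sup>2)) UNIV" by simp
  then show ?thesis using has_sum_unique[OF norm_ell2_has_sum] by fastforce
qed

text \<open>The squared error of a finite partial sum is the squared norm of \<open>x\<close> minus
  the energy already captured, which tends to 0.\<close>

lemma ell2_basis_has_sum: "((\<lambda>\<alpha>. basis_vec \<alpha> \<otimes>\<^sub>v coeff x \<alpha>) has_sum x) UNIV"
proof -
  let ?s = "\<lambda>F. \<Sum>\<alpha>\<in>F. basis_vec \<alpha> \<otimes>\<^sub>v coeff x \<alpha>"
  have "coeff (basis_vec \<alpha> \<otimes>\<^sub>v coeff x \<alpha>) \<beta> = (if \<beta> = \<alpha> then coeff x \<beta> else 0)" for \<alpha> \<beta>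
    using scaleC_of_real[of 1 "coeff x \<alpha>"] scaleC_of_real[of 0 "coeff x \<alpha>"]
    by (auto simp: tensor.rep_eq basis_vec.rep_eq)
  then have "coeff (?s F) \<beta> = (if \<beta> \<in> F then coeff x \<beta> else 0)" if "finite F" for F \<beta>
    using that by (simp add: coeff_sum)
  then have dist: "(norm (x - ?s F))\<^sup>2 = (norm x)\<^sup>2 - (\<Sum>\<alpha>\<in>F. (norm (coeff x \<alpha>))\<^sup>2)" if "finite F" for F
    using that by (intro norm_ell2_diff_finite) auto
  have ev: "\<forall>\<^sub>F F in finite_subsets_at_top UNIV.
      sqrt ((norm x)\<^sup>2 - (\<Sum>\<alpha>\<in>F. (norm (coeff x \<alpha>))\<^sup>2)) = norm (x - ?s F)"
    by (intro eventually_finite_subsets_at_top_weakI) (simp flip: dist)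
  have "((\<lambda>F. sqrt ((norm x)\<^sup>2 - (\<Sum>\<alpha>\<in>F. (norm (coeff x \<alpha>))\<^sup>2))) \<longlongrightarrow> sqrt ((norm x)\<^sup>2 - (norm x)\<^sup>2))
      (finite_subsets_at_top UNIV)"
    using norm_ell2_has_sum[of x] unfolding has_sum_def by (intro tendsto_intros)
  then have "((\<lambda>F. norm (x - ?s F)) \<longlongrightarrow> 0) (finite_subsets_at_top UNIV)"
    using tendsto_cong[OF ev] by simp
  then show ?thesis
    unfolding has_sum_def by (subst tendsto_dist_iff) (simp add: dist_norm norm_minus_commute)
qed


subsection \<open>Sums over words\<close>

lemma has_sum_sum:
  fixes f :: "'i \<Rightarrow> 'x \<Rightarrow> 'a::topological_comm_monoid_add"
  shows "(\<And>i. i \<in> I \<Longrightarrow> (f i has_sum s i) X) \<Longrightarrow> ((\<lambda>x. \<Sum>i\<in>I. f i x) has_sum (\<Sum>i\<in>I. s i)) X"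
  by (induction I rule: infinite_finite_induct) (auto intro: has_sum_add)

text \<open>Common core of splitting off a first or a last letter: each nonempty word is
  \<open>h i \<alpha>\<close> for exactly one pair.\<close>

lemma words_has_sum:
  fixes f :: "'n::finite list \<Rightarrow> 'a::banach" and h :: "'n \<Rightarrow> 'n list \<Rightarrow> 'n list"
  assumes f: "f summable_on UNIV" and inj: "inj (\<lambda>(i, \<alpha>). h i \<alpha>)"
    and range: "range (\<lambda>(i, \<alpha>). h i \<alpha>) = - {[]}"
  shows "infsum f UNIV = f [] + (\<Sum>i\<in>UNIV. \<Sum>\<^sub>\<infinity>\<alpha>. f (h i \<alpha>))"
proof -
  have inj': "inj (h i)" for i using inj by (auto simp: inj_def)
  have "(f has_sum (\<Sum>\<^sub>\<infinity>\<alpha>. f (h i \<alpha>))) (range (h i))" for i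
    using has_sum_infsum[OF summable_on_subset_banach[OF f, of "range (h i)"]] inj'[of i]
    by (simp add: infsum_reindex comp_def)
  then have "(f has_sum (\<Sum>i\<in>UNIV. \<Sum>\<^sub>\<infinity>\<alpha>. f (h i \<alpha>))) (\<Union>i. range (h i))"
    by (intro sum_has_sum) (use inj in \<open>auto simp: inj_def\<close>)
  also have "(\<Union>i. range (h i)) = range (\<lambda>(i, \<alpha>). h i \<alpha>)" by force
  also note range
  finally have "(f has_sum (f [] + (\<Sum>i\<in>UNIV. \<Sum>\<^sub>\<infinity>\<alpha>. f (h i \<alpha>)))) (insert [] (- {[]}))"
    by (rule has_sum_insert[rotated]) simp
  also have "insert [] (- {[]}) = (UNIV :: 'n list set)" by auto
  finally show ?thesis by (rule infsumI)
qed

lemma infsum_words_Cons: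
  fixes f :: "'n::finite list \<Rightarrow> 'a::banach"
  shows "f summable_on UNIV \<Longrightarrow> infsum f UNIV = f [] + (\<Sum>i\<in>UNIV. \<Sum>\<^sub>\<infinity>\<alpha>. f (i # \<alpha>))"
proof (rule words_has_sum[where h = "\<lambda>i \<alpha>. i # \<alpha>"])
  show "range (\<lambda>(i, \<alpha>). i # \<alpha>) = - {[]}"
    by (auto simp: image_def) (metis list.exhaust)
qed (auto simp: inj_def)

lemma infsum_words_snoc:
  fixes f :: "'n::finite list \<Rightarrow> 'a::banach"
  shows "f summable_on UNIV \<Longrightarrow> infsum f UNIV = f [] + (\<Sum>i\<in>UNIV. \<Sum>\<^sub>\<infinity>\<alpha>. f (\<alpha> @ [i]))"
proof (rule words_has_sum[where h = "\<lambda>i \<alpha>. \<alpha> @ [i]"])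
  show "range (\<lambda>(i, \<alpha>). \<alpha> @ [i]) = - {[]}"
    by (auto simp: image_def) (metis rev_exhaust)
qed (auto simp: inj_def)

lemma finite_words_eq: "finite {\<delta> :: 'n::finite list. length \<delta> = m}"
  using finite_lists_length_eq[of "UNIV :: 'n set" m] by simp

lemma finite_words_less: "finite {\<delta> :: 'n::finite list. length \<delta> < m}"
  by (rule finite_subset[OF _ finite_lists_length_le[of "UNIV :: 'n set" m]]) auto

lemma sum_words_Suc:
  fixes g :: "'n::finite list \<Rightarrow> 'a::comm_monoid_add"
  shows "(\<Sum>\<delta> | length \<delta> = Suc m. g \<delta>) = (\<Sum>\<delta> | length \<delta> = m. \<Sum>i\<in>UNIV. g (\<delta> @ [i]))"
proof -
  have "(\<Sum>\<delta> | length \<delta> = m. \<Sum>i\<in>UNIV. g (\<delta> @ [i]))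
      = (\<Sum>(\<delta>, i)\<in>{\<delta>. length \<delta> = m} \<times> UNIV. g (\<delta> @ [i]))"
    by (rule sum.cartesian_product)
  also have "\<dots> = (\<Sum>\<delta> | length \<delta> = Suc m. g \<delta>)"
    by (rule sum.reindex_bij_witness[of _ "\<lambda>\<delta>. (butlast \<delta>, last \<delta>)" "\<lambda>(\<delta>, i). \<delta> @ [i]"])
      (auto simp: append_butlast_last_id simp flip: length_greater_0_conv)
  finally show ?thesis by simp
qed

text \<open>Telescoping on the tree of words: \<open>a\<close> is the quantity stored at a word,
  \<open>b\<close> and \<open>c\<close> belong to the external signals. Stored terms cancel between
  consecutive levels, leaving only the root and level \<open>m\<close>.\<close>

lemma energy_balance:
  fixes a b c :: "'n::finite list \<Rightarrow> 'a::ab_group_add"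
  assumes "\<And>\<delta>. (\<Sum>i\<in>UNIV. a (\<delta> @ [i])) + b \<delta> = a \<delta> + c \<delta>"
  shows "(\<Sum>\<delta> | length \<delta> = m. a \<delta>) + (\<Sum>\<delta> | length \<delta> < m. b \<delta>)
    = a [] + (\<Sum>\<delta> | length \<delta> < m. c \<delta>)"
proof (induction m)
  case (Suc m)
  have split: "(\<Sum>\<delta> | length \<delta> < Suc m. g \<delta>)
      = (\<Sum>\<delta> | length \<delta> < m. g \<delta>) + (\<Sum>\<delta> | length \<delta> = m. g \<delta>)" for g :: "'n list \<Rightarrow> 'a"
    by (subst sum.union_disjoint[symmetric])
      (auto simp: finite_words_eq finite_words_less intro!: sum.cong)
  have "(\<Sum>\<delta> | length \<delta> = Suc m. a \<delta>) + (\<Sum>\<delta> | length \<delta> = m. b \<delta>)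
      = (\<Sum>\<delta> | length \<delta> = m. a \<delta>) + (\<Sum>\<delta> | length \<delta> = m. c \<delta>)"
    by (simp add: sum_words_Suc assms flip: sum.distrib)
  then show ?case using Suc.IH by (simp add: split algebra_simps) (metis (no_types, lifting) add.assoc add.commute)
qed simp

text \<open>The sets of words of length less than \<open>m\<close> eventually contain every finite
  set, so an unconditional sum can be computed level by level.\<close>

lemma words_less_limit:
  fixes f :: "'n::finite list \<Rightarrow> 'a::real_normed_vector"
  assumes "(f has_sum s) UNIV"
  shows "(\<lambda>m. \<Sum>\<delta> | length \<delta> < m. f \<delta>) \<longlonglongrightarrow> s"
proof -
  have "filterlim (\<lambda>m. {\<delta> :: 'n list. length \<delta> < m}) (finite_subsets_at_top UNIV) sequentially"
    unfolding filterlim_finite_subsets_at_top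
  proof (intro allI impI)
    fix X :: "'n list set" assume X: "finite X \<and> X \<subseteq> UNIV"
    show "\<forall>\<^sub>F m in sequentially. finite {\<delta> :: 'n list. length \<delta> < m} \<and> X \<subseteq> {\<delta>. length \<delta> < m}
        \<and> {\<delta> :: 'n list. length \<delta> < m} \<subseteq> UNIV"
      using eventually_gt_at_top[of "Max (insert 0 (length ` X))"]
    proof eventually_elim
      case (elim m)
      then show ?case using X by (auto simp: finite_words_less)
    qed
  qed
  from filterlim_compose[OF assms[unfolded has_sum_def] this] show ?thesis .
qed

lemma words_square_summableI:
  fixes f :: "'n::finite list \<Rightarrow> 'a::real_normed_vector"
  assumes "\<And>m. (\<Sum>\<delta> | length \<delta> < m. (norm (f \<delta>))\<^sup>2) \<le> B"
  shows "square_summable f"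
  unfolding square_summable_def
proof (rule nonneg_bdd_above_summable_on)
  show "bdd_above (sum (\<lambda>i. (norm (f i))\<^sup>2) ` {F. F \<subseteq> UNIV \<and> finite F})"
  proof (rule bdd_aboveI2)
    fix F :: "'n list set" assume F: "F \<in> {F. F \<subseteq> UNIV \<and> finite F}"
    have "sum (\<lambda>i. (norm (f i))\<^sup>2) F \<le> (\<Sum>\<delta> | length \<delta> < Suc (Max (insert 0 (length ` F))). (norm (f \<delta>))\<^sup>2)"
      by (rule sum_mono2[OF finite_words_less]) (use F in \<open>auto simp: less_Suc_eq_le\<close>)
    then show "sum (\<lambda>i. (norm (f i))\<^sup>2) F \<le> B" using assms order_trans by blast
  qed
qed simp

lemma norm_ell2_le_wordsI:
  fixes x :: "('n::finite list, 'h::chilbert_space) ell2"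
  assumes "\<And>m. (\<Sum>\<delta> | length \<delta> < m. (norm (coeff x \<delta>))\<^sup>2) \<le> (norm y)\<^sup>2"
  shows "norm x \<le> norm y"
proof (rule power2_le_imp_le)
  show "(norm x)\<^sup>2 \<le> (norm y)\<^sup>2"
    by (rule LIMSEQ_le_const2[OF words_less_limit[OF norm_ell2_has_sum]]) (use assms in blast)
qed simp

text \<open>The left shifts \<open>pull ((@) \<delta>)\<close> with \<open>|\<delta>| = m\<close> see exactly the coefficients on words of length
  at least \<open>m\<close>, so their total energy is a tail of \<open>\<parallel>Y\<parallel>\<^sup>2\<close>.\<close>

lemma pull_append_tail:
  fixes Y :: "('n::finite list, 'h::chilbert_space) ell2"
  shows "(\<lambda>m. \<Sum>\<delta> | length \<delta> = m. (norm (pull ((@) \<delta>) Y))\<^sup>2) \<longlonglongrightarrow> 0"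
    and "(\<Sum>\<delta> | length \<delta> = m. (norm (pull ((@) \<delta>) Y))\<^sup>2) \<le> (norm Y)\<^sup>2"
proof -
  let ?a = "\<lambda>\<delta>. (norm (pull ((@) \<delta>) Y))\<^sup>2"
  have inj: "inj ((@) \<delta>)" for \<delta> :: "'n list" by (simp add: inj_def)
  \<comment> \<open>A word extending \<open>\<delta>\<close> is \<open>\<delta>\<close> itself or
    extends exactly one \<open>\<delta> @ [i]\<close>.\<close>
  have step: "(\<Sum>i\<in>UNIV. ?a (\<delta> @ [i])) + (norm (coeff Y \<delta>))\<^sup>2 = ?a \<delta> + 0" for \<delta>
  proof -
    have "?a \<delta> = (norm (coeff Y \<delta>))\<^sup>2 + (\<Sum>i\<in>UNIV. \<Sum>\<^sub>\<infinity>\<alpha>. (norm (coeff Y (\<delta> @ i # \<alpha>)))\<^sup>2)"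
      unfolding norm_ell2_sq
      using infsum_words_Cons[of "\<lambda>\<alpha>. (norm (coeff (pull ((@) \<delta>) Y) \<alpha>))\<^sup>2"]
        coeff_square_summable[of "pull ((@) \<delta>) Y"]
      by (simp add: coeff_pull[OF inj] square_summable_def)
    moreover have "(\<Sum>\<^sub>\<infinity>\<alpha>. (norm (coeff Y (\<delta> @ i # \<alpha>)))\<^sup>2) = ?a (\<delta> @ [i])" for i
      unfolding norm_ell2_sq by (simp add: coeff_pull inj)
    ultimately show ?thesis by simp
  qed
  have bal: "(\<Sum>\<delta> | length \<delta> = m. ?a \<delta>) + (\<Sum>\<delta> | length \<delta> < m. (norm (coeff Y \<delta>))\<^sup>2)
      = ?a []" for m
    using energy_balance[of ?a "\<lambda>\<delta>. (norm (coeff Y \<delta>))\<^sup>2" "\<lambda>_. 0" m, OF step] by simp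
  have Y: "?a [] = (norm Y)\<^sup>2" by (simp add: norm_ell2_sq coeff_pull inj)
  have eq: "(\<Sum>\<delta> | length \<delta> = m. ?a \<delta>) = (norm Y)\<^sup>2 - (\<Sum>\<delta> | length \<delta> < m. (norm (coeff Y \<delta>))\<^sup>2)" for m
    using bal[of m] Y by (simp add: algebra_simps)
  show "(\<lambda>m. \<Sum>\<delta> | length \<delta> = m. ?a \<delta>) \<longlonglongrightarrow> 0"
    unfolding eq
    using tendsto_diff[OF tendsto_const[of "(norm Y)\<^sup>2"] words_less_limit[OF norm_ell2_has_sum[of Y]]]
    by simp
  show "(\<Sum>\<delta> | length \<delta> = m. ?a \<delta>) \<le> (norm Y)\<^sup>2"
    unfolding eq by (simp add: sum_nonneg)
qed

text \<open>\<open>spread\<close> is the row operator \<open>[R\<^sub>1 \<otimes> I, \<dots>, R\<^sub>n \<otimes> I]\<close>.\<close>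

lift_definition right_shift :: "'n \<Rightarrow> ('n list, 'h::chilbert_space) ell2 \<Rightarrow> ('n list, 'h) ell2"
  is "\<lambda>i f \<alpha>. if \<alpha> \<noteq> [] \<and> last \<alpha> = i then f (butlast \<alpha>) else 0"
proof -
  fix i :: 'a and f :: "'a list \<Rightarrow> 'b::chilbert_space"
  assume f: "square_summable f"
  have "inj_on butlast {\<alpha>. \<alpha> \<noteq> [] \<and> last \<alpha> = i}"
    by (rule inj_on_inverseI[where g = "\<lambda>\<beta>. \<beta> @ [i]"]) auto
  then show "square_summable (\<lambda>\<alpha>. if \<alpha> \<noteq> [] \<and> last \<alpha> = i then f (butlast \<alpha>) else 0)"
    by (rule square_summable_reindex[OF f]) auto
qed

lemma right_shift_tensor: "right_shift i (f \<otimes>\<^sub>v k) = right_creation i f \<otimes>\<^sub>v k"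
  using scaleC_of_real[of 0 k]
  by (intro ell2_eqI) (simp add: right_shift.rep_eq right_creation.rep_eq tensor.rep_eq)

lemma slice_right_shift: "slice k (right_shift i x) = right_creation i (slice k x)"
  by (intro ell2_eqI) (simp add: right_shift.rep_eq right_creation.rep_eq slice.rep_eq)

definition spread :: "('n::finite list, 'h::chilbert_space ^ 'n) ell2 \<Rightarrow> ('n list, 'h) ell2" where
  "spread V = (\<Sum>i\<in>UNIV. right_shift i (coeffwise (\<lambda>v. v $ i) V))"

lemma vec_nth_bop: "(\<lambda>v :: 'h::chilbert_space ^ 'n::finite. v $ i) \<in> bop UNIV UNIV"
  by (rule bopI[where b = 1]) (auto simp: scaleC_vec_def Finite_Cartesian_Product.norm_nth_le)

lemma coeff_spread_Nil: "coeff (spread V) [] = 0"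
  by (simp add: spread_def coeff_sum right_shift.rep_eq)

lemma coeff_spread_snoc: "coeff (spread V) (\<delta> @ [i]) = coeff V \<delta> $ i"
  by (simp add: spread_def coeff_sum right_shift.rep_eq coeff_coeffwise vec_nth_bop)

text \<open>Right creations are isometries with mutually orthogonal ranges; in coefficients, words
  are sorted by their last letter.\<close>

lemma cinner_spread: "cinner (spread V) (spread V') = cinner V V'"
proof -
  have s: "(\<lambda>\<alpha>. cinner (coeff V \<alpha> $ i) (coeff V' \<alpha> $ i)) summable_on UNIV" for i
    using ell2_cinner_summable[of "coeffwise (\<lambda>v. v $ i) V" "coeffwise (\<lambda>v. v $ i) V'"]
    by (simp add: coeff_coeffwise vec_nth_bop)
  have "cinner (spread V) (spread V')
      = (\<Sum>i\<in>UNIV. \<Sum>\<^sub>\<infinity>\<alpha>. cinner (coeff V \<alpha> $ i) (coeff V' \<alpha> $ i))"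
    unfolding cinner_ell2_def
    by (subst infsum_words_snoc) (simp_all add: ell2_cinner_summable coeff_spread_Nil coeff_spread_snoc)
  also have "\<dots> = (\<Sum>\<^sub>\<infinity>\<alpha>. \<Sum>i\<in>UNIV. cinner (coeff V \<alpha> $ i) (coeff V' \<alpha> $ i))"
    by (rule sym, rule infsumI, rule has_sum_sum, rule has_sum_infsum, rule s)
  finally show ?thesis by (simp add: cinner_ell2_def cinner_vec_def)
qed

lemma norm_spread: "norm (spread V) = norm V"
proof -
  have "complex_of_real ((norm (spread V))\<^sup>2) = complex_of_real ((norm V)\<^sup>2)"
    using cinner_spread[of V V] by (simp only: cinner_self)
  then have "(norm (spread V))\<^sup>2 = (norm V)\<^sup>2" using of_real_eq_iff by blast
  then show ?thesis by (simp add: power2_eq_iff_nonneg)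
qed

lemma spread_bop: "spread \<in> bop UNIV UNIV"
proof (rule bopI)
  have "coeff (spread (x + y)) \<alpha> = coeff (spread x) \<alpha> + coeff (spread y) \<alpha>" for x y \<alpha>
    by (cases \<alpha> rule: rev_cases) (auto simp: coeff_spread_Nil coeff_spread_snoc coeff_simps)
  then show "spread (x + y) = spread x + spread y" for x y
    by (intro ell2_eqI) (simp add: coeff_simps)
  have "coeff (spread (c *\<^sub>C x)) \<alpha> = c *\<^sub>C coeff (spread x) \<alpha>" for c x \<alpha>
    by (cases \<alpha> rule: rev_cases)
      (auto simp: coeff_spread_Nil coeff_spread_snoc coeff_simps scaleC_vec_def scaleC_zero_right)
  then show "spread (c *\<^sub>C x) = c *\<^sub>C spread x" for c x
    by (intro ell2_eqI) (simp add: coeff_simps)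
  show "norm (spread x) \<le> 1 * norm x" for x by (simp add: norm_spread)
qed


section \<open>Radial dilations and their strong convergence\<close>

definition dilation :: "real \<Rightarrow> ('n list, 'h::chilbert_space) ell2 \<Rightarrow> ('n list, 'h) ell2" where
  "dilation r x = Abs_ell2 (\<lambda>\<alpha>. r ^ length \<alpha> *\<^sub>R coeff x \<alpha>)"

lemma coeff_dilation:
  assumes "0 \<le> r" "r \<le> 1"
  shows "coeff (dilation r x) \<alpha> = r ^ length \<alpha> *\<^sub>R coeff x \<alpha>"
proof -
  have "norm (r ^ length \<alpha> *\<^sub>R coeff x \<alpha>) \<le> 1 * norm (coeff x \<alpha>)" for \<alpha>
    using assms by (simp add: mult_left_le_one_le power_le_one)
  then have "square_summable (\<lambda>\<alpha>. r ^ length \<alpha> *\<^sub>R coeff x \<alpha>)"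
    by (rule square_summable_le[OF coeff_square_summable[of x]])
  then show ?thesis by (simp add: dilation_def Abs_ell2_inverse)
qed

lemma eventually_at_left_1: "\<forall>\<^sub>F r :: real in at_left 1. 0 < r \<and> r < 1"
  using eventually_at_left_real[of 0 1] by simp

text \<open>Since (1 - t)^2 \<le> 1 - t^2 on [0, 1], the squared error is at most the loss of
  squared norm. Finitely many coefficients carry almost all of the norm, and on these the dilation
  is continuous at \<open>r = 1\<close>.\<close>

lemma dilation_tendsto:
  fixes x :: "('n::finite list, 'h::chilbert_space) ell2"
  shows "((\<lambda>r. dilation r x) \<longlongrightarrow> x) (at_left 1)"
proof (rule tendstoI)
  fix e :: real assume e: "e > 0"
  have "(\<lambda>m. \<Sum>\<delta> | length \<delta> < m. (norm (coeff x \<delta>))\<^sup>2) \<longlonglongrightarrow> (norm x)\<^sup>2"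
    by (rule words_less_limit[OF norm_ell2_has_sum])
  moreover have "(norm x)\<^sup>2 - e\<^sup>2 < (norm x)\<^sup>2" using e by simp
  ultimately obtain m where m: "(norm x)\<^sup>2 - e\<^sup>2 < (\<Sum>\<delta> | length \<delta> < m. (norm (coeff x \<delta>))\<^sup>2)"
    using order_tendstoD(1) eventually_happens'[OF sequentially_bot] by blast
  have "((\<lambda>r :: real. \<Sum>\<delta> | length \<delta> < m. (norm (r ^ length \<delta> *\<^sub>R coeff x \<delta>))\<^sup>2)
      \<longlongrightarrow> (\<Sum>\<delta> | length \<delta> < m. (norm (1 ^ length \<delta> *\<^sub>R coeff x \<delta>))\<^sup>2)) (at_left 1)"
    by (intro tendsto_intros)
  then have "\<forall>\<^sub>F r in at_left (1::real). (norm x)\<^sup>2 - e\<^sup>2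
      < (\<Sum>\<delta> | length \<delta> < m. (norm (r ^ length \<delta> *\<^sub>R coeff x \<delta>))\<^sup>2)"
    using m by (intro order_tendstoD(1)) auto
  then show "\<forall>\<^sub>F r in at_left 1. dist (dilation r x) x < e"
    using eventually_at_left_1
  proof eventually_elim
    case (elim r)
    then have r: "0 \<le> r" "r \<le> 1" by auto
    have "(norm (x - dilation r x))\<^sup>2 \<le> (norm x)\<^sup>2 + - (norm (dilation r x))\<^sup>2"
    proof (rule has_sum_mono[OF norm_ell2_has_sum
            has_sum_add[OF norm_ell2_has_sum has_sum_uminusI[OF norm_ell2_has_sum]]])
      fix \<alpha> :: "'n list"
      define t where "t = r ^ length \<alpha>"
      have t: "0 \<le> t" "t \<le> 1" using r by (auto simp: t_def power_le_one)
      have "coeff (x - dilation r x) \<alpha> = (1 - t) *\<^sub>R coeff x \<alpha>"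
        by (simp add: coeff_simps coeff_dilation r t_def scaleR_diff_left)
      moreover have "(1 - t)\<^sup>2 \<le> 1 - t\<^sup>2"
        using t mult_right_mono[OF t(2,1)] by (simp add: power2_eq_square algebra_simps)
      ultimately have "(norm (coeff (x - dilation r x) \<alpha>))\<^sup>2 \<le> (1 - t\<^sup>2) * (norm (coeff x \<alpha>))\<^sup>2"
        by (simp add: power_mult_distrib mult_right_mono)
      then show "(norm (coeff (x - dilation r x) \<alpha>))\<^sup>2
          \<le> (norm (coeff x \<alpha>))\<^sup>2 + - (norm (coeff (dilation r x) \<alpha>))\<^sup>2"
        by (simp add: coeff_dilation r t_def[symmetric] power_mult_distrib algebra_simps)
    qed
    also have "(\<Sum>\<delta> | length \<delta> < m. (norm (r ^ length \<delta> *\<^sub>R coeff x \<delta>))\<^sup>2) \<le> (norm (dilation r x))\<^sup>2"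
      using sum_le_norm_ell2_sq[OF finite_words_less[of m], of "dilation r x"] by (simp add: coeff_dilation r)
    then have "(norm x)\<^sup>2 + - (norm (dilation r x))\<^sup>2 < e\<^sup>2" using elim by simp
    finally show ?case using e by (simp add: dist_norm norm_minus_commute power2_less_imp_less)
  qed
qed


subsection \<open>Tensor products of subspaces\<close>

text \<open>For a closed subspace \<open>M\<close>, this is \<open>M \<otimes> H\<close>, characterised by slices.\<close>

definition slices_in :: "('i, complex) ell2 set \<Rightarrow> ('i, 'h::chilbert_space) ell2 set" where
  "slices_in M = {x. \<forall>k. slice k x \<in> M}"

lemma slices_in_eq: "slices_in M = (\<Inter>k. slice k -` M)"
  by (auto simp: slices_in_def)

lemma closed_slices_in: "closed M \<Longrightarrow> closed (slices_in M)"
  unfolding slices_in_eq by (intro closed_INT ballI bop_closed_vimage slice_bop)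

lemma csubspace_slices_in: "csubspace M \<Longrightarrow> csubspace (slices_in M)"
  by (simp add: csubspace_def slices_in_def bop_add[OF slice_bop] bop_scaleC[OF slice_bop]
      bop_zero[OF slice_bop])

lemma slices_in_coeffwise:
  "B \<in> bop UNIV UNIV \<Longrightarrow> x \<in> slices_in M \<Longrightarrow> coeffwise B x \<in> slices_in M"
  by (simp add: slices_in_def slice_coeffwise)

lemma slices_in_spread:
  assumes "csubspace M" "\<And>i f. f \<in> M \<Longrightarrow> right_creation i f \<in> M" "V \<in> slices_in M"
  shows "spread V \<in> slices_in M"
  unfolding spread_def
proof (rule csubspace_sum[OF csubspace_slices_in[OF assms(1)]])
  fix i
  show "right_shift i (coeffwise (\<lambda>v. v $ i) V) \<in> slices_in M"
    using slices_in_coeffwise[OF vec_nth_bop assms(3), of i] assms(2)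
    by (simp add: slices_in_def slice_right_shift)
qed

text \<open>For the harder inclusion let \<open>w\<close> be the part of \<open>x\<close> orthogonal
  to the tensor space. Its slices along \<open>L\<close> lie in \<open>M\<close> and are orthogonal
  to \<open>M\<close>, hence vanish; then each coefficient lies in \<open>L\<close> and is
  orthogonal to \<open>L\<close>, so \<open>w = 0\<close>.\<close>

lemma tensor_space_eq:
  assumes M: "csubspace M" "closed M" and L: "csubspace L" "closed L"
  shows "M \<otimes>\<^sub>s L = {x \<in> slices_in M. \<forall>i. coeff x i \<in> L}"
proof
  let ?R = "{x \<in> slices_in M. \<forall>i. coeff x i \<in> L}"
  have R: "?R = slices_in M \<inter> (\<Inter>i. (\<lambda>x. coeff x i) -` L)" by auto
  have R1: "closed ?R"
    unfolding R by (intro closed_Int closed_INT ballI bop_closed_vimage coeff_bop closed_slices_in M L)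
  have R2: "csubspace ?R"
    using csubspace_slices_in[OF M(1)] L(1) by (auto simp: csubspace_def coeff_simps)
  show sub: "M \<otimes>\<^sub>s L \<subseteq> ?R"
    unfolding tensor_space_def
    by (intro closed_cspan_minimal R1 R2)
      (auto simp: slices_in_def slice_tensor tensor.rep_eq intro!: csubspace_scaleC M L)
  have T: "csubspace (M \<otimes>\<^sub>s L)" "closed (M \<otimes>\<^sub>s L)"
    by (simp_all add: tensor_space_def csubspace_closed_cspan closed_closed_cspan)
  show "?R \<subseteq> M \<otimes>\<^sub>s L"
  proof
    fix x assume x: "x \<in> ?R"
    define w where "w = x - proj (M \<otimes>\<^sub>s L) x"
    have "proj (M \<otimes>\<^sub>s L) x \<in> ?R" using proj_mem[OF T] sub by blast
    then have w: "w \<in> ?R" unfolding w_def using csubspace_diff[OF R2] x by blast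
    have w': "w \<in> orth_compl (M \<otimes>\<^sub>s L)" unfolding w_def by (rule proj_orth[OF T])
    have "slice l w = 0" if "l \<in> L" for l
    proof -
      have "slice l w \<in> orth_compl M"
      proof -
        have "cinner (slice l w) f = 0" if "f \<in> M" for f
        proof -
          have "f \<otimes>\<^sub>v l \<in> M \<otimes>\<^sub>s L"
            unfolding tensor_space_def
            by (rule subsetD[OF closed_cspan_superset]) (use \<open>l \<in> L\<close> that in blast)
          then show ?thesis using w' unfolding orth_compl_def cinner_tensor[symmetric] by blast
        qed
        then show ?thesis by (simp add: orth_compl_def)
      qed
      then show ?thesis using w orth_compl_self_0 by (auto simp: slices_in_def)
    qed
    then have "cinner (coeff w i) l = 0" if "l \<in> L" for l i
      using that by (metis slice.rep_eq zero_ell2.rep_eq)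
    then have "coeff w i = 0" for i using w by (metis (mono_tags) cinner_self_eq_0 mem_Collect_eq)
    then have "w = 0" by (intro ell2_eqI) (simp add: coeff_simps)
    then show "x \<in> M \<otimes>\<^sub>s L" using proj_mem[OF T, of x] by (simp add: w_def)
  qed
qed

lemma tensor_space_UNIV: "csubspace M \<Longrightarrow> closed M \<Longrightarrow> M \<otimes>\<^sub>s UNIV = slices_in M"
  by (simp add: tensor_space_eq)

lemma orth_compl_slices_in:
  assumes M: "csubspace M" "closed M"
  shows "orth_compl (slices_in M) = slices_in (orth_compl M)"
proof -
  have "orth_compl (slices_in M) = orth_compl {f \<otimes>\<^sub>v k |f k. f \<in> M \<and> k \<in> UNIV}"
    by (simp add: tensor_space_UNIV[OF M, symmetric] tensor_space_def orth_compl_closed_cspan)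
  also have "\<dots> = slices_in (orth_compl M)"
    by (auto simp: orth_compl_def slices_in_def simp flip: cinner_tensor)
  finally show ?thesis .
qed

text \<open>Identifies the projection onto \<open>slices_in M\<close> with \<open>proj M\<close>
  tensored with the identity, so that compressions can be computed by a single projection.\<close>

lemma proj_slices_in_tensor:
  assumes M: "csubspace M" "closed M"
  shows "proj (slices_in M) (f \<otimes>\<^sub>v k) = proj M f \<otimes>\<^sub>v k"
proof (rule proj_eqI)
  show "csubspace (slices_in M)" by (rule csubspace_slices_in[OF M(1)])
  show "proj M f \<otimes>\<^sub>v k \<in> slices_in M"
    by (auto simp: slices_in_def slice_tensor intro!: csubspace_scaleC M proj_mem)
  show "f \<otimes>\<^sub>v k - proj M f \<otimes>\<^sub>v k \<in> orth_compl (slices_in M)"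
    unfolding orth_compl_slices_in[OF M] tensor_diff_left[symmetric]
    by (auto simp: slices_in_def slice_tensor
        intro!: csubspace_scaleC[OF csubspace_orth_compl] proj_orth[OF M])
qed

text \<open>The maps are additive and bounded only on the closed span, so continuity there is
  derived from the bound on differences that stay inside it.\<close>

lemma bop_eq_on_closed_cspan:
  assumes f: "f \<in> bop (closed_cspan X) UNIV" and g: "g \<in> bop (closed_cspan X) UNIV"
    and eq: "\<And>x. x \<in> X \<Longrightarrow> f x = g x" and x: "x \<in> closed_cspan X"
  shows "f x = g x"
proof -
  let ?M = "closed_cspan X"
  note M = csubspace_closed_cspan[of X]
  have hull_sub: "csubspace hull X \<subseteq> ?M" by (simp add: closed_cspan_def closure_subset)
  have "csubspace hull X \<subseteq> {x \<in> ?M. f x = g x}"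
  proof (rule hull_minimal)
    show "X \<subseteq> {x \<in> ?M. f x = g x}" using closed_cspan_superset eq by auto
    have fg: "h 0 = 0" if "h \<in> bop ?M UNIV" for h :: "'a \<Rightarrow> 'b"
    proof -
      have "h (0 *\<^sub>C 0) = 0 *\<^sub>C h 0" using that csubspace_0[OF M] unfolding bop_def by blast
      then show ?thesis using scaleC_of_real[of 0 "h 0"] by (simp add: scaleC_zero_right)
    qed
    show "csubspace {x \<in> ?M. f x = g x}"
      unfolding csubspace_def using f g csubspace_0[OF M] csubspace_add[OF M] csubspace_scaleC[OF M]
      by (auto simp: fg) (auto simp: bop_def)
  qed
  then have hull: "f y = g y" if "y \<in> csubspace hull X" for y using that by blast
  obtain s where s: "\<And>n. s n \<in> csubspace hull X" "s \<longlonglongrightarrow> x"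
    using x unfolding closed_cspan_def closure_sequential by blast
  have lim: "(\<lambda>n. h (s n)) \<longlonglongrightarrow> h x" if h: "h \<in> bop ?M UNIV" for h :: "'a \<Rightarrow> 'b"
  proof -
    obtain b where b: "\<And>y. y \<in> ?M \<Longrightarrow> norm (h y) \<le> b * norm y" using h unfolding bop_def by blast
    have "h (s n - x) + h x = h (s n)" for n
    proof -
      have "s n - x \<in> ?M" using csubspace_diff[OF M] s(1) hull_sub x by blast
      then have "h ((s n - x) + x) = h (s n - x) + h x" using h x unfolding bop_def by blast
      then show ?thesis by simp
    qed
    then have "norm (h (s n) - h x) \<le> b * norm (s n - x)" for n
      using b[of "s n - x"] csubspace_diff[OF M, of "s n" x] s(1)[of n] hull_sub x
      by (metis add_diff_cancel_right' subsetD)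
    moreover have "(\<lambda>n. b * norm (s n - x)) \<longlonglongrightarrow> 0"
      using s(2) by (intro tendsto_mult_right_zero) (simp add: LIM_zero tendsto_norm_zero)
    ultimately have "(\<lambda>n. h (s n) - h x) \<longlonglongrightarrow> 0"
      by (rule Lim_null_comparison[OF always_eventually[OF allI]])
    then show ?thesis by (rule LIM_zero_cancel)
  qed
  show ?thesis using LIMSEQ_unique[OF lim[OF f]] lim[OF g] s(1) hull by auto
qed

text \<open>Exhibiting one operator \<open>C\<close> shows that the choice in
  \<open>tensor_op\<close> is not void, and uniqueness on the closed span identifies the chosen
  operator with \<open>C\<close>.\<close>

lemma tensor_op_eq:
  assumes "C \<in> bop (M \<otimes>\<^sub>s L) UNIV" "\<And>f k. f \<in> M \<Longrightarrow> k \<in> L \<Longrightarrow> C (f \<otimes>\<^sub>v k) = A f \<otimes>\<^sub>v B k"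
    "x \<in> M \<otimes>\<^sub>s L"
  shows "tensor_op M L A B x = C x"
proof -
  have "tensor_op M L A B \<in> bop (M \<otimes>\<^sub>s L) UNIV \<and>
      (\<forall>f\<in>M. \<forall>k\<in>L. tensor_op M L A B (f \<otimes>\<^sub>v k) = A f \<otimes>\<^sub>v B k)"
    unfolding tensor_op_def by (rule someI[of _ C]) (use assms in auto)
  then have t: "tensor_op M L A B \<in> bop (M \<otimes>\<^sub>s L) UNIV"
    "\<And>f k. f \<in> M \<Longrightarrow> k \<in> L \<Longrightarrow> tensor_op M L A B (f \<otimes>\<^sub>v k) = A f \<otimes>\<^sub>v B k" by blast+
  show ?thesis
    by (rule bop_eq_on_closed_cspan[OF t(1)[unfolded tensor_space_def] assms(1)[unfolded tensor_space_def]
          _ assms(3)[unfolded tensor_space_def]])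
      (use t(2) assms(2) in force)
qed

lemma tensor_op_id:
  "B \<in> bop UNIV UNIV \<Longrightarrow> x \<in> M \<otimes>\<^sub>s L \<Longrightarrow> tensor_op M L id B x = coeffwise B x"
  by (rule tensor_op_eq) (auto intro: bop_subset coeffwise_bop simp: coeffwise_tensor)


section \<open>Poisson kernel and characteristic function on the full Fock space\<close>

lemma row_op_bop:
  assumes "\<And>i. T i \<in> bop UNIV UNIV"
  shows "row_op T \<in> bop UNIV UNIV"
proof (rule bounded_linear_bop)
  have "bounded_linear (\<lambda>v. \<Sum>i\<in>UNIV. T i (v $ i))"
    by (intro bounded_linear_sum bounded_linear_compose[OF bop_bounded_linear[OF assms]]
        bop_bounded_linear[OF vec_nth_bop])
  then show "bounded_linear (row_op T)" by (simp add: row_op_def[abs_def])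
  have "(\<Sum>i\<in>I. c *\<^sub>C f i) = c *\<^sub>C (\<Sum>i\<in>I. f i)" for c I and f :: "'a \<Rightarrow> 'b"
    by (induction I rule: infinite_finite_induct) (auto simp: scaleC_zero_right scaleC_add_right)
  then show "row_op T (c *\<^sub>C v) = c *\<^sub>C row_op T v" for c v
    by (simp add: row_op_def scaleC_vec_def bop_scaleC[OF assms])
qed

lemma adj_row_op:
  assumes "\<And>i. T i \<in> bop UNIV UNIV"
  shows "adj (row_op T) x = (\<chi> i. adj (T i) x)"
  by (rule adj_eqI) (simp add: row_op_def cinner_vec_def cinner_sum_left cinner_adj[OF assms])

lemma norm_vec_sq: "(norm v)\<^sup>2 = (\<Sum>i\<in>UNIV. (norm (v $ i))\<^sup>2)"
  by (simp add: norm_vec_def L2_set_def sum_nonneg)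

locale row_contr =
  fixes T :: "'n::finite \<Rightarrow> 'h \<Rightarrow> 'h::chilbert_space"
  assumes row_contraction: "row_contraction T"
begin

abbreviation "A \<equiv> row_op T"

lemma T: "T i \<in> bop UNIV UNIV"
  using row_contraction by (simp add: row_contraction_def)

sublocale row_operator "row_op T"
proof
  show A: "A \<in> bop UNIV UNIV" by (rule row_op_bop[OF T])
  have le: "norm (adj A x) \<le> 1 * norm x" for x
  proof -
    have "0 \<le> Re (cinner (x - A (adj A x)) x)"
      using row_contraction
      by (auto simp: row_contraction_def positive_op_def complex_nonneg_Reals_iff)
    also have "cinner (x - A (adj A x)) x = cinner x x - cinner (adj A x) (adj A x)"
      by (simp add: cinner_diff_left cinner_adj[OF A])
    finally have "(norm (adj A x))\<^sup>2 \<le> (norm x)\<^sup>2" by (simp add: cinner_self)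
    then show ?thesis using power2_le_imp_le[of "norm (adj A x)" "norm x"] by simp
  qed
  \<comment> \<open>Positivity of the defect bounds \<open>adj A\<close>; taking the adjoint again
    carries the bound over to \<open>A\<close>.\<close>
  have "adj (adj A) = A" by (rule ext, rule adj_eqI) (simp add: cinner_adj'[OF A])
  then show "norm (A v) \<le> norm v" for v
    using norm_adj_le[OF adj_bop[OF A] le, of v] by simp
qed

lemma defect_eq: "defect T = D"
  by (simp add: defect_def D_def)

lemma defect_star_eq: "defect_star T = E"
  by (simp add: defect_star_def E_def)

lemma adj_A_nth: "adj A x $ i = adj (T i) x"
  by (simp add: adj_row_op[OF T])

subsection \<open>The Poisson kernel\<close>

definition "Tw \<alpha> = adj (word_op T \<alpha>)"

lemma word_op_bop: "word_op T \<alpha> \<in> bop UNIV UNIV"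
proof (induction \<alpha>)
  case (Cons i \<alpha>)
  have "word_op T (i # \<alpha>) = T i \<circ> word_op T \<alpha>" by (simp add: word_op_def)
  then show ?case using bop_comp[OF T[of i] Cons] by metis
qed (use bop_id in \<open>simp add: word_op_def id_def\<close>)

text \<open>Adjoints reverse the order of composition, so the adjoint of the first letter acts
  first.\<close>

lemma Tw_eq: "Tw \<alpha> = fold (\<lambda>i. adj (T i)) \<alpha>"
proof (induction \<alpha>)
  case Nil
  show ?case unfolding Tw_def word_op_def by (rule ext, rule adj_eqI) simp
next
  case (Cons i \<alpha>)
  have "word_op T (i # \<alpha>) = T i \<circ> word_op T \<alpha>" by (simp add: word_op_def)
  then show ?case using Cons by (simp add: Tw_def adj_comp[OF T word_op_bop])
qed

lemma Tw_bop: "Tw \<alpha> \<in> bop UNIV UNIV"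
  unfolding Tw_def by (rule adj_bop[OF word_op_bop])

text \<open>The Julia isometry with zero input; the summand 0 is the absent input in the form that
  \<open>energy_balance\<close> expects.\<close>

lemma Tw_energy:
  "(\<Sum>i\<in>UNIV. (norm (Tw (\<delta> @ [i]) h))\<^sup>2) + (norm (D (Tw \<delta> h)))\<^sup>2 = (norm (Tw \<delta> h))\<^sup>2 + 0"
proof -
  have "(norm (adj A x))\<^sup>2 + (norm (D x))\<^sup>2 = (norm x)\<^sup>2" for x
    using arg_cong[OF julia_isometry[of x 0 x 0], of Re]
    by (simp add: bop_zero A E cinner_self)
  then show ?thesis by (simp add: norm_vec_sq adj_A_nth Tw_eq)
qed

lemma D_Tw_le: "(\<Sum>\<delta> | length \<delta> < m. (norm (D (Tw \<delta> h)))\<^sup>2) \<le> (norm h)\<^sup>2"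
proof -
  have "(\<Sum>\<delta> | length \<delta> = m. (norm (Tw \<delta> h))\<^sup>2) + (\<Sum>\<delta> | length \<delta> < m. (norm (D (Tw \<delta> h)))\<^sup>2)
      = (norm (Tw [] h))\<^sup>2"
    using energy_balance[of "\<lambda>\<delta>. (norm (Tw \<delta> h))\<^sup>2" "\<lambda>\<delta>. (norm (D (Tw \<delta> h)))\<^sup>2" "\<lambda>_. 0" m,
        OF Tw_energy] by simp
  moreover have "0 \<le> (\<Sum>\<delta> | length \<delta> = m. (norm (Tw \<delta> h))\<^sup>2)" by (simp add: sum_nonneg)
  ultimately show ?thesis by (simp add: Tw_eq)
qed

definition K :: "'h \<Rightarrow> ('n list, 'h) ell2" where
  "K h = Abs_ell2 (\<lambda>\<alpha>. D (Tw \<alpha> h))"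

lemma coeff_K: "coeff (K h) \<alpha> = D (Tw \<alpha> h)"
  using words_square_summableI[OF D_Tw_le, of h] by (simp add: K_def Abs_ell2_inverse)

lemma K_le: "norm (K h) \<le> norm h"
  by (rule norm_ell2_le_wordsI) (simp add: coeff_K D_Tw_le)

lemma K: "K \<in> bop UNIV UNIV"
  by (rule bopI[where b = 1])
    (auto intro!: ell2_eqI simp: K_le coeff_K coeff_simps bop_add[OF D] bop_add[OF Tw_bop]
      bop_scaleC[OF D] bop_scaleC[OF Tw_bop])

lemma poisson_kernel_eq: "poisson_kernel T h = K h"
  using infsumI[OF ell2_basis_has_sum[of "K h"]]
  by (simp add: poisson_kernel_def coeff_K Tw_def defect_eq)

lemma adj_K_le: "norm (adj K Y) \<le> norm Y"
  using norm_adj_le[OF K, of 1 Y] K_le by simp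

text \<open>\<open>K h\<close> has \<open>D h\<close> at the empty word and the coefficients of
  \<open>K (adj (T i) h)\<close> on the words behind a first letter \<open>i\<close>. Taking
  adjoints gives one step of the backward system.\<close>

lemma adj_K_rec: "adj K Y = A (\<chi> i. adj K (pull (Cons i) Y)) + D (coeff Y [])"
proof (rule adj_eqI)
  fix h
  have inj: "inj (Cons i)" for i :: 'n by (simp add: inj_def)
  have shift: "(\<Sum>\<^sub>\<infinity>\<alpha>. cinner (D (Tw \<alpha> (adj (T i) h))) (coeff Y (i # \<alpha>)))
      = cinner (K (adj (T i) h)) (pull (Cons i) Y)" for i
    unfolding cinner_ell2_def by (simp add: coeff_K coeff_pull[OF inj])
  have "cinner (K h) Y = cinner (D h) (coeff Y [])
      + (\<Sum>i\<in>UNIV. \<Sum>\<^sub>\<infinity>\<alpha>. cinner (D (Tw \<alpha> (adj (T i) h))) (coeff Y (i # \<alpha>)))"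
    unfolding cinner_ell2_def
    using infsum_words_Cons[OF ell2_cinner_summable[of "K h" Y]] by (simp add: coeff_K Tw_eq)
  also have "(\<Sum>i\<in>UNIV. \<Sum>\<^sub>\<infinity>\<alpha>. cinner (D (Tw \<alpha> (adj (T i) h))) (coeff Y (i # \<alpha>)))
      = cinner (adj A h) (\<chi> i. adj K (pull (Cons i) Y))"
    by (simp add: shift cinner_vec_def adj_A_nth cinner_adj[OF K])
  finally show "cinner (K h) Y = cinner h (A (\<chi> i. adj K (pull (Cons i) Y)) + D (coeff Y []))"
    by (simp add: cinner_add_right cinner_adj'[OF A] D_selfadjoint)
qed


subsection \<open>The adjoint of the characteristic function\<close>

text \<open>The backward system: \<open>costate\<close> is the state driven by the input \<open>Y\<close>, \<open>Psi Y\<close> the output.\<close>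

definition "costate Y \<delta> = adj K (pull ((@) \<delta>) Y)"

lemma inj_append: "inj ((@) \<delta>)"
  by (simp add: inj_def)

lemma costate_rec: "costate Y \<delta> = A (\<chi> i. costate Y (\<delta> @ [i])) + D (coeff Y \<delta>)"
proof -
  have "pull (Cons i) (pull ((@) \<delta>) Y) = pull ((@) (\<delta> @ [i])) Y" for i
    by (intro ell2_eqI) (simp add: coeff_pull inj_append inj_def)
  then show ?thesis
    unfolding costate_def by (subst adj_K_rec) (simp add: coeff_pull inj_append)
qed

lemma costate_Nil: "costate Y [] = adj K Y"
proof -
  have "pull ((@) []) Y = Y" by (intro ell2_eqI) (simp add: coeff_pull inj_append)
  then show ?thesis by (simp add: costate_def)
qed

lemma costate_le: "norm (costate Y \<delta>) \<le> norm (pull ((@) \<delta>) Y)"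
  by (simp add: costate_def adj_K_le)

definition "psi Y \<delta> = E (\<chi> i. costate Y (\<delta> @ [i])) - adj A (coeff Y \<delta>)"

text \<open>The Julia coisometry summed over words. Keeping two inputs \<open>Y\<close> and
  \<open>Y'\<close> makes the limit an operator identity directly, without polarisation.\<close>

lemma psi_balance:
  "(\<Sum>\<delta> | length \<delta> = m. cinner (costate Y \<delta>) (costate Y' \<delta>))
    + (\<Sum>\<delta> | length \<delta> < m. cinner (coeff Y \<delta>) (coeff Y' \<delta>))
   = cinner (adj K Y) (adj K Y') + (\<Sum>\<delta> | length \<delta> < m. cinner (psi Y \<delta>) (psi Y' \<delta>))"
  unfolding costate_Nil[symmetric]
proof (rule energy_balance)
  show "(\<Sum>i\<in>UNIV. cinner (costate Y (\<delta> @ [i])) (costate Y' (\<delta> @ [i]))) + cinner (coeff Y \<delta>) (coeff Y' \<delta>)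
      = cinner (costate Y \<delta>) (costate Y' \<delta>) + cinner (psi Y \<delta>) (psi Y' \<delta>)" for \<delta>
    unfolding costate_rec[of Y \<delta>] costate_rec[of Y' \<delta>] psi_def julia_coisometry
    by (simp add: cinner_vec_def)
qed

text \<open>The factor 2 counts the costates on level \<open>m\<close> and the coefficients below it
  separately; this suffices for square-summability.\<close>

lemma psi_sum_le: "(\<Sum>\<delta> | length \<delta> < m. (norm (psi Y \<delta>))\<^sup>2) \<le> 2 * (norm Y)\<^sup>2"
proof -
  have "(\<Sum>\<delta> | length \<delta> = m. (norm (costate Y \<delta>))\<^sup>2) \<le> (\<Sum>\<delta> | length \<delta> = m. (norm (pull ((@) \<delta>) Y))\<^sup>2)"
    by (intro sum_mono power_mono costate_le norm_ge_zero)
  also have "\<dots> \<le> (norm Y)\<^sup>2" by (rule pull_append_tail)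
  finally have "(\<Sum>\<delta> | length \<delta> = m. (norm (costate Y \<delta>))\<^sup>2) \<le> (norm Y)\<^sup>2" .
  moreover have "(\<Sum>\<delta> | length \<delta> < m. (norm (coeff Y \<delta>))\<^sup>2) \<le> (norm Y)\<^sup>2"
    by (rule sum_le_norm_ell2_sq[OF finite_words_less])
  moreover have "(\<Sum>\<delta> | length \<delta> = m. (norm (costate Y \<delta>))\<^sup>2) + (\<Sum>\<delta> | length \<delta> < m. (norm (coeff Y \<delta>))\<^sup>2)
      = (norm (adj K Y))\<^sup>2 + (\<Sum>\<delta> | length \<delta> < m. (norm (psi Y \<delta>))\<^sup>2)"
    using arg_cong[OF psi_balance[where m = m and Y = Y and Y' = Y], of Re] by (simp add: cinner_self)
  ultimately show ?thesis using zero_le_power2[of "norm (adj K Y)"] by linarith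
qed

definition Psi :: "('n list, 'h) ell2 \<Rightarrow> ('n list, 'h ^ 'n) ell2" where
  "Psi Y = Abs_ell2 (psi Y)"

lemma coeff_Psi: "coeff (Psi Y) = psi Y"
  using words_square_summableI[OF psi_sum_le, of Y] by (simp add: Psi_def Abs_ell2_inverse)

text \<open>In the limit of \<open>psi_balance\<close> the term on level \<open>m\<close>
  disappears, because costates are dominated by tails of \<open>Y\<close> and
  \<open>Y'\<close>.\<close>

lemma Psi_isometry: "cinner Y Y' = cinner (adj K Y) (adj K Y') + cinner (Psi Y) (Psi Y')"
proof -
  let ?s = "\<lambda>m. \<Sum>\<delta> | length \<delta> = m. cinner (costate Y \<delta>) (costate Y' \<delta>)"
  have "?s \<longlonglongrightarrow> 0"
  proof (rule Lim_null_comparison[OF always_eventually[OF allI]])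
    fix m
    have "norm (?s m) \<le> (\<Sum>\<delta> | length \<delta> = m. (norm (pull ((@) \<delta>) Y))\<^sup>2 + (norm (pull ((@) \<delta>) Y'))\<^sup>2)"
    proof (rule order_trans[OF norm_sum sum_mono])
      fix \<delta> :: "'n list"
      have "norm (cinner (costate Y \<delta>) (costate Y' \<delta>)) \<le> norm (costate Y \<delta>) * norm (costate Y' \<delta>)"
        by (rule norm_cinner_le)
      also have "\<dots> \<le> norm (pull ((@) \<delta>) Y) * norm (pull ((@) \<delta>) Y')"
        by (intro mult_mono costate_le) auto
      also have "\<dots> \<le> (norm (pull ((@) \<delta>) Y))\<^sup>2 + (norm (pull ((@) \<delta>) Y'))\<^sup>2"
        using sum_squares_bound[of "norm (pull ((@) \<delta>) Y)" "norm (pull ((@) \<delta>) Y')"]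
          mult_nonneg_nonneg[OF norm_ge_zero norm_ge_zero, of "pull ((@) \<delta>) Y" "pull ((@) \<delta>) Y'"]
        by linarith
      finally show "norm (cinner (costate Y \<delta>) (costate Y' \<delta>))
          \<le> (norm (pull ((@) \<delta>) Y))\<^sup>2 + (norm (pull ((@) \<delta>) Y'))\<^sup>2" .
    qed
    then show "norm (?s m) \<le> (\<Sum>\<delta> | length \<delta> = m. (norm (pull ((@) \<delta>) Y))\<^sup>2)
        + (\<Sum>\<delta> | length \<delta> = m. (norm (pull ((@) \<delta>) Y'))\<^sup>2)"
      by (simp add: sum.distrib)
  next
    show "(\<lambda>m. (\<Sum>\<delta> | length \<delta> = m. (norm (pull ((@) \<delta>) Y))\<^sup>2)
        + (\<Sum>\<delta> | length \<delta> = m. (norm (pull ((@) \<delta>) Y'))\<^sup>2)) \<longlonglongrightarrow> 0"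
      using tendsto_add[OF pull_append_tail(1)[of Y] pull_append_tail(1)[of Y']] by simp
  qed
  then have "(\<lambda>m. ?s m + (\<Sum>\<delta> | length \<delta> < m. cinner (coeff Y \<delta>) (coeff Y' \<delta>))) \<longlonglongrightarrow> 0 + cinner Y Y'"
    by (intro tendsto_add words_less_limit cinner_ell2_has_sum)
  moreover have "(\<lambda>m. ?s m + (\<Sum>\<delta> | length \<delta> < m. cinner (coeff Y \<delta>) (coeff Y' \<delta>)))
      \<longlonglongrightarrow> cinner (adj K Y) (adj K Y') + cinner (Psi Y) (Psi Y')"
    unfolding psi_balance coeff_Psi[symmetric]
    by (intro tendsto_add tendsto_const words_less_limit cinner_ell2_has_sum)
  ultimately show ?thesis using LIMSEQ_unique by fastforce
qed


subsection \<open>The characteristic function\<close>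

text \<open>The forward system, with input \<open>X\<close> and output \<open>Theta X\<close>; words are read in reverse so that
  the recursion is primitive.\<close>

primrec rev_state :: "('n list, 'h ^ 'n) ell2 \<Rightarrow> 'n list \<Rightarrow> 'h" where
  "rev_state X [] = 0"
| "rev_state X (i # \<rho>) = (adj A (rev_state X \<rho>) + E (coeff X (rev \<rho>))) $ i"

definition "state X \<delta> = rev_state X (rev \<delta>)"

lemma state_Nil: "state X [] = 0"
  by (simp add: state_def)

lemma state_snoc: "state X (\<delta> @ [i]) = (adj A (state X \<delta>) + E (coeff X \<delta>)) $ i"
  by (simp add: state_def)

definition "theta X \<delta> = D (state X \<delta>) - A (coeff X \<delta>)"

text \<open>The forward system is lossless and starts from the zero state, so the root contributes
  nothing.\<close>

lemma theta_balance:
  "(\<Sum>\<delta> | length \<delta> = m. (norm (state X \<delta>))\<^sup>2) + (\<Sum>\<delta> | length \<delta> < m. (norm (theta X \<delta>))\<^sup>2)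
   = (\<Sum>\<delta> | length \<delta> < m. (norm (coeff X \<delta>))\<^sup>2)"
proof -
  have "(\<Sum>i\<in>UNIV. (norm (state X (\<delta> @ [i])))\<^sup>2) + (norm (theta X \<delta>))\<^sup>2
      = (norm (state X \<delta>))\<^sup>2 + (norm (coeff X \<delta>))\<^sup>2" for \<delta>
    using arg_cong[OF julia_isometry[of "state X \<delta>" "coeff X \<delta>" "state X \<delta>" "coeff X \<delta>"], of Re]
    by (simp only: state_snoc theta_def norm_vec_sq[symmetric] cinner_self plus_complex.sel
        Re_complex_of_real)
  from energy_balance[of "\<lambda>\<delta>. (norm (state X \<delta>))\<^sup>2" "\<lambda>\<delta>. (norm (theta X \<delta>))\<^sup>2"
      "\<lambda>\<delta>. (norm (coeff X \<delta>))\<^sup>2", OF this]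
  show ?thesis by (simp add: state_Nil)
qed

lemma state_sum_le: "(\<Sum>\<delta> | length \<delta> = m. (norm (state X \<delta>))\<^sup>2) \<le> (norm X)\<^sup>2"
  and theta_sum_le: "(\<Sum>\<delta> | length \<delta> < m. (norm (theta X \<delta>))\<^sup>2) \<le> (norm X)\<^sup>2"
proof -
  have "(\<Sum>\<delta> | length \<delta> < m. (norm (coeff X \<delta>))\<^sup>2) \<le> (norm X)\<^sup>2"
    by (rule sum_le_norm_ell2_sq[OF finite_words_less])
  moreover have "0 \<le> (\<Sum>\<delta> | length \<delta> = m. (norm (state X \<delta>))\<^sup>2)"
    "0 \<le> (\<Sum>\<delta> | length \<delta> < m. (norm (theta X \<delta>))\<^sup>2)" by (simp_all add: sum_nonneg)
  ultimately show "(\<Sum>\<delta> | length \<delta> = m. (norm (state X \<delta>))\<^sup>2) \<le> (norm X)\<^sup>2"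
    "(\<Sum>\<delta> | length \<delta> < m. (norm (theta X \<delta>))\<^sup>2) \<le> (norm X)\<^sup>2"
    using theta_balance[where m = m and X = X] by linarith+
qed

definition Theta :: "('n list, 'h ^ 'n) ell2 \<Rightarrow> ('n list, 'h) ell2" where
  "Theta X = Abs_ell2 (theta X)"

lemma coeff_Theta: "coeff (Theta X) = theta X"
  using words_square_summableI[OF theta_sum_le, of X] by (simp add: Theta_def Abs_ell2_inverse)

text \<open>The pairing of state and costate telescopes by \<open>julia_adjoint\<close>. It is 0 at
  the root, and on level \<open>m\<close> it tends to 0 since states stay bounded while costates
  decay.\<close>

lemma Theta_adjoint: "cinner (Theta X) Y = cinner X (Psi Y)"
proof -
  let ?s = "\<lambda>m. \<Sum>\<delta> | length \<delta> = m. cinner (state X \<delta>) (costate Y \<delta>)"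
  have "(\<Sum>i\<in>UNIV. cinner (state X (\<delta> @ [i])) (costate Y (\<delta> @ [i]))) + cinner (theta X \<delta>) (coeff Y \<delta>)
      = cinner (state X \<delta>) (costate Y \<delta>) + cinner (coeff X \<delta>) (psi Y \<delta>)" for \<delta>
  proof -
    have "(\<Sum>i\<in>UNIV. cinner (state X (\<delta> @ [i])) (costate Y (\<delta> @ [i])))
        = cinner (adj A (state X \<delta>) + E (coeff X \<delta>)) (\<chi> i. costate Y (\<delta> @ [i]))"
      by (simp only: state_snoc cinner_vec_def vec_lambda_beta)
    then show ?thesis
      unfolding theta_def psi_def costate_rec[of Y \<delta>] using julia_adjoint by simp
  qed
  from energy_balance[of "\<lambda>\<delta>. cinner (state X \<delta>) (costate Y \<delta>)"
      "\<lambda>\<delta>. cinner (theta X \<delta>) (coeff Y \<delta>)" "\<lambda>\<delta>. cinner (coeff X \<delta>) (psi Y \<delta>)", OF this]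
  have bal: "?s m + (\<Sum>\<delta> | length \<delta> < m. cinner (coeff (Theta X) \<delta>) (coeff Y \<delta>))
      = (\<Sum>\<delta> | length \<delta> < m. cinner (coeff X \<delta>) (coeff (Psi Y) \<delta>))" for m
    by (simp add: state_Nil coeff_Theta coeff_Psi)
  have "?s \<longlonglongrightarrow> 0"
  proof (rule Lim_null_comparison[OF always_eventually[OF allI]])
    fix m
    have "norm (?s m) \<le> (\<Sum>\<delta> | length \<delta> = m. \<bar>norm (state X \<delta>)\<bar> * \<bar>norm (pull ((@) \<delta>) Y)\<bar>)"
      by (rule order_trans[OF norm_sum sum_mono], rule order_trans[OF norm_cinner_le])
        (auto intro!: mult_mono costate_le)
    \<comment> \<open>Cauchy-Schwarz over level \<open>m\<close>.\<close>
    also have "\<dots> \<le> L2_set (\<lambda>\<delta>. norm (state X \<delta>)) {\<delta>. length \<delta> = m}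
        * L2_set (\<lambda>\<delta>. norm (pull ((@) \<delta>) Y)) {\<delta>. length \<delta> = m}"
      by (rule L2_set_mult_ineq)
    also have "\<dots> \<le> sqrt ((norm X)\<^sup>2) * sqrt (\<Sum>\<delta> | length \<delta> = m. (norm (pull ((@) \<delta>) Y))\<^sup>2)"
      unfolding L2_set_def
      by (intro mult_mono real_sqrt_le_mono state_sum_le order_refl) (auto intro: sum_nonneg)
    finally show "norm (?s m) \<le> norm X * sqrt (\<Sum>\<delta> | length \<delta> = m. (norm (pull ((@) \<delta>) Y))\<^sup>2)"
      by simp
  next
    have "(\<lambda>m. norm X * sqrt (\<Sum>\<delta> | length \<delta> = m. (norm (pull ((@) \<delta>) Y))\<^sup>2)) \<longlonglongrightarrow> norm X * sqrt 0"
      by (intro tendsto_intros pull_append_tail)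
    then show "(\<lambda>m. norm X * sqrt (\<Sum>\<delta> | length \<delta> = m. (norm (pull ((@) \<delta>) Y))\<^sup>2)) \<longlonglongrightarrow> 0"
      by simp
  qed
  then have "(\<lambda>m. ?s m + (\<Sum>\<delta> | length \<delta> < m. cinner (coeff (Theta X) \<delta>) (coeff Y \<delta>)))
      \<longlonglongrightarrow> 0 + cinner (Theta X) Y"
    by (intro tendsto_add words_less_limit cinner_ell2_has_sum)
  moreover have "(\<lambda>m. ?s m + (\<Sum>\<delta> | length \<delta> < m. cinner (coeff (Theta X) \<delta>) (coeff Y \<delta>)))
      \<longlonglongrightarrow> cinner X (Psi Y)"
    unfolding bal by (intro words_less_limit cinner_ell2_has_sum)
  ultimately show ?thesis using LIMSEQ_unique by fastforce
qed

text \<open>With \<open>Psi\<close> as the adjoint of \<open>Theta\<close>, this is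
  \<open>Psi_isometry\<close> tested against an arbitrary vector.\<close>

theorem Theta_Psi_K: "Y - Theta (Psi Y) = K (adj K Y)"
proof (rule cinner_ext)
  fix Z
  have "cinner Z (Theta (Psi Y)) = cinner (Psi Z) (Psi Y)"
    by (metis Theta_adjoint cinner_commute)
  then show "cinner Z (Y - Theta (Psi Y)) = cinner Z (K (adj K Y))"
    using Psi_isometry[of Z Y] by (simp add: cinner_diff_right cinner_adj'[OF K, symmetric])
qed


subsection \<open>The radial approximants\<close>

text \<open>The fixed point equation of \<open>step r X\<close> is
  \<open>Z - \<Sum> r R\<^sub>i \<otimes> T\<^sub>i\<^sup>* Z = r [R\<^sub>1 \<otimes> I, \<dots>, R\<^sub>n \<otimes> I] (I \<otimes> E) X\<close>.\<close>

definition "step r X Z = r *\<^sub>R spread (coeffwise (adj A) Z + coeffwise E X)"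

lemma step_contraction:
  assumes "0 \<le> r"
  shows "dist (step r X Z) (step r X Z') \<le> r * dist Z Z'"
proof -
  have "step r X Z - step r X Z' = r *\<^sub>R spread (coeffwise (adj A) (Z - Z'))"
    by (simp add: step_def bop_add[OF spread_bop] bop_diff[OF spread_bop]
        bop_diff[OF coeffwise_bop[OF adj_A]] scaleR_diff_right scaleR_add_right)
  moreover have "norm (coeffwise (adj A) (Z - Z')) \<le> 1 * norm (Z - Z')"
    by (rule norm_coeffwise_le[OF adj_A]) (simp_all add: adj_A_le)
  ultimately show ?thesis using assms by (simp add: dist_norm norm_spread mult_left_mono)
qed

definition "radial_state r X = (THE Z. step r X Z = Z)"

lemma radial_state_unique:
  assumes "0 \<le> r" "r < 1" "step r X Z = Z"
  shows "radial_state r X = Z"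
proof -
  have "\<exists>!Z. step r X Z = Z"
    using assms step_contraction by (intro banach_fix_type[of r]) auto
  then show ?thesis unfolding radial_state_def using assms(3) by (rule the1_equality)
qed

text \<open>Banach's fixed point theorem on a closed set mapped into itself: \<open>S = UNIV\<close>
  gives existence, \<open>S = slices_in M\<close> gives invariance of the state.\<close>

lemma radial_state_in:
  assumes "0 \<le> r" "r < 1" "closed S" "S \<noteq> {}" "step r X ` S \<subseteq> S"
  shows "radial_state r X \<in> S" "step r X (radial_state r X) = radial_state r X"
proof -
  have "\<exists>!Z\<in>S. step r X Z = Z"
    using assms step_contraction
    by (intro Banach_fix[of S r]) (auto simp: complete_eq_closed)
  then obtain Z where "Z \<in> S" "step r X Z = Z" by blast
  then show "radial_state r X \<in> S" "step r X (radial_state r X) = radial_state r X"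
    using radial_state_unique assms by auto
qed

lemma radial_state: "0 \<le> r \<Longrightarrow> r < 1 \<Longrightarrow> step r X (radial_state r X) = radial_state r X"
  by (rule radial_state_in[of r UNIV]) auto

definition "radial_Theta r X = coeffwise D (radial_state r X) - coeffwise A X"

text \<open>Coefficientwise, the Julia isometry balances the state and the input against
  \<open>?U\<close> and the output. The state is \<open>r\<close> times an isometric image of
  \<open>?U\<close>, so it is no larger than \<open>?U\<close>, and the output no larger than the
  input.\<close>

lemma radial_Theta_le:
  assumes r: "0 \<le> r" "r < 1"
  shows "norm (radial_Theta r X) \<le> norm X"
proof -
  let ?Z = "radial_state r X" and ?U = "coeffwise (adj A) (radial_state r X) + coeffwise E X"
  have "((\<lambda>i. (norm (coeff ?U i))\<^sup>2 + (norm (coeff (radial_Theta r X) i))\<^sup>2) has_sum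
      (norm ?U)\<^sup>2 + (norm (radial_Theta r X))\<^sup>2) UNIV"
    by (intro has_sum_add norm_ell2_has_sum)
  moreover have "(norm (coeff ?U i))\<^sup>2 + (norm (coeff (radial_Theta r X) i))\<^sup>2
      = (norm (coeff ?Z i))\<^sup>2 + (norm (coeff X i))\<^sup>2" for i
    using arg_cong[OF julia_isometry[of "coeff ?Z i" "coeff X i" "coeff ?Z i" "coeff X i"], of Re]
    by (simp add: cinner_self coeff_simps coeff_coeffwise A adj_A D E radial_Theta_def)
  ultimately have "((\<lambda>i. (norm (coeff ?Z i))\<^sup>2 + (norm (coeff X i))\<^sup>2) has_sum
      (norm ?U)\<^sup>2 + (norm (radial_Theta r X))\<^sup>2) UNIV" by simp
  moreover have "((\<lambda>i. (norm (coeff ?Z i))\<^sup>2 + (norm (coeff X i))\<^sup>2) has_sum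
      (norm ?Z)\<^sup>2 + (norm X)\<^sup>2) UNIV"
    by (intro has_sum_add norm_ell2_has_sum)
  ultimately have eq: "(norm ?U)\<^sup>2 + (norm (radial_Theta r X))\<^sup>2 = (norm ?Z)\<^sup>2 + (norm X)\<^sup>2"
    by (rule has_sum_unique)
  have "norm ?Z = r * norm ?U"
    by (subst radial_state[OF r, symmetric]) (use r in \<open>simp add: step_def norm_spread\<close>)
  also have "\<dots> \<le> norm ?U" using r by (simp add: mult_left_le_one_le)
  finally have "(norm ?Z)\<^sup>2 \<le> (norm ?U)\<^sup>2" by (rule power_mono) simp
  then have "(norm (radial_Theta r X))\<^sup>2 \<le> (norm X)\<^sup>2" using eq by linarith
  then show ?thesis by (rule power2_le_imp_le) simp
qed

lemma radial_Theta_diff: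
  assumes r: "0 \<le> r" "r < 1"
  shows "radial_Theta r X - radial_Theta r X' = radial_Theta r (X - X')"
proof -
  have eq: "radial_state r (X - X') = radial_state r X - radial_state r X'"
  proof (rule radial_state_unique[OF r])
    have "step r (X - X') (radial_state r X - radial_state r X')
        = step r X (radial_state r X) - step r X' (radial_state r X')"
      by (simp add: step_def bop_diff[OF coeffwise_bop] adj_A E algebra_simps
          flip: scaleR_diff_right bop_diff[OF spread_bop])
    then show "step r (X - X') (radial_state r X - radial_state r X')
        = radial_state r X - radial_state r X'" by (simp add: radial_state[OF r])
  qed
  show ?thesis
    unfolding radial_Theta_def eq by (simp add: bop_diff[OF coeffwise_bop] A D)
qed

text \<open>Each letter contributes one factor \<open>r\<close> in the fixed point equation, so the
  state for the dilated input is the dilated forward state.\<close>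

lemma radial_Theta_dilation:
  assumes r: "0 \<le> r" "r < 1"
  shows "radial_Theta r (dilation r X) = dilation r (Theta X)"
proof -
  have r': "0 \<le> r" "r \<le> 1" using r by auto
  let ?Z = "radial_state r (dilation r X)"
  have Z: "coeff ?Z \<delta> = r ^ length \<delta> *\<^sub>R state X \<delta>" for \<delta>
  proof (induction \<delta> rule: rev_induct)
    case Nil
    show ?case
      by (subst radial_state[OF r, symmetric])
        (simp add: step_def coeff_simps coeff_spread_Nil state_Nil)
  next
    case (snoc i \<delta>)
    have "coeff ?Z (\<delta> @ [i])
        = r *\<^sub>R (adj A (coeff ?Z \<delta>) + E (r ^ length \<delta> *\<^sub>R coeff X \<delta>)) $ i"
      by (subst radial_state[OF r, symmetric])
        (simp add: step_def coeff_simps coeff_spread_snoc coeff_coeffwise adj_A E coeff_dilation[OF r'])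
    then show ?case
      by (simp add: snoc state_snoc bop_scaleR[OF adj_A] bop_scaleR[OF E] scaleR_add_right)
  qed
  show ?thesis
    by (intro ell2_eqI)
      (simp add: radial_Theta_def coeff_simps coeff_coeffwise A D Z coeff_dilation[OF r'] coeff_Theta
        theta_def bop_scaleR[OF D] bop_scaleR[OF A] scaleR_diff_right)
qed

text \<open>On dilated inputs the approximant is known exactly; the error
  \<open>X - dilation r X\<close> is controlled by contractivity.\<close>

lemma radial_Theta_tendsto: "((\<lambda>r. radial_Theta r X) \<longlongrightarrow> Theta X) (at_left 1)"
proof (rule LIM_zero_cancel, rule Lim_null_comparison)
  show "\<forall>\<^sub>F r in at_left 1. norm (radial_Theta r X - Theta X)
      \<le> norm (dilation r X - X) + norm (dilation r (Theta X) - Theta X)"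
    using eventually_at_left_1
  proof eventually_elim
    case (elim r)
    then have r: "0 \<le> r" "r < 1" by auto
    have "radial_Theta r X - Theta X
        = radial_Theta r (X - dilation r X) + (dilation r (Theta X) - Theta X)"
      by (simp add: radial_Theta_diff[OF r, symmetric] radial_Theta_dilation[OF r])
    then have "norm (radial_Theta r X - Theta X)
        \<le> norm (radial_Theta r (X - dilation r X)) + norm (dilation r (Theta X) - Theta X)"
      by (metis norm_triangle_ineq)
    then show ?case
      using radial_Theta_le[OF r, of "X - dilation r X"] by (simp add: norm_minus_commute[of X])
  qed
  show "((\<lambda>r. norm (dilation r X - X) + norm (dilation r (Theta X) - Theta X)) \<longlongrightarrow> 0) (at_left 1)"
    by (intro tendsto_add_zero tendsto_norm_zero LIM_zero dilation_tendsto)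
qed

section \<open>Invariance of the forward system on subspaces stable under right creation\<close>

context
  fixes M :: "'n fock set"
  assumes M: "csubspace M" "closed M"
    and inv: "\<And>i f. f \<in> M \<Longrightarrow> right_creation i f \<in> M"
begin

lemma step_slices_in: "X \<in> slices_in M \<Longrightarrow> Z \<in> slices_in M \<Longrightarrow> step r X Z \<in> slices_in M"
  unfolding step_def
  by (intro csubspace_scaleR[OF csubspace_slices_in[OF M(1)]] slices_in_spread[OF M(1) inv]
      csubspace_add[OF csubspace_slices_in[OF M(1)]] slices_in_coeffwise adj_A E)

lemma radial_Theta_slices_in:
  assumes "0 \<le> r" "r < 1" "X \<in> slices_in M"
  shows "radial_Theta r X \<in> slices_in M"
proof -
  have "radial_state r X \<in> slices_in M"
    by (rule radial_state_in[OF assms(1,2) closed_slices_in[OF M(2)]])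
      (use csubspace_0[OF csubspace_slices_in[OF M(1)]] assms(3) in \<open>auto intro: step_slices_in\<close>)
  then show ?thesis
    unfolding radial_Theta_def
    by (intro csubspace_diff[OF csubspace_slices_in[OF M(1)]] slices_in_coeffwise A D assms)
qed

lemma Theta_slices_in:
  assumes "X \<in> slices_in M"
  shows "Theta X \<in> slices_in M"
proof (rule Lim_in_closed_set[OF closed_slices_in[OF M(2)] _ _ radial_Theta_tendsto])
  show "\<forall>\<^sub>F r in at_left 1. radial_Theta r X \<in> slices_in M"
    using eventually_at_left_1
    by eventually_elim (auto intro: radial_Theta_slices_in assms)
qed simp

end

end


section \<open>Co-invariance of \<open>N_space J\<close> under right creation\<close>

lemma norm_embed_le:
  assumes "inj_on h S" "\<And>i. i \<in> S \<Longrightarrow> coeff y i = coeff x (h i)" "\<And>i. i \<notin> S \<Longrightarrow> coeff y i = 0"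
  shows "norm y \<le> norm x"
proof (rule power2_le_imp_le)
  show "(norm y)\<^sup>2 \<le> (norm x)\<^sup>2"
    unfolding norm_ell2_sq[of y]
  proof (rule infsum_le_finite_sums)
    show "(\<lambda>i. (norm (coeff y i))\<^sup>2) summable_on UNIV"
      using coeff_square_summable[of y] by (simp add: square_summable_def)
    fix F :: "'a set" assume F: "finite F"
    have "(\<Sum>i\<in>F. (norm (coeff y i))\<^sup>2) = (\<Sum>i\<in>F \<inter> S. (norm (coeff x (h i)))\<^sup>2)"
      by (rule sum.mono_neutral_cong_right) (use F assms(2,3) in auto)
    also have "\<dots> = (\<Sum>j\<in>h ` (F \<inter> S). (norm (coeff x j))\<^sup>2)"
      by (subst sum.reindex) (auto intro: inj_on_subset[OF assms(1)])
    also have "\<dots> \<le> (norm x)\<^sup>2"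
      using F by (intro sum_le_norm_ell2_sq) auto
    finally show "(\<Sum>i\<in>F. (norm (coeff y i))\<^sup>2) \<le> (norm x)\<^sup>2" .
  qed
qed simp

lemma inj_on_butlast: "inj_on butlast {\<alpha>. \<alpha> \<noteq> [] \<and> last \<alpha> = i}"
  by (rule inj_on_inverseI[where g = "\<lambda>\<beta>. \<beta> @ [i]"]) auto

lemma right_creation_bop: "right_creation i \<in> bop UNIV UNIV"
proof (rule bopI)
  have "norm (right_creation i x) \<le> norm x" for x
    by (rule norm_embed_le[OF inj_on_butlast[of i]]) (auto simp: right_creation.rep_eq)
  then show "norm (right_creation i x) \<le> 1 * norm x" for x by simp
qed (auto intro!: ell2_eqI simp: right_creation.rep_eq coeff_simps scaleC_zero_right)

lemma right_shift_bop: "right_shift i \<in> bop UNIV UNIV"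
proof (rule bopI)
  have "norm (right_shift i x) \<le> norm x" for x
    by (rule norm_embed_le[OF inj_on_butlast[of i]]) (auto simp: right_shift.rep_eq)
  then show "norm (right_shift i x) \<le> 1 * norm x" for x by simp
qed (auto intro!: ell2_eqI simp: right_shift.rep_eq coeff_simps scaleC_zero_right)

lemma left_creation_bop: "left_creation i \<in> bop UNIV UNIV"
proof (rule bopI)
  have "inj_on tl {\<alpha>. \<alpha> \<noteq> [] \<and> hd \<alpha> = i}"
    by (auto simp: inj_on_def list.expand)
  then have "norm (left_creation i x) \<le> norm x" for x
    by (rule norm_embed_le) (auto simp: left_creation.rep_eq)
  then show "norm (left_creation i x) \<le> 1 * norm x" for x by simp
qed (auto intro!: ell2_eqI simp: left_creation.rep_eq coeff_simps scaleC_zero_right)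

lemma left_right_creation_commute:
  "left_creation i (right_creation j f) = right_creation j (left_creation i f)"
proof (rule ell2_eqI)
  fix \<alpha> :: "'a list"
  show "coeff (left_creation i (right_creation j f)) \<alpha> = coeff (right_creation j (left_creation i f)) \<alpha>"
  proof (cases \<alpha>)
    case (Cons a \<beta>)
    then show ?thesis
      by (cases \<beta> rule: rev_cases) (auto simp: left_creation.rep_eq right_creation.rep_eq)
  qed (simp add: left_creation.rep_eq right_creation.rep_eq)
qed

section \<open>The weak operator topology and the commutant of right creation\<close>

lemma topspace_wot: "topspace wot = bop UNIV UNIV"
  by (simp add: wot_def topspace_pullback_topology)

lemma continuous_map_wot: "continuous_map wot euclidean (\<lambda>A. cinner (A x) y)"
proof -
  have "continuous_map wot euclidean
      ((\<lambda>\<phi>. \<phi> (x, y)) \<circ> (\<lambda>(A :: 'a \<Rightarrow> 'a) (x, y). cinner (A x) y))"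
    unfolding wot_def
    by (rule continuous_map_pullback) (rule continuous_map_product_projection, simp)
  then show ?thesis by (simp add: comp_def)
qed

lemma wot_closed_algebra_commutant:
  assumes "\<And>i. R i \<in> bop UNIV UNIV"
  shows "wot_closed_algebra {A \<in> bop UNIV UNIV. \<forall>i f. A (R i f) = R i (A f)}"
proof -
  let ?S = "{A \<in> bop UNIV UNIV. \<forall>i f. A (R i f) = R i (A f)}"
  \<comment> \<open>Moving \<open>R i\<close> to the other side leaves only matrix coefficients of
    \<open>A\<close>, which are WOT-continuous; hence the commutant is closed.\<close>
  have eq: "?S = (\<Inter>i. \<Inter>f. \<Inter>g. {A \<in> topspace wot. cinner (A (R i f)) g - cinner (A f) (adj (R i) g) \<in> {0}})"
  proof -
    have "A (R i f) = R i (A f) \<longleftrightarrow> (\<forall>g. cinner (A (R i f)) g - cinner (A f) (adj (R i) g) = 0)"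
      for A :: "'b \<Rightarrow> 'b" and i f
      unfolding cinner_adj[OF assms, symmetric]
      by (metis cinner_diff_left cinner_self_eq_0 cinner_zero_left eq_iff_diff_eq_0)
    then show ?thesis by (auto simp: topspace_wot)
  qed
  have closed: "closedin wot {A \<in> topspace wot. cinner (A (R i f)) g - cinner (A f) (adj (R i) g) \<in> {0}}"
    for i f g
    by (rule closedin_continuous_map_preimage[OF continuous_map_diff[OF continuous_map_wot continuous_map_wot]])
      simp
  have "closedin wot ?S"
    by (subst eq) (rule closedin_INT[OF UNIV_not_empty], rule closedin_INT[OF UNIV_not_empty],
        rule closedin_INT[OF UNIV_not_empty], rule closed)
  moreover have "(\<lambda>x. A x + B x) \<in> bop UNIV UNIV" if "A \<in> ?S" "B \<in> ?S" for A B
    using that by (intro bounded_linear_bop[OF bounded_linear_add[OF bop_bounded_linear bop_bounded_linear]])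
      (auto simp: bop_scaleC scaleC_add_right)
  moreover have "(\<lambda>x. c *\<^sub>C A x) \<in> bop UNIV UNIV" if "A \<in> ?S" for A c
    using that by (intro bounded_linear_bop[OF bounded_linear_compose[OF bounded_linear_scaleC bop_bounded_linear]])
      (auto simp: bop_scaleC scaleC_scaleC mult.commute)
  ultimately show ?thesis
    unfolding wot_closed_algebra_def
    by (auto intro: bop_comp simp: bop_add[OF assms] bop_scaleC[OF assms])
qed

lemma Finf_commutes:
  assumes "A \<in> Finf"
  shows "A (right_creation i f) = right_creation i (A f)"
proof -
  have "Finf \<subseteq> {A \<in> bop UNIV UNIV. \<forall>i f. A (right_creation i f) = right_creation i (A f)}"
    unfolding Finf_def
    by (rule hull_minimal)
      (auto simp: left_creation_bop left_right_creation_commute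
        intro: wot_closed_algebra_commutant right_creation_bop)
  then show ?thesis using assms by auto
qed

lemma N_space_eq: "N_space J = orth_compl {A f |A f. A \<in> J}"
  by (simp add: N_space_def orth_compl_closed_cspan)

lemma csubspace_N_space: "csubspace (N_space J)" and closed_N_space: "closed (N_space J)"
  by (simp_all add: N_space_def csubspace_orth_compl closed_orth_compl)

text \<open>The adjoint of right creation preserves \<open>N_space J\<close>: against
  \<open>A h\<close> it gives \<open>cinner f (A (right_creation i h))\<close>, which vanishes.
  Dualising yields the invariance of the complement.\<close>

lemma right_creation_orth_N_space:
  assumes "J \<subseteq> Finf" "g \<in> orth_compl (N_space J)"
  shows "right_creation i g \<in> orth_compl (N_space J)"
proof -
  have "adj (right_creation i) f \<in> N_space J" if f: "f \<in> N_space J" for f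
  proof -
    have "cinner (adj (right_creation i) f) (A h) = 0" if A: "A \<in> J" for A h
    proof -
      have "cinner (adj (right_creation i) f) (A h) = cinner f (A (right_creation i h))"
        using A assms(1) by (simp add: cinner_adj'[OF right_creation_bop] Finf_commutes subsetD)
      also have "\<dots> = 0" using f A by (auto simp: N_space_eq orth_compl_def)
      finally show ?thesis .
    qed
    then show ?thesis by (auto simp: N_space_eq orth_compl_def)
  qed
  then have "cinner (right_creation i g) f = 0" if "f \<in> N_space J" for f
    using that assms(2) by (auto simp: cinner_adj[OF right_creation_bop] orth_compl_def)
  then show ?thesis by (simp add: orth_compl_def)
qed


section \<open>Compression to \<open>N_space J\<close>\<close>

lemma tensor_scaleR_left: "(r *\<^sub>R f) \<otimes>\<^sub>v k = r *\<^sub>R (f \<otimes>\<^sub>v k)"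
  by (rule ell2_eqI)
    (simp add: tensor.rep_eq coeff_simps scaleR_scaleC scaleC_scaleC scaleC_complex_def)

lemma bop_sum: "f \<in> bop UNIV UNIV \<Longrightarrow> f (\<Sum>i\<in>I. x i) = (\<Sum>i\<in>I. f (x i))"
  by (rule linear_sum[OF bounded_linear.linear[OF bop_bounded_linear]])

lemma csubspace_range: "f \<in> bop UNIV UNIV \<Longrightarrow> csubspace (range f)"
  unfolding csubspace_def
  by (auto simp: image_iff) (metis bop_zero, metis bop_add, metis bop_scaleC)

section \<open>The compressed system and the constrained identity\<close>

locale constrained = row_contr T for T :: "'n::finite \<Rightarrow> 'h \<Rightarrow> 'h::chilbert_space" +
  fixes J :: "('n fock \<Rightarrow> 'n fock) set"
  assumes J_subset: "J \<subseteq> Finf"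
begin

abbreviation "N \<equiv> N_space J"
abbreviation "Q \<equiv> proj (slices_in N)"

lemmas N = csubspace_N_space[of J] closed_N_space[of J]
lemmas NH = csubspace_slices_in[OF N(1)] closed_slices_in[OF N(2)]
lemmas Q = bop_proj[OF NH]

lemma Q_eq_0: "x \<in> slices_in (orth_compl N) \<Longrightarrow> Q x = 0"
  by (rule proj_eqI[OF NH(1) csubspace_0[OF NH(1)]]) (simp add: orth_compl_slices_in[OF N])

lemma diff_Q: "x - Q x \<in> slices_in (orth_compl N)"
  using proj_orth[OF NH] by (simp add: orth_compl_slices_in[OF N])

lemmas orth_inv = right_creation_orth_N_space[OF J_subset]
lemmas orth_N = csubspace_orth_compl[of N] closed_orth_compl[of N]

lemma defect_spaces:
  "csubspace (defect_space T)" "closed (defect_space T)"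
  "csubspace (defect_star_space T)" "closed (defect_star_space T)"
  by (simp_all add: defect_space_def defect_star_space_def defect_eq defect_star_eq
      csubspace_closure csubspace_range D E)

lemma tensor_op_W:
  assumes B: "B \<in> bop UNIV UNIV" and Z: "Z \<in> slices_in N"
  shows "tensor_op N UNIV (\<lambda>f. r *\<^sub>R W_op J i f) B Z = r *\<^sub>R Q (right_shift i (coeffwise B Z))"
proof (rule tensor_op_eq)
  have "bounded_linear (\<lambda>Z. r *\<^sub>R Q (right_shift i (coeffwise B Z)))"
    by (intro bounded_linear_const_scaleR bounded_linear_compose[OF bop_bounded_linear[OF Q]]
        bounded_linear_compose[OF bop_bounded_linear[OF right_shift_bop]]
        bop_bounded_linear coeffwise_bop B)
  then have "(\<lambda>Z. r *\<^sub>R Q (right_shift i (coeffwise B Z))) \<in> bop UNIV UNIV"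
    by (rule bounded_linear_bop)
      (simp add: bop_scaleC[OF Q] bop_scaleC[OF right_shift_bop] bop_scaleC[OF coeffwise_bop[OF B]]
        scaleR_scaleC scaleC_scaleC mult.commute)
  then show "(\<lambda>Z. r *\<^sub>R Q (right_shift i (coeffwise B Z))) \<in> bop (N \<otimes>\<^sub>s UNIV) UNIV"
    by (rule bop_subset)
  show "r *\<^sub>R Q (right_shift i (coeffwise B (f \<otimes>\<^sub>v k))) = (r *\<^sub>R W_op J i f) \<otimes>\<^sub>v B k" for f k
    by (simp add: coeffwise_tensor[OF B] right_shift_tensor proj_slices_in_tensor[OF N] W_op_def
        tensor_scaleR_left)
qed (use Z in \<open>simp add: tensor_space_UNIV[OF N]\<close>)

lemma sum_tensor_op_W:
  assumes "Z \<in> slices_in N"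
  shows "(\<Sum>i\<in>UNIV. tensor_op N UNIV (\<lambda>f. r *\<^sub>R W_op J i f) (adj (T i)) Z)
    = r *\<^sub>R Q (spread (coeffwise (adj A) Z))"
proof -
  have "coeffwise (adj (T i)) Z = coeffwise (\<lambda>v. v $ i) (coeffwise (adj A) Z)" for i
    by (intro ell2_eqI) (simp add: coeff_coeffwise adj_bop[OF T] vec_nth_bop adj_A adj_A_nth)
  then show ?thesis
    by (simp add: tensor_op_W[OF adj_bop[OF T] assms] spread_def bop_sum[OF Q] scaleR_sum_right)
qed

text \<open>Since \<open>slices_in (orth_compl N)\<close> is invariant under the forward system, compressing the
  system to \<open>N \<otimes> H\<close> amounts to applying \<open>Q\<close> to its state and output.\<close>

lemma fourier_expr_eq:
  assumes r: "0 \<le> r" "r < 1" and X: "X \<in> N \<otimes>\<^sub>s defect_star_space T"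
  shows "fourier_expr N (\<lambda>i f. r *\<^sub>R W_op J i f) T X = Q (radial_Theta r X)"
proof -
  have XN: "X \<in> slices_in N"
    using X tensor_space_eq[OF N defect_spaces(3,4)] by blast
  define Z where "Z = radial_state r X"
  define g where "g = (\<lambda>Z. Z - (\<Sum>i\<in>UNIV. tensor_op N UNIV (\<lambda>f. r *\<^sub>R W_op J i f) (adj (T i)) Z))"
  have g: "g Z = Z - r *\<^sub>R Q (spread (coeffwise (adj A) Z))" if "Z \<in> slices_in N" for Z
    using that by (simp add: g_def sum_tensor_op_W)
  have QZ: "Q Z \<in> slices_in N" by (rule proj_mem[OF NH])
  have input: "(\<Sum>i\<in>UNIV. tensor_op N UNIV (\<lambda>f. r *\<^sub>R W_op J i f) id
      (tensor_op N UNIV id (\<lambda>v. v $ i) (tensor_op N (defect_star_space T) id (defect_star T) X)))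
      = r *\<^sub>R Q (spread (coeffwise E X))"
  proof -
    have EX: "coeffwise E X \<in> slices_in N" by (rule slices_in_coeffwise[OF E XN])
    have id: "coeffwise id V = V" for V :: "('n list, 'h) ell2"
      by (intro ell2_eqI) (simp add: coeff_coeffwise)
    have "tensor_op N UNIV (\<lambda>f. r *\<^sub>R W_op J i f) id (tensor_op N UNIV id (\<lambda>v. v $ i) (coeffwise E X))
        = r *\<^sub>R Q (right_shift i (coeffwise (\<lambda>v. v $ i) (coeffwise E X)))" for i
      using EX slices_in_coeffwise[OF vec_nth_bop EX]
      by (simp add: tensor_op_W tensor_op_id vec_nth_bop tensor_space_UNIV[OF N] id)
    then show ?thesis
      by (simp add: defect_star_eq tensor_op_id[OF E X] spread_def bop_sum[OF Q] scaleR_sum_right)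
  qed
  have "g (Q Z) = r *\<^sub>R Q (spread (coeffwise E X))"
  proof -
    \<comment> \<open>The part of the state outside \<open>slices_in N\<close> stays in the
      invariant complement and never feeds back into the compressed equation.\<close>
    have "Q (spread (coeffwise (adj A) (Z - Q Z))) = 0"
      by (intro Q_eq_0 slices_in_spread[OF orth_N(1) orth_inv] slices_in_coeffwise[OF adj_A] diff_Q)
    then have "Q (spread (coeffwise (adj A) (Q Z))) = Q (spread (coeffwise (adj A) Z))"
      by (simp add: bop_diff[OF coeffwise_bop[OF adj_A]] bop_diff[OF spread_bop] bop_diff[OF Q])
    then have gQZ: "g (Q Z) = Q Z - r *\<^sub>R Q (spread (coeffwise (adj A) Z))"
      by (simp add: g[OF QZ])
    have "Q Z = Q (step r X Z)" using radial_state[OF r] by (simp add: Z_def)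
    also have "\<dots> = r *\<^sub>R Q (spread (coeffwise (adj A) Z)) + r *\<^sub>R Q (spread (coeffwise E X))"
      by (simp add: step_def bop_scaleR[OF Q] bop_add[OF spread_bop] bop_add[OF Q] scaleR_add_right)
    finally show ?thesis using gQZ by simp
  qed
  \<comment> \<open>Injectivity makes \<open>inv_into\<close> return \<open>Q Z\<close> and no other
    preimage; a difference of two preimages is fixed by a map of norm at most
    \<open>r < 1\<close>.\<close>
  moreover have "inj_on g (slices_in N)"
  proof (rule inj_onI)
    fix U V assume UV: "U \<in> slices_in N" "V \<in> slices_in N" "g U = g V"
    have "U - V = r *\<^sub>R Q (spread (coeffwise (adj A) (U - V)))"
      using UV by (simp add: g bop_diff[OF coeffwise_bop[OF adj_A]] bop_diff[OF spread_bop]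
          bop_diff[OF Q] scaleR_diff_right algebra_simps)
    then have "norm (U - V) = r * norm (Q (spread (coeffwise (adj A) (U - V))))"
      using r by (metis abs_of_nonneg norm_scaleR)
    also have "\<dots> \<le> r * norm (U - V)"
      using norm_proj_le[OF NH, of "spread (coeffwise (adj A) (U - V))"]
        norm_coeffwise_le[OF adj_A, of 1 "U - V"] adj_A_le r
      by (intro mult_left_mono) (auto simp: norm_spread)
    finally have "(1 - r) * norm (U - V) \<le> 0" by (simp add: algebra_simps)
    then show "U = V" using r by (simp add: mult_le_0_iff)
  qed
  ultimately have inv: "inv_into (slices_in N) g (r *\<^sub>R Q (spread (coeffwise E X))) = Q Z"
    using QZ by (intro inv_into_f_eq)
  have "fourier_expr N (\<lambda>i f. r *\<^sub>R W_op J i f) T X = - coeffwise A X + coeffwise D (Q Z)"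
    unfolding fourier_expr_def input
    using inv QZ
    by (simp add: tensor_space_UNIV[OF N] g_def[symmetric] tensor_op_id[OF A X] defect_eq
        tensor_op_id[OF D])
  also have "\<dots> = Q (radial_Theta r X)"
  proof (rule proj_eqI[OF NH(1), symmetric])
    show "- coeffwise A X + coeffwise D (Q Z) \<in> slices_in N"
      by (intro csubspace_add[OF NH(1)] csubspace_minus[OF NH(1)] slices_in_coeffwise A D XN QZ)
    have "radial_Theta r X - (- coeffwise A X + coeffwise D (Q Z)) = coeffwise D (Z - Q Z)"
      by (simp add: radial_Theta_def Z_def bop_diff[OF coeffwise_bop[OF D]])
    also have "\<dots> \<in> orth_compl (slices_in N)"
      unfolding orth_compl_slices_in[OF N] by (rule slices_in_coeffwise[OF D diff_Q])
    finally show "radial_Theta r X - (- coeffwise A X + coeffwise D (Q Z)) \<in> orth_compl (slices_in N)" .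
  qed
  finally show ?thesis .
qed

lemma constrained_char_fun_eq:
  assumes "X \<in> N \<otimes>\<^sub>s defect_star_space T"
  shows "constrained_char_fun J T X = Q (Theta X)"
  unfolding constrained_char_fun_def
proof (rule tendsto_Lim)
  have "\<forall>\<^sub>F r in at_left 1. Q (radial_Theta r X) = fourier_expr N (\<lambda>i f. r *\<^sub>R W_op J i f) T X"
    using eventually_at_left_1
    by eventually_elim (simp add: fourier_expr_eq[OF _ _ assms])
  then show "((\<lambda>r. fourier_expr N (\<lambda>i f. r *\<^sub>R W_op J i f) T X) \<longlongrightarrow> Q (Theta X)) (at_left 1)"
    by (rule tendsto_cong[THEN iffD1])
      (rule bounded_linear.tendsto[OF bop_bounded_linear[OF Q] radial_Theta_tendsto])
qed simp

text \<open>\<open>Theta\<close> preserves the complement of \<open>slices_in N\<close>, so its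
  adjoint \<open>Psi\<close> preserves \<open>slices_in N\<close>. The coefficients lie in the right
  defect space because \<open>adj_A_D\<close> sends the range of \<open>D\<close> into that of
  \<open>E\<close>.\<close>

lemma Psi_in:
  assumes "Y \<in> N \<otimes>\<^sub>s defect_space T"
  shows "Psi Y \<in> N \<otimes>\<^sub>s defect_star_space T"
proof -
  have Y: "Y \<in> slices_in N" "\<And>\<delta>. coeff Y \<delta> \<in> defect_space T"
    using assms by (auto simp: tensor_space_eq[OF N defect_spaces(1,2)])
  have "cinner (Psi Y) X = 0" if "X \<in> slices_in (orth_compl N)" for X
  proof -
    have "Theta X \<in> orth_compl (slices_in N)"
      unfolding orth_compl_slices_in[OF N]
      by (rule Theta_slices_in[OF orth_N orth_inv that])
    then have "cinner (Theta X) Y = 0" using Y(1) by (auto simp: orth_compl_def)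
    then show ?thesis by (simp add: Theta_adjoint cinner_eq_0_commute)
  qed
  then have "Psi Y \<in> orth_compl (orth_compl (slices_in N))"
    by (simp add: orth_compl_slices_in[OF N]) (simp add: orth_compl_def)
  then have "Psi Y \<in> slices_in N"
    by (simp add: orth_compl_orth_compl csubspace_slices_in closed_slices_in N)
  moreover have "coeff (Psi Y) \<delta> \<in> defect_star_space T" for \<delta>
  proof -
    have "adj A ` range D \<subseteq> range E" by (auto simp: adj_A_D)
    then have "adj A ` closure (range D) \<subseteq> closure (range E)"
      by (rule order_trans[OF closure_bounded_linear_image_subset[OF bop_bounded_linear[OF adj_A]]
            closure_mono])
    then have "adj A (coeff Y \<delta>) \<in> defect_star_space T"
      using Y(2)[of \<delta>] by (auto simp: defect_space_def defect_star_space_def defect_eq defect_star_eq)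
    moreover have "E v \<in> defect_star_space T" for v
      using closure_subset[of "range E"] by (auto simp: defect_star_space_def defect_star_eq)
    ultimately show ?thesis
      unfolding coeff_Psi psi_def by (intro csubspace_diff[OF defect_spaces(3)])
  qed
  ultimately show ?thesis by (simp add: tensor_space_eq[OF N defect_spaces(3,4)])
qed

text \<open>The projection moves onto \<open>Y\<close>, which it fixes; \<open>Psi_in\<close> places
  the result in the domain, as \<open>adj_on\<close> demands.\<close>

lemma adj_constrained_char_fun:
  assumes "Y \<in> N \<otimes>\<^sub>s defect_space T"
  shows "adj_on (N \<otimes>\<^sub>s defect_star_space T) (constrained_char_fun J T) Y = Psi Y"
proof (rule adj_on_eqI)
  show "csubspace (N \<otimes>\<^sub>s defect_star_space T)"
    by (simp add: tensor_space_def csubspace_closed_cspan)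
  show "cinner (constrained_char_fun J T X) Y = cinner X (Psi Y)"
    if "X \<in> N \<otimes>\<^sub>s defect_star_space T" for X
    using assms that
    by (simp add: constrained_char_fun_eq cinner_proj[OF NH] Theta_adjoint
        tensor_space_eq[OF N defect_spaces(1,2)])
qed (rule Psi_in[OF assms])

text \<open>\<open>K h\<close> has its coefficients in the defect space, so it lies where
  \<open>tensor_op\<close> is determined.\<close>

lemma constrained_poisson_kernel_eq: "constrained_poisson_kernel J T h = Q (K h)"
  unfolding constrained_poisson_kernel_def poisson_kernel_eq
proof (rule tensor_op_eq)
  show "Q \<in> bop (UNIV \<otimes>\<^sub>s defect_space T) UNIV" by (rule bop_subset[OF Q])
  show "Q (f \<otimes>\<^sub>v k) = proj N f \<otimes>\<^sub>v id k" for f k by (simp add: proj_slices_in_tensor[OF N])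
  have "D v \<in> defect_space T" for v
    using closure_subset[of "range D"] by (auto simp: defect_space_def defect_eq)
  then show "K h \<in> UNIV \<otimes>\<^sub>s defect_space T"
    by (simp add: tensor_space_eq[OF csubspace_UNIV closed_UNIV defect_spaces(1,2)] slices_in_def coeff_K)
qed

text \<open>Apply \<open>Q\<close> to \<open>Theta_Psi_K\<close> at a vector \<open>Y\<close> fixed
  by \<open>Q\<close>; for such \<open>Y\<close> the adjoint of the constrained kernel agrees with
  \<open>adj K\<close>.\<close>

theorem constrained_factorization:
  assumes Y: "Y \<in> N \<otimes>\<^sub>s defect_space T"
  shows "Y - constrained_char_fun J T
      (adj_on (N \<otimes>\<^sub>s defect_star_space T) (constrained_char_fun J T) Y)
    = constrained_poisson_kernel J T (adj (constrained_poisson_kernel J T) Y)"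
proof -
  have YN: "Y \<in> slices_in N" using Y tensor_space_eq[OF N defect_spaces(1,2)] by blast
  have "adj (constrained_poisson_kernel J T) Y = adj K Y"
    by (rule adj_eqI) (simp add: constrained_poisson_kernel_eq cinner_proj[OF NH YN] cinner_adj[OF K])
  moreover have "Q (K (adj K Y)) = Y - Q (Theta (Psi Y))"
    by (simp add: Theta_Psi_K[symmetric] bop_diff[OF Q] proj_ident[OF NH(1) YN])
  ultimately show ?thesis
    by (simp add: adj_constrained_char_fun[OF Y] constrained_char_fun_eq[OF Psi_in[OF Y]]
        constrained_poisson_kernel_eq)
qed

end

theorem theorem4p1:
  fixes J :: "('n::finite fock \<Rightarrow> 'n fock) set"
    and P :: "('n list \<Rightarrow>\<^sub>0 complex) set"
    and T :: "'n \<Rightarrow> 'h \<Rightarrow> 'h::chilbert_space"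
  assumes "wot_closed_ideal J"
    and "J = wot_closed_ideal hull (poly_op left_creation ` P)"
    and "J \<noteq> Finf"
    and "row_contraction T"
    and "\<And>p x. p \<in> P \<Longrightarrow> poly_op T p x = 0"
  shows "\<forall>X \<in> N_space J \<otimes>\<^sub>s defect_space T.
    X - constrained_char_fun J T
          (adj_on (N_space J \<otimes>\<^sub>s defect_star_space T) (constrained_char_fun J T) X)
    = constrained_poisson_kernel J T (adj (constrained_poisson_kernel J T) X)"
proof -
  interpret constrained T J
    using assms(1,4) by unfold_locales (auto simp: wot_closed_ideal_def)
  show ?thesis using constrained_factorization by blast
qed

end
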